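(* Let $k$ be a perfect field of characteristic $2$, let $d\ge3$ be an odd integer, and let $f=\sum_{i+j\le d}c_{i,j}x^iy^j\in k[x,y]$ define (via its homogenization) a smooth plane projective curve $C/k$ of degree $d$, of genus $g=(d-1)(d-2)/2$. Then the rank of the Hasse–Witt matrix of $C$ is at least \[ g-\frac{d^2-1}{8}=\frac38(d-1)(d-3), \] and equality holds if and only if $c_{i,j}=0$ for all $(i,j)$ with $i$ and $j$ both odd. *)

theory Defs
  imports
    "HOL-Library.Poly_Mapping"
    "HOL-Library.Product_Plus"
    "HOL-Algebra.Algebraic_Closure_Type"
    "Jordan_Normal_Form.DL_Rank"
begin

definition perfect_field :: "'k::field itself \<Rightarrow> bool" where
  "perfect_field _ \<longleftrightarrow> CHAR('k) = 0 \<or> surj (\<lambda>x::'k. x ^ CHAR('k))"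

section \<open>Polynomials and smooth plane curves\<close>

text \<open>
  \<open>'k poly2\<close> is \<open>k[x,y]\<close> and \<open>'k poly3\<close> is \<open>k[X,Y,Z]\<close>; the keys are exponent vectors.
\<close>

type_synonym 'k poly2 = "(nat \<times> nat) \<Rightarrow>\<^sub>0 'k"
type_synonym 'k poly3 = "(nat \<times> nat \<times> nat) \<Rightarrow>\<^sub>0 'k"

text \<open>\<open>homogenize d f = Z^d f(X/Z, Y/Z)\<close>, intended for \<open>f\<close> of total degree at most \<open>d\<close>.\<close>

definition homogenize :: "nat \<Rightarrow> 'k::field poly2 \<Rightarrow> 'k poly3" where
  "homogenize d f = (\<Sum>(i, j)\<in>Poly_Mapping.keys f.
     Poly_Mapping.single (i, j, d - (i + j)) (Poly_Mapping.lookup f (i, j)))"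

definition eval3 :: "'k::field poly3 \<Rightarrow> 'k alg_closure \<Rightarrow> 'k alg_closure \<Rightarrow> 'k alg_closure \<Rightarrow> 'k alg_closure" where
  "eval3 F x y z = (\<Sum>(i, j, l)\<in>Poly_Mapping.keys F.
     to_ac (Poly_Mapping.lookup F (i, j, l)) * x ^ i * y ^ j * z ^ l)"

definition deriv_X :: "'k::field poly3 \<Rightarrow> 'k poly3" where
  "deriv_X F = (\<Sum>(i, j, l)\<in>Poly_Mapping.keys F.
     Poly_Mapping.single (i - 1, j, l) (of_nat i * Poly_Mapping.lookup F (i, j, l)))"

definition deriv_Y :: "'k::field poly3 \<Rightarrow> 'k poly3" where
  "deriv_Y F = (\<Sum>(i, j, l)\<in>Poly_Mapping.keys F.
     Poly_Mapping.single (i, j - 1, l) (of_nat j * Poly_Mapping.lookup F (i, j, l)))"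

definition deriv_Z :: "'k::field poly3 \<Rightarrow> 'k poly3" where
  "deriv_Z F = (\<Sum>(i, j, l)\<in>Poly_Mapping.keys F.
     Poly_Mapping.single (i, j, l - 1) (of_nat l * Poly_Mapping.lookup F (i, j, l)))"

text \<open>
  Smoothness over \<open>k\<close> of the curve \<open>F = 0\<close>, for homogeneous \<open>F\<close>: the Jacobian criterion at all
  points of the projective plane over the algebraic closure. It forces \<open>F \<noteq> 0\<close>.
\<close>

definition smooth_plane_curve :: "'k::field poly3 \<Rightarrow> bool" where
  "smooth_plane_curve F \<longleftrightarrow> (\<forall>x y z. (x, y, z) \<noteq> (0, 0, 0) \<and> eval3 F x y z = 0 \<longrightarrow>
     \<not> (eval3 (deriv_X F) x y z = 0 \<and> eval3 (deriv_Y F) x y z = 0 \<and> eval3 (deriv_Z F) x y z = 0))"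

section \<open>First cohomology of the structure sheaf\<close>

text \<open>
  Let \<open>C = Proj k[X,Y,Z]/(F)\<close> and index the coordinates \<open>X, Y, Z\<close> by \<open>0, 1, 2\<close>. We compute
  \<open>H^1(C, O_C)\<close> as the Cech cohomology of the affine cover by the \<open>U_i = {X_i \<noteq> 0}\<close>.
  For \<open>I \<subseteq> {0,1,2}\<close>, \<open>localized I\<close> is the localization of \<open>k[X,Y,Z]\<close> at the coordinates in \<open>I\<close>,
  as a subring of the ring of Laurent polynomials. The ring of sections of \<open>O_C\<close> over the
  intersection of the \<open>U_i\<close> with \<open>i \<in> I\<close> is \<open>sections I\<close> (the part of degree \<open>0\<close>) modulo
  \<open>sections_ideal F I\<close> (the part of degree \<open>0\<close> of the ideal generated by \<open>F\<close>).
\<close>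

type_synonym 'k laurent = "(int \<times> int \<times> int) \<Rightarrow>\<^sub>0 'k"

definition to_laurent :: "'k::field poly3 \<Rightarrow> 'k laurent" where
  "to_laurent F = (\<Sum>(i, j, l)\<in>Poly_Mapping.keys F.
     Poly_Mapping.single (int i, int j, int l) (Poly_Mapping.lookup F (i, j, l)))"

definition localized :: "nat set \<Rightarrow> 'k::field laurent set" where
  "localized I = {u. \<forall>(a, b, c)\<in>Poly_Mapping.keys u.
     (0 \<notin> I \<longrightarrow> 0 \<le> a) \<and> (1 \<notin> I \<longrightarrow> 0 \<le> b) \<and> (2 \<notin> I \<longrightarrow> 0 \<le> c)}"

definition sections :: "nat set \<Rightarrow> 'k::field laurent set" where
  "sections I = {u \<in> localized I. \<forall>(a, b, c)\<in>Poly_Mapping.keys u. a + b + c = 0}"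

definition sections_ideal :: "'k::field poly3 \<Rightarrow> nat set \<Rightarrow> 'k laurent set" where
  "sections_ideal F I = {u \<in> sections I. \<exists>q\<in>localized I. u = to_laurent F * q}"

text \<open>
  A 1-cochain is represented by a triple \<open>(u01, u02, u12)\<close> of Laurent polynomials. The cocycles and
  coboundaries below are the preimages of those of the Cech complex of \<open>O_C\<close>, so
  \<open>H^1(C, O_C) = cocycles F / coboundaries F\<close>.
\<close>

type_synonym 'k cochain = "'k laurent \<times> 'k laurent \<times> 'k laurent"

definition cocycles :: "'k::field poly3 \<Rightarrow> 'k cochain set" where
  "cocycles F = {(u01, u02, u12).
     u01 \<in> sections {0, 1} \<and> u02 \<in> sections {0, 2} \<and> u12 \<in> sections {1, 2} \<and>
     u12 - u02 + u01 \<in> sections_ideal F {0, 1, 2}}"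

definition coboundaries :: "'k::field poly3 \<Rightarrow> 'k cochain set" where
  "coboundaries F = {(u01, u02, u12). \<exists>v0\<in>sections {0}. \<exists>v1\<in>sections {1}. \<exists>v2\<in>sections {2}.
     u01 - (v1 - v0) \<in> sections_ideal F {0, 1} \<and>
     u02 - (v2 - v0) \<in> sections_ideal F {0, 2} \<and>
     u12 - (v2 - v1) \<in> sections_ideal F {1, 2}}"

definition scale_cochain :: "'k::field \<Rightarrow> 'k cochain \<Rightarrow> 'k cochain" where
  "scale_cochain r = (\<lambda>(u01, u02, u12).
     (Poly_Mapping.single 0 r * u01, Poly_Mapping.single 0 r * u02, Poly_Mapping.single 0 r * u12))"

text \<open>
  \<open>H1_coords F bs z r\<close>: the class of \<open>z\<close> in \<open>H^1(C, O_C)\<close> is the linear combination of the classes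
  of \<open>bs\<close> with coefficients \<open>r\<close>. \<open>H1_basis F bs\<close>: the classes of \<open>bs\<close> form a basis of \<open>H^1(C, O_C)\<close>.
\<close>

definition H1_coords :: "'k::field poly3 \<Rightarrow> 'k cochain list \<Rightarrow> 'k cochain \<Rightarrow> 'k vec \<Rightarrow> bool" where
  "H1_coords F bs z r \<longleftrightarrow> r \<in> carrier_vec (length bs) \<and>
     z - (\<Sum>i<length bs. scale_cochain (vec_index r i) (bs ! i)) \<in> coboundaries F"

definition H1_basis :: "'k::field poly3 \<Rightarrow> 'k cochain list \<Rightarrow> bool" where
  "H1_basis F bs \<longleftrightarrow> set bs \<subseteq> cocycles F \<and> (\<forall>z\<in>cocycles F. \<exists>!r. H1_coords F bs z r)"

text \<open>The genus of a smooth plane curve, as the dimension of \<open>H^1(C, O_C)\<close>.\<close>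

definition has_genus :: "'k::field poly3 \<Rightarrow> nat \<Rightarrow> bool" where
  "has_genus F g \<longleftrightarrow> (\<exists>bs. H1_basis F bs \<and> length bs = g)"

section \<open>The Hasse--Witt matrix\<close>

text \<open>
  The absolute Frobenius of \<open>C\<close> raises sections to the \<open>p\<close>-th power. The Hasse--Witt matrix is the
  matrix of the induced \<open>p\<close>-linear map on \<open>H^1(C, O_C)\<close>; column \<open>j\<close> holds the coordinates of the
  image of the \<open>j\<close>-th basis vector.
\<close>

definition frobenius :: "'k::field cochain \<Rightarrow> 'k cochain" where
  "frobenius = (\<lambda>(u01, u02, u12). (u01 ^ CHAR('k), u02 ^ CHAR('k), u12 ^ CHAR('k)))"

definition hasse_witt_matrix :: "'k::field poly3 \<Rightarrow> 'k cochain list \<Rightarrow> 'k mat" where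
  "hasse_witt_matrix F bs =
     mat_of_cols (length bs) (map (\<lambda>b. THE r. H1_coords F bs (frobenius b) r) bs)"

end

theory Submission
  imports Defs
begin

text \<open>
  Write \<open>d = 2m + 1\<close>. The connecting map identifies \<open>H\<^sup>1(C, O)\<close> with the Laurent polynomials of degree
  \<open>-d\<close> all of whose exponents are negative, and Frobenius with \<open>v \<mapsto>\<close> the negative part of \<open>F v\<^sup>2\<close>.
  Decompose \<open>F = X A + Y B + Z C + XYZ D\<close> with \<open>A, B, C, D\<close> polynomials in \<open>X\<^sup>2, Y\<^sup>2, Z\<^sup>2\<close>, and read them as
  forms of degrees \<open>m, m, m, m - 1\<close> in these squares; here \<open>D\<close> collects the \<open>c\<^sub>i\<^sub>j\<close> with \<open>i, j\<close> odd.
  Dually, the rank is the dimension of the part of degree \<open>2m - 2\<close> of the ideal \<open>(A, B, C, D)\<close>, and smoothness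
  says that \<open>A, B, C, D\<close> have no common zero. Over the algebraic closure, \<open>A, B, C\<close> can be changed by multiples
  of \<open>D\<close> to \<open>A', B', C'\<close> without common zeros. By the Nullstellensatz and the exactness of the Koszul
  complex, \<open>A', B', C'\<close> have no relations in degree less than \<open>m\<close>, so they already contribute \<open>3 m (m - 1) / 2\<close>
  dimensions. If that is everything, then all multiples of \<open>D\<close> of degree \<open>2m - 2\<close> lie in \<open>(A', B', C')\<close>, and the
  same absence of relations forces \<open>D = 0\<close> by descent on the degree.
\<close>

text \<open>Frobenius is only semilinear, so a change of basis does not conjugate its matrix. Ranks
  are therefore compared through factorizations whose length is the rank; these survive the change,
  in which some coordinates merely get squared. In the monomial basis the entry at \<alpha>, \<beta>
  is the coefficient of \<open>F\<close> at \<open>2 \<beta> + (1, 1, 1) - \<alpha>\<close>: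
  multiplication by \<open>F\<close> followed by projection to the parity class
  \<open>(1, 1, 1)\<close>. As \<open>F\<close> has odd degree, only four parity classes of
  exponents occur in it, and each is completed to \<open>(1, 1, 1)\<close> by exactly one class;
  hence \<open>A, B, C, D\<close>. Four forms in three variables cannot be a regular sequence, which
  is why three general combinations are taken, over an infinite field. In degree
  \<open>2m - 2\<close> their cofactors have degree \<open>m - 2\<close>, and there are
  \<open>m (m - 1) / 2\<close> monomials of that degree. Conversely, if \<open>D = 0\<close>, no
  exponent of \<open>F\<close> is odd in all three places, so the monomials with \<alpha>
  \<open>= 2 \<kappa>\<close> never occur in the image of Frobenius. There are
  \<open>m (m + 1) / 2 = (d^2 - 1) / 8\<close> of them, which is the defect in the
  statement.\<close>

section \<open>Linear systems\<close>

text \<open>Gaussian elimination, one equation at a time. Dimension counts below are phrased as the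
  existence of such a nontrivial solution.\<close>

lemma underdetermined_system:
  fixes a :: "'i \<Rightarrow> 'j \<Rightarrow> 'a::field"
  assumes "finite J" "finite I" "card J < card I"
  shows "\<exists>x. (\<exists>i\<in>I. x i \<noteq> 0) \<and> (\<forall>j\<in>J. (\<Sum>i\<in>I. x i * a i j) = 0)"
  using assms
proof (induction J arbitrary: I a rule: finite_induct)
  case empty
  then show ?case by (intro exI[of _ "\<lambda>_. 1"]) (auto simp: card_gt_0_iff)
next
  case (insert j J)
  show ?case
  proof (cases "\<forall>i\<in>I. a i j = 0")
    case True
    have "card J < card I" using insert by simp
    then obtain x where "\<exists>i\<in>I. x i \<noteq> 0" "\<forall>j\<in>J. (\<Sum>i\<in>I. x i * a i j) = 0"
      using insert.IH[of I a] insert.prems by blast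
    then show ?thesis using True by (intro exI[of _ x]) auto
  next
    case False
    then obtain i0 where i0: "i0 \<in> I" "a i0 j \<noteq> 0" by blast
    define I' where "I' = I - {i0}"
    have I': "I = insert i0 I'" "i0 \<notin> I'" "finite I'" using i0 insert.prems by (auto simp: I'_def)
    have "card J < card I'" using insert.prems insert.hyps I' by simp
    then obtain x where x: "\<exists>i\<in>I'. x i \<noteq> 0"
      "\<forall>j'\<in>J. (\<Sum>i\<in>I'. x i * (a i j' - a i j / a i0 j * a i0 j')) = 0"
      using insert.IH[OF I'(3), of "\<lambda>i j'. a i j' - a i j / a i0 j * a i0 j'"] by blast
    \<comment> \<open>The eliminated unknown \<open>i0\<close> is recovered from equation
      \<open>j\<close>.\<close>
    define y where "y = x(i0 := - (\<Sum>i\<in>I'. x i * a i j) / a i0 j)"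
    have y: "(\<Sum>i\<in>I'. y i * c i) = (\<Sum>i\<in>I'. x i * c i)" for c
      using I'(2) by (intro sum.cong) (auto simp: y_def)
    have "(\<Sum>i\<in>I. y i * a i j') = 0" if "j' \<in> insert j J" for j'
    proof (cases "j' = j")
      case True
      then show ?thesis using I' i0 by (simp add: y) (simp add: y_def)
    next
      case False
      with that x(2) have "(\<Sum>i\<in>I'. x i * (a i j' - a i j / a i0 j * a i0 j')) = 0" by simp
      also have "(\<Sum>i\<in>I'. x i * (a i j' - a i j / a i0 j * a i0 j')) =
          (\<Sum>i\<in>I'. x i * a i j') - (\<Sum>i\<in>I'. x i * a i j) / a i0 j * a i0 j'"
        by (simp add: sum_subtractf right_diff_distrib sum_distrib_right sum_divide_distrib mult.assoc)
      finally show ?thesis using I' by (simp add: y) (simp add: y_def)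
    qed
    moreover have "\<exists>i\<in>I. y i \<noteq> 0" using x(1) I' by (auto simp: y_def)
    ultimately show ?thesis by blast
  qed
qed

section \<open>Polynomial mappings\<close>

abbreviation "lookup \<equiv> Poly_Mapping.lookup"
abbreviation "keys \<equiv> Poly_Mapping.keys"
abbreviation "single \<equiv> Poly_Mapping.single"

lemma lookup_sum_single:
  assumes "finite K"
  shows "lookup (\<Sum>k\<in>K. single k (f k)) k = (f k when k \<in> K)"
  using assms by (simp add: lookup_sum lookup_single when_def sum.delta)

lemma poly_mapping_eq_sum_single:
  assumes "finite K" "keys p \<subseteq> K"
  shows "p = (\<Sum>k\<in>K. single k (lookup p k))"
  by (rule poly_mapping_eqI)
    (use assms in \<open>auto simp: lookup_sum_single when_def in_keys_iff\<close>)

lemma lookup_single_times: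
  fixes k :: "'b::cancel_comm_monoid_add" and p :: "'b \<Rightarrow>\<^sub>0 'a::comm_semiring_1"
  shows "lookup (single k c * p) (k + l) = c * lookup p l"
proof -
  have "single k c * p = (\<Sum>l\<in>keys p. single (k + l) (c * lookup p l))"
    by (subst (1) poly_mapping_eq_sum_single[of "keys p" p]) (auto simp: sum_distrib_left mult_single)
  then show ?thesis
    by (simp add: lookup_sum lookup_single when_def sum.delta in_keys_iff)
qed

lemma keys_single_times:
  fixes k :: "'b::cancel_comm_monoid_add" and p :: "'b \<Rightarrow>\<^sub>0 'a::comm_semiring_1"
  shows "keys (single k c * p) \<subseteq> (\<lambda>l. k + l) ` keys p"
  using keys_mult[of "single k c" p] by (auto split: if_splits)

lemma lookup_const_times:
  fixes p :: "'b::cancel_comm_monoid_add \<Rightarrow>\<^sub>0 'a::comm_semiring_1"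
  shows "lookup (single 0 c * p) l = c * lookup p l"
  using lookup_single_times[of 0 c p l] by simp

lemma keys_const_times:
  fixes p :: "'b::cancel_comm_monoid_add \<Rightarrow>\<^sub>0 'a::comm_semiring_1"
  shows "keys (single 0 c * p) \<subseteq> keys p"
  using keys_single_times[of 0 c p] by auto

lemma single_times_eq_0_iff:
  fixes k :: "'b::cancel_comm_monoid_add" and p :: "'b \<Rightarrow>\<^sub>0 'a::comm_semiring_1"
  shows "single k 1 * p = 0 \<longleftrightarrow> p = 0"
  by (auto intro!: poly_mapping_eqI) (metis lookup_single_times lookup_zero mult_1)

lemma single_times_left_cancel:
  fixes k :: "'b::cancel_comm_monoid_add" and p :: "'b \<Rightarrow>\<^sub>0 'a::comm_ring_1"
  shows "single k 1 * p = single k 1 * q \<longleftrightarrow> p = q"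
  using single_times_eq_0_iff[of k "p - q"] by (simp add: right_diff_distrib)

section \<open>Restriction of the support and division by monomials\<close>

definition restrict_keys :: "('b \<Rightarrow> bool) \<Rightarrow> ('b \<Rightarrow>\<^sub>0 'a::comm_monoid_add) \<Rightarrow> 'b \<Rightarrow>\<^sub>0 'a" where
  "restrict_keys P p = (\<Sum>k\<in>{k\<in>keys p. P k}. single k (lookup p k))"

lemma lookup_restrict_keys [simp]: "lookup (restrict_keys P p) k = (if P k then lookup p k else 0)"
  by (auto simp: restrict_keys_def lookup_sum_single when_def in_keys_iff)

lemma keys_restrict_keys [simp]: "keys (restrict_keys P p) = {k \<in> keys p. P k}"
  by (auto simp: in_keys_iff split: if_splits)

lemma restrict_keys_split: "p = restrict_keys P p + restrict_keys (\<lambda>k. \<not> P k) p"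
  by (rule poly_mapping_eqI) (simp add: lookup_add)

text \<open>The quotient by a monomial; keys that are not divisible by it are dropped.\<close>

definition mon_quot :: "'b::cancel_comm_monoid_add \<Rightarrow> ('b \<Rightarrow>\<^sub>0 'a::comm_monoid_add) \<Rightarrow> 'b \<Rightarrow>\<^sub>0 'a" where
  "mon_quot k p = Poly_Mapping.map_key (\<lambda>l. k + l) p"

lemma lookup_mon_quot [simp]: "lookup (mon_quot k p) l = lookup p (k + l)"
  unfolding mon_quot_def by (simp add: map_key.rep_eq)

lemma single_times_mon_quot:
  fixes k :: "'b::cancel_comm_monoid_add" and p :: "'b \<Rightarrow>\<^sub>0 'a::comm_semiring_1"
  assumes "keys p \<subseteq> range (\<lambda>l. k + l)"
  shows "single k 1 * mon_quot k p = p"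
proof (rule poly_mapping_eqI)
  fix l
  show "lookup (single k 1 * mon_quot k p) l = lookup p l"
  proof (cases "l \<in> range (\<lambda>l. k + l)")
    case True
    then show ?thesis by (auto simp: lookup_single_times)
  next
    case False
    then have "l \<notin> keys p" "l \<notin> keys (single k 1 * mon_quot k p)"
      using assms keys_single_times[of k 1 "mon_quot k p"] by auto
    then show ?thesis by (simp add: in_keys_iff)
  qed
qed

section \<open>Ternary forms\<close>

definition tdeg :: "nat \<times> nat \<times> nat \<Rightarrow> nat" where
  "tdeg = (\<lambda>(i, j, l). i + j + l)"

lemma tdeg_simp [simp]: "tdeg (i, j, l) = i + j + l"
  by (simp add: tdeg_def)

lemma tdeg_add: "tdeg (k + l) = tdeg k + tdeg l"
  by (cases k; cases l) simp

text \<open>\<open>form e n\<close> is the space of forms of degree \<open>n - e\<close>, which is \<open>0\<close> if \<open>n < e\<close>.\<close>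

definition form :: "nat \<Rightarrow> nat \<Rightarrow> 'a::zero poly3 \<Rightarrow> bool" where
  "form e n p \<longleftrightarrow> (\<forall>k\<in>keys p. tdeg k + e = n)"

lemma form_0 [simp, intro]: "form e n 0"
  by (simp add: form_def)

lemma form_add [intro]: "form e n p \<Longrightarrow> form e n q \<Longrightarrow> form e n (p + q)"
  unfolding form_def by (auto dest!: subsetD[OF Poly_Mapping.keys_add])

lemma form_uminus [intro]: "form e n (p :: 'a::ab_group_add poly3) \<Longrightarrow> form e n (- p)"
  by (auto simp: form_def in_keys_iff)

lemma form_diff [intro]:
  "form e n p \<Longrightarrow> form e n q \<Longrightarrow> form e n (p - q)" for p q :: "'a::ab_group_add poly3"
  by (metis form_add form_uminus add_uminus_conv_diff)

lemma form_sum [intro]: "(\<And>i. i \<in> I \<Longrightarrow> form e n (f i)) \<Longrightarrow> form e n (sum f I)"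
  by (induction I rule: infinite_finite_induct) auto

lemma form_mult [intro]:
  "form e n p \<Longrightarrow> form e' n' q \<Longrightarrow> form (e + e') (n + n') (p * q)"
proof -
  assume *: "form e n p" "form e' n' q"
  have "tdeg k + (e + e') = n + n'" if k: "k \<in> keys (p * q)" for k
  proof -
    obtain a b where "k = a + b" "a \<in> keys p" "b \<in> keys q" using k keys_mult[of p q] by blast
    moreover have "tdeg a + e = n" "tdeg b + e' = n'" using * calculation by (auto simp: form_def)
    ultimately show ?thesis by (simp add: tdeg_add)
  qed
  then show ?thesis by (simp add: form_def)
qed

lemma form_single [intro]: "tdeg k + e = n \<Longrightarrow> form e n (single k c)"
  by (simp add: form_def)

lemma form_const_times [intro]:
  "form e n p \<Longrightarrow> form e n (single 0 c * p)" for p :: "'a::comm_semiring_1 poly3"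
  unfolding form_def by (auto dest!: subsetD[OF keys_const_times])

lemma form_less_eq_0: "form e n p \<Longrightarrow> n < e \<Longrightarrow> p = 0"
  unfolding form_def using poly_mapping_eqI[of p 0] by (force simp: in_keys_iff)

section \<open>Evaluation of forms at a point\<close>

definition mval :: "'a::comm_monoid_mult \<times> 'a \<times> 'a \<Rightarrow> nat \<times> nat \<times> nat \<Rightarrow> 'a" where
  "mval = (\<lambda>(x, y, z) (i, j, l). x ^ i * y ^ j * z ^ l)"

lemma mval_add: "mval P (k + l) = mval P k * mval P l"
  by (cases P; cases k; cases l) (simp add: mval_def power_add ac_simps)

lemma mval_0 [simp]: "mval P 0 = 1"
  by (cases P) (simp add: mval_def zero_prod_def)

definition ev :: "'a::comm_semiring_1 poly3 \<Rightarrow> 'a \<times> 'a \<times> 'a \<Rightarrow> 'a" where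
  "ev p P = (\<Sum>k\<in>keys p. lookup p k * mval P k)"

lemma ev_superset: "finite K \<Longrightarrow> keys p \<subseteq> K \<Longrightarrow> ev p P = (\<Sum>k\<in>K. lookup p k * mval P k)"
  unfolding ev_def by (rule sum.mono_neutral_left) (auto simp: in_keys_iff)

lemma ev_0 [simp]: "ev 0 P = 0"
  by (simp add: ev_def)

lemma ev_add [simp]: "ev (p + q) P = ev p P + ev q P"
proof -
  have "finite (keys p \<union> keys q)" by simp
  moreover have "keys (p + q) \<subseteq> keys p \<union> keys q" by (rule Poly_Mapping.keys_add)
  ultimately show ?thesis
    using ev_superset[of "keys p \<union> keys q" _ P]
    by (simp add: lookup_add distrib_right sum.distrib)
qed

lemma ev_sum [simp]: "ev (sum f I) P = (\<Sum>i\<in>I. ev (f i) P)"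
  by (induction I rule: infinite_finite_induct) auto

lemma ev_single [simp]: "ev (single k c) P = c * mval P k"
  by (simp add: ev_def)

lemma ev_mult [simp]: "ev (p * q) P = ev p P * ev q P"
proof -
  have "p * q = (\<Sum>k\<in>keys p. \<Sum>l\<in>keys q. single (k + l) (lookup p k * lookup q l))"
    by (subst (1) poly_mapping_eq_sum_single[of "keys p" p], simp, simp,
        subst (1) poly_mapping_eq_sum_single[of "keys q" q], simp, simp)
      (simp add: sum_product mult_single)
  then have "ev (p * q) P = (\<Sum>k\<in>keys p. \<Sum>l\<in>keys q. (lookup p k * mval P k) * (lookup q l * mval P l))"
    by (simp add: mval_add ac_simps)
  then show ?thesis by (simp add: ev_def sum_product)
qed

lemma ev_1 [simp]: "ev 1 P = 1"
  using ev_single[of 0 1 P] by simp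

lemma ev_power [simp]: "ev (p ^ n) P = ev p P ^ n"
  by (induction n) simp_all

lemma ev_diff [simp]: "ev (p - q) P = ev p P - ev q P" for p :: "'a::comm_ring_1 poly3"
  using ev_add[of "p - q" q P] by simp

lemma finite_tdeg: "finite {k. tdeg k = n}"
proof -
  have "{k. tdeg k = n} \<subseteq> {..n} \<times> {..n} \<times> {..n}" by auto
  then show ?thesis by (rule finite_subset) auto
qed

lemma form_eq_sum:
  assumes "form 0 n p"
  shows "p = (\<Sum>k\<in>{k. tdeg k = n}. single k (lookup p k))"
  by (rule poly_mapping_eq_sum_single) (use assms finite_tdeg in \<open>auto simp: form_def\<close>)

section \<open>The homogeneous Nullstellensatz in three variables\<close>

text \<open>A homogeneous ideal is given by its homogeneous elements \<open>p\<close>, paired with their degree \<open>n\<close>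
  (which \<open>p = 0\<close> does not determine).\<close>

definition graded_ideal :: "(nat \<times> 'a::comm_ring_1 poly3) set \<Rightarrow> bool" where
  "graded_ideal J \<longleftrightarrow> (\<forall>n p. (n, p) \<in> J \<longrightarrow> form 0 n p) \<and> (\<forall>n. (n, 0) \<in> J) \<and>
     (\<forall>n p q. (n, p) \<in> J \<longrightarrow> (n, q) \<in> J \<longrightarrow> (n, p + q) \<in> J) \<and>
     (\<forall>n p t s. (n, p) \<in> J \<longrightarrow> form 0 t s \<longrightarrow> (n + t, s * p) \<in> J)"

definition irrelevant :: "(nat \<times> 'a::comm_ring_1 poly3) set \<Rightarrow> bool" where
  "irrelevant J \<longleftrightarrow> (\<exists>N. \<forall>p. form 0 N p \<longrightarrow> (N, p) \<in> J)"

lemma graded_idealD: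
  assumes "graded_ideal J"
  shows "(n, p) \<in> J \<Longrightarrow> form 0 n p" "(n, 0) \<in> J"
    "(n, p) \<in> J \<Longrightarrow> (n, q) \<in> J \<Longrightarrow> (n, p + q) \<in> J"
    "(n, p) \<in> J \<Longrightarrow> form 0 t s \<Longrightarrow> (n + t, s * p) \<in> J"
  using assms by (auto simp: graded_ideal_def)

lemma form_shift: "form (n + e) (n + t) s \<longleftrightarrow> form e t s"
  by (auto simp: form_def)

lemma form_shift0: "form n (n + t) s \<longleftrightarrow> form 0 t s"
  using form_shift[of n 0] by simp

lemma form_power:
  fixes z :: "'a::comm_ring_1 poly3"
  assumes "form 0 d z"
  shows "form 0 (d * m) (z ^ m)"
proof (induction m)
  case 0
  show ?case by (simp add: form_def zero_prod_def)
next
  case (Suc m)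
  show ?case using form_mult[OF assms Suc.IH] by simp
qed

text \<open>Closure with the target degree \<open>t\<close> prescribed, which avoids subtraction of
  degrees; for \<open>t < n\<close> the factor \<open>s\<close> is 0.\<close>

lemma graded_ideal_mult:
  assumes "graded_ideal J" "(n, p) \<in> J" "form n t s"
  shows "(t, s * p) \<in> J"
proof (cases "n \<le> t")
  case True
  then have "form 0 (t - n) s" using assms(3) form_shift0[of n "t - n" s] by simp
  then show ?thesis using graded_idealD(4)[OF assms(1,2)] True by fastforce
next
  case False
  then show ?thesis using form_less_eq_0[OF assms(3)] graded_idealD(2)[OF assms(1)] by simp
qed

lemma graded_ideal_const:
  assumes "graded_ideal J" "(n, p) \<in> J"
  shows "(n, single 0 c * p) \<in> J"
proof -
  have "form n n (single 0 c)" by (rule form_single) (simp add: zero_prod_def)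
  then show ?thesis by (rule graded_ideal_mult[OF assms])
qed

lemma graded_ideal_uminus:
  assumes "graded_ideal J" "(n, p) \<in> J"
  shows "(n, - p) \<in> J"
  using graded_ideal_const[OF assms, of "-1"] by (simp add: single_uminus)

lemma graded_ideal_diff:
  assumes "graded_ideal J" "(n, p) \<in> J" "(n, q) \<in> J"
  shows "(n, p - q) \<in> J"
  using graded_idealD(3)[OF assms(1,2) graded_ideal_uminus[OF assms(1,3)]] by simp

lemma graded_ideal_sum:
  assumes "graded_ideal J" "\<And>i. i \<in> I \<Longrightarrow> (n, f i) \<in> J"
  shows "(n, sum f I) \<in> J"
  using assms(2)
  by (induction I rule: infinite_finite_induct) (auto intro: graded_idealD[OF assms(1)])

lemma graded_ideal_monomials:
  assumes "graded_ideal J" "\<And>k. tdeg k = n \<Longrightarrow> (n, single k 1) \<in> J" "form 0 n p"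
  shows "(n, p) \<in> J"
proof -
  have "(n, \<Sum>k\<in>{k. tdeg k = n}. single 0 (lookup p k) * single k 1) \<in> J"
    by (intro graded_ideal_sum[OF assms(1)] graded_ideal_const[OF assms(1)]) (use assms(2) in auto)
  then show ?thesis using form_eq_sum[OF assms(3)] by (simp add: mult_single)
qed

lemma tdeg_split:
  assumes "tdeg k = m + n"
  obtains a b where "k = a + b" "tdeg a = m" "tdeg b = n"
proof -
  obtain i j l where k: "k = (i, j, l)" by (cases k)
  \<comment> \<open>Greedy choice: fill the exponents from left to right until degree
    \<open>m\<close> is reached.\<close>
  define i' where "i' = min i m"
  define j' where "j' = min j (m - i')"
  define l' where "l' = m - i' - j'"
  have "tdeg (i', j', l') = m" "tdeg (i - i', j - j', l - l') = n"
    "k = (i', j', l') + (i - i', j - j', l - l')"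
    using assms by (auto simp: k i'_def j'_def l'_def)
  then show ?thesis using that by blast
qed

lemma single_0_mult: "single 0 (a * b) = single 0 a * single (0 :: 'b::comm_monoid_add) (b :: 'a::comm_semiring_1)"
  by (simp add: mult_single)

lemma single_add_times: "single (a + b) (1::'a::comm_semiring_1) = single a 1 * single b 1"
  by (simp add: mult_single)

text \<open>The homogeneous ideal generated by \<open>J\<close> and a form \<open>g\<close> of
  degree \<open>e\<close>. Below degree \<open>e\<close> nothing is added, since then
  \<open>s = 0\<close>.\<close>

definition adjoin :: "(nat \<times> 'a::comm_ring_1 poly3) set \<Rightarrow> nat \<Rightarrow> 'a poly3 \<Rightarrow> (nat \<times> 'a poly3) set" where
  "adjoin J e g = {(n, p). \<exists>j s. (n, j) \<in> J \<and> form e n s \<and> p = j + s * g}"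

lemma form_mult_cancel: "form e n s \<Longrightarrow> form 0 e g \<Longrightarrow> form 0 n (s * g)"
  using form_mult[of e n s 0 e g] form_shift[of e 0 n "s * g"] by (simp add: add.commute)

lemma graded_ideal_adjoin:
  assumes J: "graded_ideal J" and g: "form 0 e g"
  shows "graded_ideal (adjoin J e g)"
  unfolding graded_ideal_def
proof (intro conjI allI impI)
  fix n p assume "(n, p) \<in> adjoin J e g"
  then show "form 0 n p" using graded_idealD(1)[OF J] form_mult_cancel[OF _ g]
    by (auto simp: adjoin_def)
next
  fix n show "(n, 0) \<in> adjoin J e g"
    unfolding adjoin_def using graded_idealD(2)[OF J] form_0 by force
next
  fix n p q assume "(n, p) \<in> adjoin J e g" "(n, q) \<in> adjoin J e g"
  then obtain j s j' s' where *: "(n, j) \<in> J" "form e n s" "p = j + s * g"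
    "(n, j') \<in> J" "form e n s'" "q = j' + s' * g" unfolding adjoin_def by blast
  then have "p + q = (j + j') + (s + s') * g" by (simp add: algebra_simps)
  moreover have "(n, j + j') \<in> J" "form e n (s + s')" using * graded_idealD(3)[OF J] by auto
  ultimately show "(n, p + q) \<in> adjoin J e g" unfolding adjoin_def by blast
next
  fix n p t and r :: "'a poly3" assume "(n, p) \<in> adjoin J e g" and r: "form 0 t r"
  then obtain j s where *: "(n, j) \<in> J" "form e n s" "p = j + s * g" unfolding adjoin_def by blast
  have "r * p = r * j + (r * s) * g" by (simp add: * algebra_simps)
  moreover have "(n + t, r * j) \<in> J" using graded_idealD(4)[OF J *(1) r] .
  moreover have "form e (n + t) (r * s)" using form_mult[OF r *(2)] by (simp add: add.commute)
  ultimately show "(n + t, r * p) \<in> adjoin J e g" unfolding adjoin_def by blast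
qed

lemma adjoin_superset: "J \<subseteq> adjoin J e (g :: 'a::comm_ring_1 poly3)"
proof
  fix a assume "a \<in> J"
  then show "a \<in> adjoin J e g"
    unfolding adjoin_def by (cases a) (force intro: exI[of _ "0 :: 'a poly3"])
qed

lemma adjoin_mem:
  assumes "graded_ideal J"
  shows "(e, g) \<in> adjoin J e g"
proof -
  have "form e e (1 :: 'a poly3)" by (auto simp: form_def zero_prod_def)
  then show ?thesis
    unfolding adjoin_def using graded_idealD(2)[OF assms, of e] by (force intro: exI[of _ 1])
qed

lemma irrelevant_mono_degree:
  assumes J: "graded_ideal J" and "\<And>p. form 0 N p \<Longrightarrow> (N, p) \<in> J" "N \<le> n" "form 0 n p"
  shows "(n, p) \<in> J"
proof (rule graded_ideal_monomials[OF J _ assms(4)])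
  fix k assume "tdeg k = n"
  then have "tdeg k = N + (n - N)" using assms(3) by simp
  then obtain a b where ab: "k = a + b" "tdeg a = N" "tdeg b = n - N" by (rule tdeg_split)
  have "(N + (n - N), single b 1 * single a 1) \<in> J"
    using ab by (intro graded_idealD(4)[OF J] assms(2) form_single) auto
  then show "(n, single k 1) \<in> J"
    using assms(3) ab by (simp add: single_add_times mult.commute)
qed

text \<open>Zorn's lemma. The union of a chain stays non-irrelevant because there are only finitely
  many monomials of degree \<open>N\<close>: if all lie in the union, they already lie in one member
  of the chain.\<close>

lemma ex_maximal_graded_ideal:
  fixes I :: "(nat \<times> 'a::comm_ring_1 poly3) set"
  assumes I: "graded_ideal I" "\<not> irrelevant I"
  shows "\<exists>M. graded_ideal M \<and> \<not> irrelevant M \<and> I \<subseteq> M \<and>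
    (\<forall>J. graded_ideal J \<and> \<not> irrelevant J \<and> M \<subseteq> J \<longrightarrow> J = M)"
proof -
  define F where "F = {J. graded_ideal J \<and> \<not> irrelevant J \<and> I \<subseteq> J}"
  have "\<exists>M\<in>F. \<forall>J\<in>F. M \<subseteq> J \<longrightarrow> J = M"
  proof (rule subset_Zorn_nonempty)
    show "F \<noteq> {}" using I by (auto simp: F_def)
  next
    fix C assume C: "C \<noteq> {}" "subset.chain F C"
    have A: "graded_ideal J" "\<not> irrelevant J" "I \<subseteq> J" if "J \<in> C" for J
      using C that by (auto simp: subset.chain_def F_def)
    have U: "graded_ideal (\<Union>C)"
      unfolding graded_ideal_def
    proof (intro conjI allI impI)
      fix n p assume "(n, p) \<in> \<Union>C"
      then show "form 0 n p" using A(1) graded_idealD(1) by blast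
    next
      fix n show "(n, 0) \<in> \<Union>C" using A(1) graded_idealD(2) C(1) by blast
    next
      fix n p q assume "(n, p) \<in> \<Union>C" "(n, q) \<in> \<Union>C"
      then have "{(n, p), (n, q)} \<subseteq> \<Union>C" by blast
      from finite_subset_Union_chain[OF _ this C]
      obtain J where J: "J \<in> C" "{(n, p), (n, q)} \<subseteq> J" by auto
      then have "(n, p + q) \<in> J" using graded_idealD(3)[OF A(1)[OF J(1)]] by blast
      then show "(n, p + q) \<in> \<Union>C" using J by blast
    next
      fix n p t and s :: "'a poly3" assume "(n, p) \<in> \<Union>C" "form 0 t s"
      then show "(n + t, s * p) \<in> \<Union>C" using A(1) graded_idealD(4) by blast
    qed
    have "\<not> irrelevant (\<Union>C)"
    proof
      assume "irrelevant (\<Union>C)"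
      then obtain N where N: "\<forall>p. form 0 N p \<longrightarrow> (N, p) \<in> \<Union>C" unfolding irrelevant_def by blast
      have "(\<lambda>k. (N, single k 1)) ` {k. tdeg k = N} \<subseteq> \<Union>C"
      proof (rule image_subsetI)
        fix k :: "nat \<times> nat \<times> nat" assume "k \<in> {k. tdeg k = N}"
        then have "form 0 N (single k (1::'a))" by (intro form_single) simp
        then show "(N, single k 1) \<in> \<Union>C" using N by blast
      qed
      from finite_subset_Union_chain[OF _ this C] finite_tdeg
      obtain J where J: "J \<in> C" "(\<lambda>k. (N, single k 1)) ` {k. tdeg k = N} \<subseteq> J" by blast
      have "irrelevant J"
        unfolding irrelevant_def using graded_ideal_monomials[OF A(1)[OF J(1)]] J(2) by blast
      then show False using A(2) J(1) by blast
    qed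
    then show "\<Union>C \<in> F" using U A(3) C(1) by (auto simp: F_def)
  qed
  then obtain M where "M \<in> F" "\<forall>J\<in>F. M \<subseteq> J \<longrightarrow> J = M" by blast
  then show ?thesis unfolding F_def by (intro exI[of _ M]) auto
qed

locale maximal_graded_ideal =
  fixes M :: "(nat \<times> 'a::alg_closed_field poly3) set"
  assumes ideal: "graded_ideal M" and proper: "\<not> irrelevant M"
    and maximal: "\<And>J. graded_ideal J \<Longrightarrow> \<not> irrelevant J \<Longrightarrow> M \<subseteq> J \<Longrightarrow> J = M"
begin

lemma irrelevant_adjoin:
  assumes "form 0 e g" "(e, g) \<notin> M"
  shows "irrelevant (adjoin M e g)"
  using maximal[OF graded_ideal_adjoin[OF ideal assms(1)] _ adjoin_superset] adjoin_mem[OF ideal] assms(2)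
  by blast

text \<open>If neither factor were in \<open>M\<close>, adjoining either one would give all forms of
  some degree, by maximality. A monomial of the sum of these degrees is then a product
  \<open>(j + s g) (j' + s' h)\<close>, which lies in \<open>M\<close> together with
  \<open>g h\<close>; so \<open>M\<close> would be irrelevant.\<close>

lemma prime:
  assumes g: "form 0 n g" and h: "form 0 t h" and gh: "(n + t, g * h) \<in> M"
  shows "(n, g) \<in> M \<or> (t, h) \<in> M"
proof (rule ccontr)
  assume "\<not> ?thesis"
  then have "irrelevant (adjoin M n g)" "irrelevant (adjoin M t h)"
    using irrelevant_adjoin g h by auto
  then obtain N N' where N: "\<And>p. form 0 N p \<Longrightarrow> (N, p) \<in> adjoin M n g"
    "\<And>p. form 0 N' p \<Longrightarrow> (N', p) \<in> adjoin M t h"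
    unfolding irrelevant_def by blast
  have "(N + N', single k 1) \<in> M" if "tdeg k = N + N'" for k
  proof -
    from that obtain a b where ab: "k = a + b" "tdeg a = N" "tdeg b = N'" by (rule tdeg_split)
    have f: "form 0 N (single a (1::'a))" "form 0 N' (single b (1::'a))" using ab by (auto intro: form_single)
    obtain j s where j: "(N, j) \<in> M" "form n N s" "single a 1 = j + s * g"
      using N(1)[OF f(1)] unfolding adjoin_def by auto
    obtain j' s' where j': "(N', j') \<in> M" "form t N' s'" "single b 1 = j' + s' * h"
      using N(2)[OF f(2)] unfolding adjoin_def by auto
    have "single k 1 = single b 1 * j + (s * g) * j' + (s * s') * (g * h)"
      by (simp add: ab single_add_times j(3) j'(3) algebra_simps)
    moreover have "(N + N', single b 1 * j) \<in> M" using graded_idealD(4)[OF ideal j(1) f(2)] .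
    moreover have "(N + N', (s * g) * j') \<in> M"
      using graded_idealD(4)[OF ideal j'(1) form_mult_cancel[OF j(2) g]] by (simp add: add.commute)
    moreover have "(N + N', (s * s') * (g * h)) \<in> M"
      using graded_ideal_mult[OF ideal gh form_mult[OF j(2) j'(2)]] .
    ultimately show ?thesis using graded_idealD(3)[OF ideal] by simp
  qed
  then have "irrelevant M"
    unfolding irrelevant_def using graded_ideal_monomials[OF ideal] by blast
  then show False using proper by simp
qed

lemma power_notin:
  assumes "form 0 1 x" "(1, x) \<notin> M"
  shows "form 0 n (x ^ n) \<and> (n, x ^ n) \<notin> M"
proof (induction n)
  case 0
  have "(0, 1) \<notin> M"
  proof
    assume "(0, 1) \<in> M"
    then have "irrelevant M" unfolding irrelevant_def
      using graded_ideal_mult[OF ideal, of 0 1 0] by auto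
    then show False using proper by simp
  qed
  then show ?case by (auto simp: form_def zero_prod_def)
next
  case (Suc n)
  then show ?case
    using form_mult[OF assms(1), of 0 n "x ^ n"] prime[OF assms(1), of n "x ^ n"] assms(2) by auto
qed

text \<open>Modulo \<open>M\<close> two linear forms \<open>x \<noteq> 0\<close> and \<open>y\<close> satisfy a homogeneous equation in two unknowns,
  because \<open>S/M\<close> has bounded Hilbert function. As \<open>k\<close> is algebraically closed and \<open>M\<close> is prime,
  one of its linear factors vanishes.\<close>

lemma binary_form_factor:
  assumes x: "form 0 1 x" "(1, x) \<notin> M" and y: "form 0 1 y"
  shows "P \<noteq> 0 \<Longrightarrow> degree P \<le> n \<Longrightarrow>
    (n, \<Sum>i\<le>n. single 0 (coeff P i) * (y ^ i * x ^ (n - i))) \<in> M \<Longrightarrow> \<exists>c. (1, y - single 0 c * x) \<in> M"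
proof (induction n arbitrary: P)
  case 0
  then have "coeff P 0 \<noteq> 0" by (metis le_zero_eq leading_coeff_0_iff)
  moreover have "(0, single 0 (inverse (coeff P 0)) * single 0 (coeff P 0)) \<in> M"
    using graded_ideal_const[OF ideal 0(3)] by simp
  ultimately have "(0, x ^ 0) \<in> M" by (simp add: mult_single)
  then show ?case using power_notin[OF x] by blast
next
  case (Suc n)
  show ?case
  proof (cases "degree P = 0")
    case True
    then have P: "coeff P 0 \<noteq> 0" "\<And>i. i > 0 \<Longrightarrow> coeff P i = 0"
      using Suc.prems(1) by (auto simp: coeff_eq_0) (metis leading_coeff_0_iff)
    have "(\<Sum>i\<le>Suc n. single 0 (coeff P i) * (y ^ i * x ^ (Suc n - i))) =
        (\<Sum>i\<in>{0}. single 0 (coeff P i) * (y ^ i * x ^ (Suc n - i)))"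
      by (rule sum.mono_neutral_right) (use P in auto)
    then have "(Suc n, single 0 (inverse (coeff P 0)) * (single 0 (coeff P 0) * x ^ Suc n)) \<in> M"
      using graded_ideal_const[OF ideal Suc.prems(3)] by simp
    then have "(Suc n, x ^ Suc n) \<in> M" using P by (simp add: mult_single flip: mult.assoc)
    then show ?thesis using power_notin[OF x] by blast
  next
    case False
    then obtain c where "poly P c = 0" using alg_closed_imp_poly_has_root by blast
    then obtain Q where Q: "P = [:-c, 1:] * Q" by (auto simp: poly_eq_0_iff_dvd elim: dvdE)
    have "Q \<noteq> 0" using Suc.prems(1) Q by auto
    then have dQ: "degree Q \<le> n" using Suc.prems(2) unfolding Q by (subst (asm) degree_mult_eq) auto
    define H where "H = (\<Sum>i\<le>n. single 0 (coeff Q i) * (y ^ i * x ^ (n - i)))"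
    \<comment> \<open>The identity \<open>P = [:-c, 1:] * Q\<close> read on coefficients. After
      homogenization it factors the given sum as \<open>(y - c x) * H\<close>, to which primality
      applies.\<close>
    have cP: "single 0 (coeff P i) = single 0 (case i of 0 \<Rightarrow> 0 | Suc j \<Rightarrow> coeff Q j) - single 0 c * single 0 (coeff Q i)"
      for i by (simp add: Q mult_single flip: single_diff split: nat.split)
    have "(\<Sum>i\<le>Suc n. single 0 (coeff P i) * (y ^ i * x ^ (Suc n - i))) =
        (\<Sum>i\<le>Suc n. single 0 (case i of 0 \<Rightarrow> 0 | Suc j \<Rightarrow> coeff Q j) * (y ^ i * x ^ (Suc n - i))) -
        (\<Sum>i\<le>Suc n. single 0 c * single 0 (coeff Q i) * (y ^ i * x ^ (Suc n - i)))"
      by (simp only: cP left_diff_distrib sum_subtractf)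
    also have "(\<Sum>i\<le>Suc n. single 0 (case i of 0 \<Rightarrow> 0 | Suc j \<Rightarrow> coeff Q j) * (y ^ i * x ^ (Suc n - i))) = y * H"
      by (subst sum.atMost_Suc_shift) (simp add: H_def sum_distrib_left algebra_simps)
    also have "(\<Sum>i\<le>Suc n. single 0 c * single 0 (coeff Q i) * (y ^ i * x ^ (Suc n - i))) =
        (\<Sum>i\<le>n. single 0 c * single 0 (coeff Q i) * (y ^ i * x ^ (Suc n - i)))"
      using dQ by (simp add: coeff_eq_0)
    also have "\<dots> = single 0 c * x * H"
      by (simp add: H_def sum_distrib_left Suc_diff_le algebra_simps)
    finally have "(1 + n, (y - single 0 c * x) * H) \<in> M"
      using Suc.prems(3) by (simp add: left_diff_distrib)
    moreover have "form 0 1 (y - single 0 c * x)" using x y by auto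
    moreover have "form 0 n H"
      unfolding H_def
    proof (intro form_sum form_const_times)
      fix i assume "i \<in> {..n}"
      from form_mult[OF form_power[OF y, of i] form_power[OF x(1), of "n - i"]]
      show "form 0 n (y ^ i * x ^ (n - i))" using \<open>i \<in> {..n}\<close> by simp
    qed
    ultimately have "(1, y - single 0 c * x) \<in> M \<or> (n, H) \<in> M" by (intro prime)
    then show ?thesis using Suc.IH[OF \<open>Q \<noteq> 0\<close> dQ] H_def by blast
  qed
qed

text \<open>Adjoining \<open>x\<close> to \<open>M\<close> yields all forms of some degree
  \<open>N\<close>, so modulo \<open>M\<close> a form of degree \<open>N + t\<close> is
  \<open>x ^ t\<close> times a form of degree \<open>N\<close>. The number of monomials of degree
  \<open>N\<close> thus bounds the dimension in every higher degree, and sufficiently many products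
  of \<open>x\<close> and \<open>y\<close> become linearly dependent.\<close>

lemma linear_form_proportional:
  assumes x: "form 0 1 x" "(1, x) \<notin> M" and y: "form 0 1 y"
  shows "\<exists>c. (1, y - single 0 c * x) \<in> M"
proof -
  obtain N where N: "\<And>p. form 0 N p \<Longrightarrow> (N, p) \<in> adjoin M 1 x"
    using irrelevant_adjoin[OF x] unfolding irrelevant_def by blast
  have reduce: "\<exists>b. form 0 N b \<and> (N + t, p - x ^ t * b) \<in> M" if "form 0 (N + t) p" for t p
    using that
  proof (induction t arbitrary: p)
    case 0
    then show ?case using graded_idealD(2)[OF ideal] by (intro exI[of _ p]) auto
  next
    case (Suc t)
    have "(N + Suc t, p) \<in> adjoin M 1 x"
      using irrelevant_mono_degree[OF graded_ideal_adjoin[OF ideal x(1)] N _ Suc.prems] by simp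
    then obtain j s where j: "(N + Suc t, j) \<in> M" "form 1 (N + Suc t) s" "p = j + s * x"
      unfolding adjoin_def by blast
    have "form 0 (N + t) s" using j(2) form_shift0[of 1 "N + t" s] by simp
    then obtain b where b: "form 0 N b" "(N + t, s - x ^ t * b) \<in> M" using Suc.IH by blast
    have "(N + t + 1, x * (s - x ^ t * b)) \<in> M" by (rule graded_idealD(4)[OF ideal b(2) x(1)])
    then have "(N + Suc t, j + x * (s - x ^ t * b)) \<in> M" using graded_idealD(3)[OF ideal j(1)] by simp
    then show ?case using b(1) j(3) by (intro exI[of _ b]) (simp add: algebra_simps)
  qed
  define q where "q = card {k. tdeg k = N}"
  \<comment> \<open>There are \<open>n + 1 > q\<close> products \<open>y ^ i * x ^ (n - i)\<close>.
    Each reduces to \<open>x ^ q * b i\<close> with \<open>b i\<close> in a space of dimension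
    \<open>q\<close>.\<close>
  define n where "n = N + q"
  have "form 0 n (y ^ i * x ^ (n - i))" if "i \<le> n" for i
    using form_mult[OF form_power[OF y, of i] form_power[OF x(1), of "n - i"]] that by simp
  then have "\<forall>i\<in>{..n}. \<exists>b. form 0 N b \<and> (n, y ^ i * x ^ (n - i) - x ^ q * b) \<in> M"
    using reduce[of q] unfolding n_def by blast
  then obtain b where b: "\<And>i. i \<le> n \<Longrightarrow> form 0 N (b i)"
    "\<And>i. i \<le> n \<Longrightarrow> (n, y ^ i * x ^ (n - i) - x ^ q * b i) \<in> M"
    by (subst (asm) bchoice_iff) auto
  obtain c where c: "\<exists>i\<in>{..n}. c i \<noteq> 0"
    "\<forall>k\<in>{k. tdeg k = N}. (\<Sum>i\<le>n. c i * lookup (b i) k) = 0"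
    using underdetermined_system[of "{k. tdeg k = N}" "{..n}" "\<lambda>i. lookup (b i)"] finite_tdeg
    by (auto simp: q_def n_def)
  have b0: "(\<Sum>i\<le>n. single 0 (c i) * b i) = 0"
  proof (rule poly_mapping_eqI)
    fix k
    show "lookup (\<Sum>i\<le>n. single 0 (c i) * b i) k = lookup 0 k"
    proof (cases "tdeg k = N")
      case True
      then have "(\<Sum>i\<le>n. c i * lookup (b i) k) = 0" using c(2) by blast
      then show ?thesis by (simp add: lookup_sum lookup_const_times)
    next
      case False
      then have "lookup (b i) k = 0" if "i \<le> n" for i
        using b(1)[OF that] by (auto simp: form_def in_keys_iff)
      then show ?thesis by (simp add: lookup_sum lookup_const_times)
    qed
  qed
  have "(n, \<Sum>i\<le>n. single 0 (c i) * (y ^ i * x ^ (n - i) - x ^ q * b i)) \<in> M"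
    by (intro graded_ideal_sum[OF ideal] graded_ideal_const[OF ideal]) (use b(2) in auto)
  also have "(\<Sum>i\<le>n. single 0 (c i) * (y ^ i * x ^ (n - i) - x ^ q * b i)) =
      (\<Sum>i\<le>n. single 0 (c i) * (y ^ i * x ^ (n - i))) - x ^ q * (\<Sum>i\<le>n. single 0 (c i) * b i)"
    by (simp add: right_diff_distrib sum_subtractf sum_distrib_left algebra_simps)
  finally have *: "(n, \<Sum>i\<le>n. single 0 (c i) * (y ^ i * x ^ (n - i))) \<in> M" by (simp add: b0)
  define P where "P = (\<Sum>i\<le>n. monom (c i) i)"
  have P: "coeff P i = (if i \<le> n then c i else 0)" for i
    by (simp add: P_def coeff_sum coeff_monom sum.delta)
  have "P \<noteq> 0" using c(1) P by (metis atMost_iff coeff_0)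
  moreover have "degree P \<le> n" by (rule degree_le) (simp add: P)
  moreover have "(n, \<Sum>i\<le>n. single 0 (coeff P i) * (y ^ i * x ^ (n - i))) \<in> M" using * by (simp add: P)
  ultimately show ?thesis using binary_form_factor[OF x y] by blast
qed

text \<open>Some variable \<open>x\<close> is outside \<open>M\<close>, and modulo \<open>M\<close>
  every variable is a constant times \<open>x\<close>. These constants are the coordinates of
  \<open>P\<close>. Hence a form \<open>p\<close> of degree \<open>n\<close> is congruent to
  \<open>ev p P * x ^ n\<close>; if \<open>p\<close> is in \<open>M\<close>, the constant must
  vanish because no power of \<open>x\<close> is in \<open>M\<close>.\<close>

lemma ex_point: "\<exists>P. P \<noteq> (0, 0, 0) \<and> (\<forall>(n, p)\<in>M. ev p P = 0)"
proof -
  define U :: "(nat \<times> nat \<times> nat) set" where "U = {(1, 0, 0), (0, 1, 0), (0, 0, 1)}"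
  have U: "k \<in> U \<longleftrightarrow> tdeg k = 1" for k
    by (cases k) (auto simp: U_def)
  have "\<exists>k\<in>U. (1, single k 1) \<notin> M"
  proof (rule ccontr)
    assume "\<not> ?thesis"
    then have "irrelevant M"
      unfolding irrelevant_def using graded_ideal_monomials[OF ideal, of 1] U by blast
    then show False using proper by simp
  qed
  then obtain k0 where k0: "k0 \<in> U" "(1, single k0 1) \<notin> M" by blast
  define x :: "'a poly3" where "x = single k0 1"
  have x: "form 0 1 x" "(1, x) \<notin> M" using k0 U by (auto simp: x_def intro: form_single)
  have "\<forall>k\<in>U. \<exists>c. (1, single k 1 - single 0 c * x) \<in> M"
    using linear_form_proportional[OF x form_single] U by simp
  then obtain c where c: "\<And>k. k \<in> U \<Longrightarrow> (1, single k 1 - single 0 (c k) * x) \<in> M"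
    by (subst (asm) bchoice_iff) auto
  define P where "P = (c (1, 0, 0), c (0, 1, 0), c (0, 0, 1))"
  \<comment> \<open>If this constant were 0, the variable \<open>x\<close> itself would lie in
    \<open>M\<close>.\<close>
  have "c k \<noteq> 0" if "k = k0" for k
    using c[of k0] k0 that by (auto simp: x_def)
  then have P0: "P \<noteq> (0, 0, 0)" using k0(1) by (auto simp: P_def U_def)
  define T where "T k \<longleftrightarrow> (tdeg k, single k 1 - single 0 (mval P k) * x ^ tdeg k) \<in> M" for k
  have T0: "T (0, 0, 0)"
    using graded_idealD(2)[OF ideal] mval_0[of P] by (simp add: T_def zero_prod_def)
  have TU: "T k" if "k \<in> U" for k
    using c[OF that] that by (auto simp: T_def U_def P_def mval_def)
  have Tadd: "T (k + l)" if "T k" "T l" for k l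
  proof -
    have "single (k + l) 1 - single 0 (mval P (k + l)) * x ^ tdeg (k + l) =
      single l 1 * (single k 1 - single 0 (mval P k) * x ^ tdeg k) +
      single 0 (mval P k) * x ^ tdeg k * (single l 1 - single 0 (mval P l) * x ^ tdeg l)"
      by (simp add: mval_add single_add_times tdeg_add power_add single_0_mult algebra_simps)
    moreover have "(tdeg k + tdeg l, single l 1 * (single k 1 - single 0 (mval P k) * x ^ tdeg k)) \<in> M"
      by (rule graded_idealD(4)[OF ideal that(1)[unfolded T_def]]) (simp add: form_single)
    moreover have "(tdeg l + tdeg k, single 0 (mval P k) * x ^ tdeg k * (single l 1 - single 0 (mval P l) * x ^ tdeg l)) \<in> M"
      using graded_idealD(4)[OF ideal that(2)[unfolded T_def], of "tdeg k" "single 0 (mval P k) * x ^ tdeg k"]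
        power_notin[OF x] by auto
    ultimately show ?thesis
      unfolding T_def using graded_idealD(3)[OF ideal] by (simp add: tdeg_add add.commute)
  qed
  have "T (i, 0, 0)" for i
    by (induction i) (use T0 Tadd[OF TU[of "(1,0,0)"]] in \<open>auto simp: U_def\<close>)
  moreover have "T (0, i, 0)" for i
    by (induction i) (use T0 Tadd[OF TU[of "(0,1,0)"]] in \<open>auto simp: U_def\<close>)
  moreover have "T (0, 0, i)" for i
    by (induction i) (use T0 Tadd[OF TU[of "(0,0,1)"]] in \<open>auto simp: U_def\<close>)
  ultimately have "T ((i, 0, 0) + ((0, j, 0) + (0, 0, l)))" for i j l
    by (intro Tadd)
  then have T: "T k" for k by (cases k) simp
  have "ev p P = 0" if p: "(n, p) \<in> M" for n p
  proof (rule ccontr)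
    assume nz: "ev p P \<noteq> 0"
    have f: "form 0 n p" using graded_idealD(1)[OF ideal p] .
    have "(n, \<Sum>k\<in>{k. tdeg k = n}. single 0 (lookup p k) * (single k 1 - single 0 (mval P k) * x ^ n)) \<in> M"
      by (intro graded_ideal_sum[OF ideal] graded_ideal_const[OF ideal]) (use T in \<open>auto simp: T_def\<close>)
    also have "(\<Sum>k\<in>{k. tdeg k = n}. single 0 (lookup p k) * (single k 1 - single 0 (mval P k) * x ^ n)) =
        (\<Sum>k\<in>{k. tdeg k = n}. single k (lookup p k)) -
        (\<Sum>k\<in>{k. tdeg k = n}. single 0 (lookup p k * mval P k)) * x ^ n"
      by (simp add: right_diff_distrib sum_subtractf sum_distrib_right mult_single flip: mult.assoc)
    also have "(\<Sum>k\<in>{k. tdeg k = n}. single k (lookup p k)) = p"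
      using form_eq_sum[OF f] by simp
    also have "(\<Sum>k\<in>{k. tdeg k = n}. single 0 (lookup p k * mval P k)) = single 0 (ev p P)"
      by (subst ev_superset[of "{k. tdeg k = n}"])
        (use f finite_tdeg in \<open>auto simp: form_def lookup_sum lookup_single when_def intro!: poly_mapping_eqI\<close>)
    finally have "(n, p - (p - single 0 (ev p P) * x ^ n)) \<in> M"
      by (rule graded_ideal_diff[OF ideal p])
    then have "(n, single 0 (ev p P) * x ^ n) \<in> M" by simp
    from graded_ideal_const[OF ideal this, of "inverse (ev p P)"]
    have "(n, x ^ n) \<in> M" using nz by (simp add: mult_single flip: mult.assoc)
    then show False using power_notin[OF x] by blast
  qed
  then show ?thesis using P0 by blast
qed

end

theorem homogeneous_nullstellensatz:
  fixes I :: "(nat \<times> 'a::alg_closed_field poly3) set"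
  assumes "graded_ideal I" "\<And>P. P \<noteq> (0, 0, 0) \<Longrightarrow> \<exists>(n, p)\<in>I. ev p P \<noteq> 0"
  shows "irrelevant I"
proof (rule ccontr)
  assume "\<not> irrelevant I"
  then obtain M where M: "graded_ideal M" "\<not> irrelevant M" "I \<subseteq> M"
    "\<And>J. graded_ideal J \<and> \<not> irrelevant J \<and> M \<subseteq> J \<longrightarrow> J = M"
    using ex_maximal_graded_ideal[OF assms(1)] by blast
  then interpret maximal_graded_ideal M by unfold_locales auto
  obtain P where "P \<noteq> (0, 0, 0)" "\<forall>(n, p)\<in>M. ev p P = 0" using ex_point by blast
  then show False using assms(2)[of P] M(3) by blast
qed

section \<open>Three forms without common zeros\<close>

text \<open>Coprimality of monomials in the form in which it is applied: a multiple of the monomial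
  of \<open>k\<close> that is divisible by the monomial of \<open>l\<close> has a cofactor divisible
  by it. It is stated additively because exponents in \<nat> have no true subtraction.\<close>

definition coprime_exponents :: "'b::comm_monoid_add \<Rightarrow> 'b \<Rightarrow> bool" where
  "coprime_exponents k l \<longleftrightarrow> (\<forall>a b. k + a = l + b \<longrightarrow> (\<exists>c. a = l + c))"

text \<open>Two coprime monomials form a regular sequence; divisibility is checked on each exponent
  of \<open>s\<close>.\<close>

lemma coprime_monomials:
  fixes k l :: "'b::cancel_comm_monoid_add" and s t :: "'b \<Rightarrow>\<^sub>0 'a::comm_ring_1"
  assumes "coprime_exponents k l" and eq: "single k 1 * s = single l 1 * t"
  shows "\<exists>r. t = single k 1 * r \<and> s = single l 1 * r"
proof -
  have "a \<in> range (\<lambda>c. l + c)" if "a \<in> keys s" for a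
  proof -
    have "lookup (single l 1 * t) (k + a) \<noteq> 0"
      using that by (simp add: eq[symmetric] lookup_single_times in_keys_iff)
    then have "k + a \<in> keys (single l 1 * t)" by (simp add: in_keys_iff)
    then obtain b where "k + a = l + b" using keys_single_times by blast
    then show ?thesis using assms(1) unfolding coprime_exponents_def by blast
  qed
  then have s: "single l 1 * mon_quot l s = s" by (intro single_times_mon_quot) auto
  then have "single l 1 * (single k 1 * mon_quot l s) = single l 1 * t"
    using eq by (metis mult.left_commute)
  then show ?thesis using s single_times_left_cancel by metis
qed

text \<open>Dividing an element of the ideal of two monomials by a third monomial, coprime to both,
  stays in the ideal. As the ideal is monomial, each exponent of \<open>s\<close> can be tested
  separately.\<close>

lemma monomial_colon:
  fixes k l h :: "'b::cancel_comm_monoid_add" and s t :: "'b \<Rightarrow>\<^sub>0 'a::comm_ring_1"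
  assumes "coprime_exponents h k" "coprime_exponents h l"
    and eq: "single h 1 * s = single k 1 * a - single l 1 * b"
  shows "\<exists>a b. s = single k 1 * a - single l 1 * b"
proof -
  \<comment> \<open>\<open>s1\<close> collects the exponents divisible by \<open>k\<close>; those
    left over in \<open>s2\<close> turn out to be divisible by \<open>l\<close>.\<close>
  define s1 where "s1 = restrict_keys (\<lambda>c. c \<in> range (\<lambda>c. k + c)) s"
  define s2 where "s2 = restrict_keys (\<lambda>c. c \<notin> range (\<lambda>c. k + c)) s"
  have s: "s = s1 + s2" unfolding s1_def s2_def by (rule restrict_keys_split)
  have "c \<in> range (\<lambda>c. l + c)" if "c \<in> keys s" "c \<notin> range (\<lambda>c. k + c)" for c
  proof -
    have "lookup (single k 1 * a - single l 1 * b) (h + c) \<noteq> 0"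
      using that(1) by (simp add: eq[symmetric] lookup_single_times in_keys_iff)
    then have "h + c \<in> keys (single k 1 * a) \<or> h + c \<in> keys (single l 1 * b)"
      by (auto simp: lookup_minus in_keys_iff)
    then consider x where "h + c = k + x" | x where "h + c = l + x"
      using keys_single_times[of k 1 a] keys_single_times[of l 1 b] by auto
    then show ?thesis
    proof cases
      case 1
      then have "c \<in> range (\<lambda>c. k + c)" using assms(1) by (auto simp: coprime_exponents_def)
      then show ?thesis using that(2) by simp
    next
      case 2
      then show ?thesis using assms(2) by (auto simp: coprime_exponents_def)
    qed
  qed
  then have "single l 1 * mon_quot l s2 = s2"
    by (intro single_times_mon_quot) (auto simp: s2_def)
  moreover have "single k 1 * mon_quot k s1 = s1"
    by (intro single_times_mon_quot) (auto simp: s1_def)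
  ultimately have "s = single k 1 * mon_quot k s1 - single l 1 * (- mon_quot l s2)" using s by simp
  then show ?thesis by blast
qed

text \<open>The ideal \<open>(A, B, C)\<close> contains powers of all three variables. The Koszul complex of
  \<open>A, B, C\<close> is then exact because its homology is killed by these powers, which themselves form a
  regular sequence.\<close>

locale koszul =
  fixes A B C :: "'a::comm_ring_1 poly3" and k :: "nat \<Rightarrow> nat \<times> nat \<times> nat"
    and \<alpha> \<beta> \<gamma> :: "nat \<Rightarrow> 'a poly3"
  assumes coprime: "i < 3 \<Longrightarrow> j < 3 \<Longrightarrow> i \<noteq> j \<Longrightarrow> coprime_exponents (k i) (k j)"
    and power: "i < 3 \<Longrightarrow> single (k i) 1 = \<alpha> i * A + \<beta> i * B + \<gamma> i * C"
begin

abbreviation "e i \<equiv> single (k i) (1::'a)"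

text \<open>Injectivity of the first map of the Koszul complex: the ideal contains a monomial, and
  monomials are not zero divisors.\<close>

lemma annihilator_0:
  assumes "A * t = 0" "B * t = 0" "C * t = 0"
  shows "t = 0"
proof -
  have "e 0 * t = \<alpha> 0 * (A * t) + \<beta> 0 * (B * t) + \<gamma> 0 * (C * t)"
    by (subst power) (simp_all add: algebra_simps)
  then show ?thesis using assms single_times_eq_0_iff by fastforce
qed

text \<open>Exactness at the next place. Contraction with the cofactors of \<open>e i\<close> is a
  homotopy for multiplication by \<open>e i\<close>, so \<open>e i\<close> times the cycle is the
  boundary of \<open>s i\<close>. The \<open>s i\<close> agree up to these monomials, and
  coprimality of \<open>e 0\<close> and \<open>e 1\<close> allows division of \<open>s 0\<close> by
  \<open>e 0\<close>.\<close>

lemma second_syzygy: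
  assumes "B * w + C * v = 0" "C * u - A * w = 0" "A * v + B * u = 0"
  shows "\<exists>s. w = C * s \<and> v = - (B * s) \<and> u = A * s"
proof -
  define s where "s i = \<alpha> i * u - \<beta> i * v + \<gamma> i * w" for i
  have eq: "B * w = - (C * v)" "A * w = C * u" "A * v = - (B * u)"
    using assms by (auto simp: eq_neg_iff_add_eq_0)
  have w: "e i * w = C * s i" if "i < 3" for i
  proof -
    have "e i * w = \<alpha> i * (A * w) + \<beta> i * (B * w) + \<gamma> i * (C * w)"
      by (simp only: power[OF that]) (simp add: algebra_simps)
    then show ?thesis by (simp only: eq s_def) (simp add: algebra_simps)
  qed
  have v: "e i * v = - (B * s i)" if "i < 3" for i
  proof -
    have "e i * v = \<alpha> i * (A * v) + \<beta> i * (B * v) + \<gamma> i * (C * v)"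
      by (simp only: power[OF that]) (simp add: algebra_simps)
    moreover have "C * v = - (B * w)" using eq(1) by simp
    ultimately show ?thesis by (simp only: eq(3) s_def) (simp add: algebra_simps)
  qed
  have u: "e i * u = A * s i" if "i < 3" for i
  proof -
    have "e i * u = \<alpha> i * (A * u) + \<beta> i * (B * u) + \<gamma> i * (C * u)"
      by (simp only: power[OF that]) (simp add: algebra_simps)
    moreover have "B * u = - (A * v)" "C * u = A * w" using eq by auto
    ultimately show ?thesis by (simp only: s_def) (simp add: algebra_simps)
  qed
  define t where "t = e 0 * s 1 - e 1 * s 0"
  have "t = 0"
  proof (rule annihilator_0)
    have "A * t = e 0 * (A * s 1) - e 1 * (A * s 0)" by (simp add: t_def algebra_simps)
    then show "A * t = 0" by (simp add: u[symmetric] algebra_simps)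
    have "B * t = e 0 * (B * s 1) - e 1 * (B * s 0)" by (simp add: t_def algebra_simps)
    moreover have "B * s i = - (e i * v)" if "i < 3" for i using v[OF that] by simp
    ultimately show "B * t = 0" by (simp add: algebra_simps)
    have "C * t = e 0 * (C * s 1) - e 1 * (C * s 0)" by (simp add: t_def algebra_simps)
    then show "C * t = 0" by (simp add: w[symmetric] algebra_simps)
  qed
  then have "e 0 * s 1 = e 1 * s 0" by (simp add: t_def)
  from coprime_monomials[OF coprime this] obtain r where r: "s 0 = e 0 * r" by auto
  have "e 0 * w = e 0 * (C * r)" "e 0 * v = e 0 * (- (B * r))" "e 0 * u = e 0 * (A * r)"
    using w[of 0] v[of 0] u[of 0] r by (simp_all add: algebra_simps)
  then show ?thesis unfolding single_times_left_cancel by blast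
qed

text \<open>Every relation is a combination of the trivial ones. The contraction bounds
  \<open>e i\<close> times the relation by \<open>(w i, v i, u i)\<close>. Comparing two indices
  gives cycles, hence boundaries of elements \<open>s i j\<close>; correcting \<open>w 0\<close> and
  \<open>v 0\<close> by these makes them divisible by \<open>e 0\<close>.\<close>

lemma first_syzygy:
  assumes rel: "A * p + B * q + C * r = 0"
  shows "\<exists>w v. p = B * w + C * v"
proof -
  define w where "w i = \<beta> i * p - \<alpha> i * q" for i
  define v where "v i = \<gamma> i * p - \<alpha> i * r" for i
  define u where "u i = \<gamma> i * q - \<beta> i * r" for i
  have A: "A * p = - (B * q) - C * r" using rel by (simp add: eq_diff_eq eq_neg_iff_add_eq_0 algebra_simps)
  have B: "B * q = - (A * p) - C * r" using rel by (simp add: eq_diff_eq eq_neg_iff_add_eq_0 algebra_simps)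
  have C: "C * r = - (A * p) - B * q" using rel by (simp add: eq_diff_eq eq_neg_iff_add_eq_0 algebra_simps)
  have p: "e i * p = B * w i + C * v i" if "i < 3" for i
  proof -
    have "e i * p = \<alpha> i * (A * p) + \<beta> i * (B * p) + \<gamma> i * (C * p)"
      by (simp only: power[OF that]) (simp add: algebra_simps)
    then show ?thesis by (simp only: A w_def v_def) (simp add: algebra_simps)
  qed
  have q: "e i * q = C * u i - A * w i" if "i < 3" for i
  proof -
    have "e i * q = \<alpha> i * (A * q) + \<beta> i * (B * q) + \<gamma> i * (C * q)"
      by (simp only: power[OF that]) (simp add: algebra_simps)
    then show ?thesis by (simp only: B w_def u_def) (simp add: algebra_simps)
  qed
  have r: "e i * r = - (A * v i) - B * u i" if "i < 3" for i
  proof -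
    have "e i * r = \<alpha> i * (A * r) + \<beta> i * (B * r) + \<gamma> i * (C * r)"
      by (simp only: power[OF that]) (simp add: algebra_simps)
    then show ?thesis by (simp only: C v_def u_def) (simp add: algebra_simps)
  qed
  have "\<exists>s. e j * w i - e i * w j = C * s \<and> e j * v i - e i * v j = - (B * s) \<and>
      e j * u i - e i * u j = A * s" if "i < 3" "j < 3" for i j
  proof (rule second_syzygy)
    have "B * (e j * w i - e i * w j) + C * (e j * v i - e i * v j) =
      e j * (B * w i + C * v i) - e i * (B * w j + C * v j)" by (simp add: algebra_simps)
    also have "\<dots> = e j * (e i * p) - e i * (e j * p)" by (simp only: p that)
    finally show "B * (e j * w i - e i * w j) + C * (e j * v i - e i * v j) = 0"
      by (simp only: mult.left_commute diff_self)
    have "C * (e j * u i - e i * u j) - A * (e j * w i - e i * w j) =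
      e j * (C * u i - A * w i) - e i * (C * u j - A * w j)" by (simp add: algebra_simps)
    also have "\<dots> = e j * (e i * q) - e i * (e j * q)" by (simp only: q that)
    finally show "C * (e j * u i - e i * u j) - A * (e j * w i - e i * w j) = 0"
      by (simp only: mult.left_commute diff_self)
    have "A * (e j * v i - e i * v j) + B * (e j * u i - e i * u j) =
      - (e j * (- (A * v i) - B * u i) - e i * (- (A * v j) - B * u j))" by (simp add: algebra_simps)
    also have "\<dots> = - (e j * (e i * r) - e i * (e j * r))" by (simp only: r that)
    finally show "A * (e j * v i - e i * v j) + B * (e j * u i - e i * u j) = 0"
      by (simp only: mult.left_commute diff_self neg_equal_0_iff_equal)
  qed
  then obtain s where s: "\<And>i j. i < 3 \<Longrightarrow> j < 3 \<Longrightarrow> e j * w i - e i * w j = C * s i j"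
      "\<And>i j. i < 3 \<Longrightarrow> j < 3 \<Longrightarrow> e j * v i - e i * v j = - (B * s i j)"
      "\<And>i j. i < 3 \<Longrightarrow> j < 3 \<Longrightarrow> e j * u i - e i * u j = A * s i j"
    by metis
  \<comment> \<open>The cocycle condition for the \<open>s i j\<close>. Multiplied by
    \<open>A\<close>, \<open>B\<close> or \<open>C\<close> it becomes an alternating sum of the
    differences above, which cancels.\<close>
  define t where "t = e 2 * s 0 1 - e 1 * s 0 2 + e 0 * s 1 2"
  have "t = 0"
  proof (rule annihilator_0)
    have "A * t = e 2 * (A * s 0 1) - e 1 * (A * s 0 2) + e 0 * (A * s 1 2)"
      by (simp add: t_def algebra_simps)
    then show "A * t = 0" by (simp add: s(3)[symmetric]) (simp add: algebra_simps)
    have "B * t = - (e 2 * (- (B * s 0 1)) - e 1 * (- (B * s 0 2)) + e 0 * (- (B * s 1 2)))"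
      by (simp add: t_def algebra_simps)
    also have "\<dots> = 0" by (subst (1 2 3) s(2)[symmetric]) (simp_all add: algebra_simps)
    finally show "B * t = 0" .
    have "C * t = e 2 * (C * s 0 1) - e 1 * (C * s 0 2) + e 0 * (C * s 1 2)"
      by (simp add: t_def algebra_simps)
    then show "C * t = 0" by (simp add: s(1)[symmetric]) (simp add: algebra_simps)
  qed
  then have "e 2 * s 0 1 = e 1 * s 0 2 - e 0 * s 1 2" by (simp add: t_def algebra_simps)
  \<comment> \<open>With \<open>s 0 1\<close> in the ideal of \<open>e 0\<close> and
    \<open>e 1\<close>, the discrepancy between the bounds for the indices 0 and 1 splits into a
    correction of each.\<close>
  from monomial_colon[OF coprime coprime this] obtain a b where ab: "s 0 1 = e 1 * a - e 0 * b" by auto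
  have "e 1 * w 0 - e 0 * w 1 = C * (e 1 * a - e 0 * b)" using s(1)[of 0 1] ab by simp
  then have "e 1 * (w 0 - C * a) = e 0 * (w 1 - C * b)" by (simp add: algebra_simps)
  from coprime_monomials[OF coprime this] obtain w' where w': "w 0 - C * a = e 0 * w'" by auto
  have "e 1 * v 0 - e 0 * v 1 = - (B * (e 1 * a - e 0 * b))" using s(2)[of 0 1] ab by simp
  then have "e 1 * (v 0 + B * a) = e 0 * (v 1 + B * b)" by (simp add: algebra_simps)
  from coprime_monomials[OF coprime this] obtain v' where v': "v 0 + B * a = e 0 * v'" by auto
  have "e 0 * p = B * w 0 + C * v 0" by (rule p) simp
  also have "\<dots> = B * (w 0 - C * a) + C * (v 0 + B * a)" by (simp add: algebra_simps)
  also have "\<dots> = e 0 * (B * w' + C * v')" by (simp add: w' v' algebra_simps)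
  finally show ?thesis unfolding single_times_left_cancel by blast
qed

end

section \<open>The ideal of three forms of the same degree\<close>

definition gen_ideal :: "nat \<Rightarrow> 'a::comm_ring_1 poly3 \<Rightarrow> 'a poly3 \<Rightarrow> 'a poly3 \<Rightarrow> (nat \<times> 'a poly3) set" where
  "gen_ideal m A B C = {(n, f). \<exists>p q r. form m n p \<and> form m n q \<and> form m n r \<and> f = p * A + q * B + r * C}"

lemma gen_idealI:
  "form m n p \<Longrightarrow> form m n q \<Longrightarrow> form m n r \<Longrightarrow> f = p * A + q * B + r * C \<Longrightarrow> (n, f) \<in> gen_ideal m A B C"
  unfolding gen_ideal_def by auto

lemma graded_ideal_gen:
  fixes A B C :: "'a::comm_ring_1 poly3"
  assumes "form 0 m A" "form 0 m B" "form 0 m C"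
  shows "graded_ideal (gen_ideal m A B C)"
  unfolding graded_ideal_def
proof (intro conjI allI impI)
  fix n p assume "(n, p) \<in> gen_ideal m A B C"
  then show "form 0 n p"
    unfolding gen_ideal_def using form_mult_cancel assms by (auto intro!: form_add)
next
  fix n show "(n, 0) \<in> gen_ideal m A B C"
    unfolding gen_ideal_def by (auto intro!: exI[of _ "0 :: 'a poly3"])
next
  fix n f f' assume "(n, f) \<in> gen_ideal m A B C" "(n, f') \<in> gen_ideal m A B C"
  then obtain p q r p' q' r' where *: "form m n p" "form m n q" "form m n r" "f = p * A + q * B + r * C"
     "form m n p'" "form m n q'" "form m n r'" "f' = p' * A + q' * B + r' * C"
    unfolding gen_ideal_def by auto
  have "f + f' = (p + p') * A + (q + q') * B + (r + r') * C" by (simp add: * algebra_simps)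
  then show "(n, f + f') \<in> gen_ideal m A B C"
    by (rule gen_idealI[OF form_add[OF *(1,5)] form_add[OF *(2,6)] form_add[OF *(3,7)]])
next
  fix n f t and s :: "'a poly3" assume "(n, f) \<in> gen_ideal m A B C" and s: "form 0 t s"
  then obtain p q r where *: "form m n p" "form m n q" "form m n r" "f = p * A + q * B + r * C"
    unfolding gen_ideal_def by auto
  have "s * f = (s * p) * A + (s * q) * B + (s * r) * C" by (simp add: * algebra_simps)
  moreover have "form m (n + t) (s * g)" if "form m n g" for g
    using form_mult[OF s that] by (simp add: add.commute)
  ultimately show "(n + t, s * f) \<in> gen_ideal m A B C"
    using *(1-3) by (intro gen_idealI)
qed

lemma form_eq_mult_add:
  fixes A B :: "'a::comm_ring_1 poly3"
  assumes "form 0 m A" "form 0 m B" "\<And>k. k \<in> keys p \<Longrightarrow> tdeg k < m" "p = A * w + B * v"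
  shows "p = 0"
proof -
  have "k \<notin> keys p" for k
  proof
    assume k: "k \<in> keys p"
    then have "k \<in> keys (A * w) \<or> k \<in> keys (B * v)"
      using Poly_Mapping.keys_add[of "A * w" "B * v"] assms(4) by blast
    moreover have "m \<le> tdeg k" if "k \<in> keys (E * t)" "form 0 m E" for E t :: "'a poly3"
    proof -
      from that(1) keys_mult[of E t] obtain a b where "k = a + b" "a \<in> keys E" by blast
      then show ?thesis using that(2) by (auto simp: form_def tdeg_add)
    qed
    ultimately show False using assms(1-3) k by (meson not_le)
  qed
  then show ?thesis by (intro poly_mapping_eqI) (simp add: in_keys_iff)
qed

text \<open>By exactness of the Koszul complex each coefficient of a relation lies in the ideal of
  the two other forms, so its terms have degree at least \<open>m\<close>. The coefficients need not
  be homogeneous.\<close>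

lemma low_degree_relations_trivial:
  fixes A B C :: "'a::alg_closed_field poly3"
  assumes f: "form 0 m A" "form 0 m B" "form 0 m C"
    and zeros: "\<And>P. ev A P = 0 \<Longrightarrow> ev B P = 0 \<Longrightarrow> ev C P = 0 \<Longrightarrow> P = (0, 0, 0)"
    and low: "\<And>k. k \<in> keys p \<union> keys q \<union> keys r \<Longrightarrow> tdeg k < m"
    and rel: "A * p + B * q + C * r = 0"
  shows "p = 0 \<and> q = 0 \<and> r = 0"
proof -
  have mem: "(m, A) \<in> gen_ideal m A B C" "(m, B) \<in> gen_ideal m A B C" "(m, C) \<in> gen_ideal m A B C"
  proof -
    have 1: "form m m (1::'a poly3)" by (simp add: form_def zero_prod_def)
    have "A = 1 * A + 0 * B + 0 * C" "B = 0 * A + 1 * B + 0 * C" "C = 0 * A + 0 * B + 1 * C" by auto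
    then show "(m, A) \<in> gen_ideal m A B C" "(m, B) \<in> gen_ideal m A B C" "(m, C) \<in> gen_ideal m A B C"
      by (auto intro: gen_idealI[OF 1 form_0 form_0] gen_idealI[OF form_0 1 form_0] gen_idealI[OF form_0 form_0 1])
  qed
  have "irrelevant (gen_ideal m A B C)"
  proof (rule homogeneous_nullstellensatz[OF graded_ideal_gen[OF f]])
    fix P :: "'a \<times> 'a \<times> 'a" assume "P \<noteq> (0, 0, 0)"
    then show "\<exists>(n, p)\<in>gen_ideal m A B C. ev p P \<noteq> 0" using zeros[of P] mem by blast
  qed
  then obtain N where N: "\<And>p. form 0 N p \<Longrightarrow> (N, p) \<in> gen_ideal m A B C"
    unfolding irrelevant_def by blast
  \<comment> \<open>All forms of degree \<open>N\<close> lie in the ideal, in particular the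
    \<open>N\<close>-th powers of the three variables, which are pairwise coprime.\<close>
  define k where "k i = (if i = 0 then (N, 0, 0) else if i = 1 then (0, N, 0) else (0, 0, N))" for i :: nat
  have "\<exists>a b c. single (k i) 1 = a * A + b * B + c * C" for i
  proof -
    have "form 0 N (single (k i) (1::'a))" by (rule form_single) (simp add: k_def)
    from N[OF this] show ?thesis unfolding gen_ideal_def by auto
  qed
  then obtain \<alpha> \<beta> \<gamma> where abc: "\<And>i. single (k i) 1 = \<alpha> i * A + \<beta> i * B + \<gamma> i * C"
    by metis
  have cop: "coprime_exponents (k i) (k j)" if "i < 3" "j < 3" "i \<noteq> j" for i j
    unfolding coprime_exponents_def
  proof (intro allI impI)
    fix a b assume eq: "k i + a = k j + b"
    obtain a1 a2 a3 b1 b2 b3 where ab: "a = (a1, a2, a3)" "b = (b1, b2, b3)" by (metis prod_cases3)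
    have "a = k j + (if j = 0 then (a1 - N, a2, a3) else if j = 1 then (a1, a2 - N, a3) else (a1, a2, a3 - N))"
      using eq that by (auto simp: k_def ab split: if_splits)
    then show "\<exists>c. a = k j + c" by blast
  qed
  have "koszul A B C k \<alpha> \<beta> \<gamma>" by unfold_locales (use cop abc in auto)
  from koszul.first_syzygy[OF this rel] obtain w v where "p = B * w + C * v" by blast
  then have "p = 0" using form_eq_mult_add[OF f(2,3)] low by blast
  \<comment> \<open>The Koszul hypotheses are symmetric in the three forms, so the other two
    coefficients follow by permuting them.\<close>
  have "koszul B A C k \<beta> \<alpha> \<gamma>" by unfold_locales (use cop abc in \<open>auto simp: ac_simps\<close>)
  moreover have "B * q + A * p + C * r = 0" using rel by (simp add: ac_simps)
  ultimately obtain w v where "q = A * w + C * v" using koszul.first_syzygy by blast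
  then have "q = 0" using form_eq_mult_add[OF f(1,3)] low by blast
  have "koszul C A B k \<gamma> \<alpha> \<beta>" by unfold_locales (use cop abc in \<open>auto simp: ac_simps\<close>)
  moreover have "C * r + A * p + B * q = 0" using rel by (simp add: ac_simps)
  ultimately obtain w v where "r = A * w + B * v" using koszul.first_syzygy by blast
  then have "r = 0" using form_eq_mult_add[OF f(1,2)] low by blast
  then show ?thesis using \<open>p = 0\<close> \<open>q = 0\<close> by simp
qed

section \<open>Reduction to three generators\<close>

text \<open>Over a finite field, the polynomial that is 1 plus the product of all
  \<open>x - a\<close> has no root.\<close>

lemma infinite_UNIV_alg_closed: "infinite (UNIV :: 'a::alg_closed_field set)"
proof
  assume fin: "finite (UNIV :: 'a set)"
  define P :: "'a poly" where "P = (\<Prod>a\<in>UNIV. [:- a, 1:]) + 1"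
  have "degree (\<Prod>a\<in>(UNIV::'a set). [:- a, 1:]) = card (UNIV :: 'a set)"
    by (subst degree_prod_eq_sum_degree) auto
  then have "degree (\<Prod>a\<in>(UNIV::'a set). [:- a, 1:]) > degree (1 :: 'a poly)"
    using fin by (simp add: finite_UNIV_card_ge_0)
  then have "degree P > 0" unfolding P_def by (subst degree_add_eq_left) auto
  then obtain x where "poly P x = 0" using alg_closed_imp_poly_has_root by blast
  moreover have "poly P x = 1" using fin by (simp add: P_def poly_prod)
  ultimately show False by simp
qed

lemma ex_nonroot:
  fixes x :: "nat \<Rightarrow> 'a::alg_closed_field"
  assumes "i \<le> n" "x i \<noteq> 0"
  shows "\<exists>c. (\<Sum>i\<le>n. x i * c ^ i) \<noteq> 0"
proof -
  define P where "P = (\<Sum>i\<le>n. monom (x i) i)"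
  have "coeff P i = x i" using assms by (simp add: P_def coeff_sum coeff_monom sum.delta)
  then have "P \<noteq> 0" using assms by auto
  then have "{c. poly P c = 0} \<noteq> UNIV" using poly_roots_finite infinite_UNIV_alg_closed by metis
  then show ?thesis by (auto simp: P_def poly_sum poly_monom)
qed

lemma ex_nonroot3:
  fixes x :: "nat \<Rightarrow> nat \<Rightarrow> nat \<Rightarrow> 'a::alg_closed_field"
  assumes "i \<le> n" "j \<le> n" "l \<le> n" "x i j l \<noteq> 0"
  shows "\<exists>a b c. (\<Sum>i\<le>n. \<Sum>j\<le>n. \<Sum>l\<le>n. x i j l * a ^ i * b ^ j * c ^ l) \<noteq> 0"
proof -
  obtain c where c: "(\<Sum>l\<le>n. x i j l * c ^ l) \<noteq> 0" using ex_nonroot assms by blast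
  obtain b where b: "(\<Sum>j\<le>n. (\<Sum>l\<le>n. x i j l * c ^ l) * b ^ j) \<noteq> 0"
    using ex_nonroot[of j n "\<lambda>j. \<Sum>l\<le>n. x i j l * c ^ l"] assms c by blast
  obtain a where a: "(\<Sum>i\<le>n. (\<Sum>j\<le>n. (\<Sum>l\<le>n. x i j l * c ^ l) * b ^ j) * a ^ i) \<noteq> 0"
    using ex_nonroot[of i n "\<lambda>i. \<Sum>j\<le>n. (\<Sum>l\<le>n. x i j l * c ^ l) * b ^ j"] assms b by blast
  have "(\<Sum>i\<le>n. (\<Sum>j\<le>n. (\<Sum>l\<le>n. x i j l * c ^ l) * b ^ j) * a ^ i) =
      (\<Sum>i\<le>n. \<Sum>j\<le>n. \<Sum>l\<le>n. x i j l * a ^ i * b ^ j * c ^ l)"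
    by (simp add: sum_distrib_left sum_distrib_right ac_simps)
  then show ?thesis using a by metis
qed

text \<open>By counting, \<open>A\<close>, \<open>B\<close>, \<open>C\<close>, \<open>G\<close> satisfy a homogeneous algebraic relation. A zero of the
  three differences where \<open>G\<close> does not vanish would make \<open>(a, b, c)\<close> a zero of its dehomogenization.\<close>

lemma generic_differences:
  fixes A B C G :: "'a::alg_closed_field poly3"
  assumes f: "form 0 m A" "form 0 m B" "form 0 m C" "form 0 m G"
  shows "\<exists>a b c. \<forall>P. ev (A - single 0 a * G) P = 0 \<and> ev (B - single 0 b * G) P = 0 \<and>
    ev (C - single 0 c * G) P = 0 \<longrightarrow> ev A P = 0 \<and> ev B P = 0 \<and> ev C P = 0 \<and> ev G P = 0"
proof -
  \<comment> \<open>Chosen so that the count closes: there are \<open>(e + 1)^3\<close> products,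
    while the forms of degree \<open>3 e m\<close> have at most \<open>(3 e m + 1)^2\<close>
    monomials, and this is at most \<open>((3 m + 1) (e + 1))^2 = e (e + 1)^2\<close>.\<close>
  define e where "e = (3 * m + 1)\<^sup>2"
  define J where "J = {k. tdeg k = m * (3 * e)}"
  define I where "I = {..e} \<times> {..e} \<times> {..e}"
  \<comment> \<open>The power of \<open>G\<close> brings all products to the common degree
    \<open>3 e m\<close>.\<close>
  define F where "F = (\<lambda>(i, j, l). A ^ i * B ^ j * C ^ l * G ^ (3 * e - (i + j + l)))"
  have "card J \<le> card ({..m * (3 * e)} \<times> {..m * (3 * e)})"
    by (rule card_inj_on_le[of "\<lambda>(i, j, l). (i, j)"]) (auto simp: J_def inj_on_def)
  also have "\<dots> = (m * (3 * e) + 1)\<^sup>2" by (simp add: card_cartesian_product power2_eq_square)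
  also have "\<dots> \<le> ((3 * m + 1) * (e + 1))\<^sup>2" by (intro power_mono) (auto simp: algebra_simps)
  also have "\<dots> = e * (e + 1)\<^sup>2" by (simp only: e_def power_mult_distrib)
  also have "\<dots> < (e + 1) * (e + 1)\<^sup>2" by simp
  also have "\<dots> = card I" by (simp add: I_def card_cartesian_product power2_eq_square)
  finally have "card J < card I" .
  moreover have "finite J" "finite I" using finite_tdeg by (auto simp: J_def I_def)
  ultimately obtain x where x: "\<exists>i\<in>I. x i \<noteq> 0" "\<forall>k\<in>J. (\<Sum>i\<in>I. x i * lookup (F i) k) = 0"
    using underdetermined_system[of J I "\<lambda>i. lookup (F i)"] by blast
  have F: "form 0 (m * (3 * e)) (F i)" if "i \<in> I" for i
  proof -
    obtain i1 i2 i3 where i: "i = (i1, i2, i3)" by (cases i)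
    have le: "i1 + i2 + i3 \<le> 3 * e" using that by (auto simp: I_def i)
    have "form 0 (m * i1 + m * i2 + m * i3 + m * (3 * e - (i1 + i2 + i3))) (F i)"
      using form_mult[OF form_mult[OF form_mult[OF form_power[OF f(1), of i1] form_power[OF f(2), of i2]]
        form_power[OF f(3), of i3]] form_power[OF f(4), of "3 * e - (i1 + i2 + i3)"]]
      by (simp add: F_def i)
    also have "m * i1 + m * i2 + m * i3 + m * (3 * e - (i1 + i2 + i3)) = m * (3 * e)"
      using le by (simp flip: distrib_left)
    finally show ?thesis .
  qed
  have rel: "(\<Sum>i\<in>I. single 0 (x i) * F i) = 0"
  proof (rule poly_mapping_eqI)
    fix k
    show "lookup (\<Sum>i\<in>I. single 0 (x i) * F i) k = lookup 0 k"
    proof (cases "k \<in> J")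
      case True
      then show ?thesis using x(2) by (simp add: lookup_sum lookup_const_times)
    next
      case False
      then have "lookup (F i) k = 0" if "i \<in> I" for i
        using F[OF that] by (auto simp: form_def in_keys_iff J_def)
      then show ?thesis by (simp add: lookup_sum lookup_const_times)
    qed
  qed
  obtain i j l where "i \<le> e" "j \<le> e" "l \<le> e" "x (i, j, l) \<noteq> 0" using x(1) by (auto simp: I_def)
  from ex_nonroot3[OF this(1-3), of "\<lambda>i j l. x (i, j, l)"] this(4)
  obtain a b c where abc: "(\<Sum>i\<le>e. \<Sum>j\<le>e. \<Sum>l\<le>e. x (i, j, l) * a ^ i * b ^ j * c ^ l) \<noteq> 0" by blast
  have "ev G P = 0" if "ev A P = a * ev G P" "ev B P = b * ev G P" "ev C P = c * ev G P" for P
  proof (rule ccontr)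
    assume G: "ev G P \<noteq> 0"
    have "0 = ev (\<Sum>i\<in>I. single 0 (x i) * F i) P" by (simp add: rel)
    also have "\<dots> = (\<Sum>i\<in>I. x i * ev (F i) P)" by simp
    also have "\<dots> = (\<Sum>(i, j, l)\<in>I. x (i, j, l) * a ^ i * b ^ j * c ^ l * ev G P ^ (3 * e))"
    proof (rule sum.cong)
      fix t assume "t \<in> I"
      then obtain i j l where t: "t = (i, j, l)" "i + j + l \<le> 3 * e" by (auto simp: I_def)
      have "ev G P ^ (3 * e) = ev G P ^ (i + j + l + (3 * e - (i + j + l)))" using t(2) by simp
      then show "x t * ev (F t) P = (case t of (i, j, l) \<Rightarrow> x (i, j, l) * a ^ i * b ^ j * c ^ l * ev G P ^ (3 * e))"
        by (simp only: t F_def prod.case ev_mult ev_power that power_mult_distrib power_add ac_simps)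
    qed simp
    also have "\<dots> = (\<Sum>i\<le>e. \<Sum>j\<le>e. \<Sum>l\<le>e. x (i, j, l) * a ^ i * b ^ j * c ^ l) * ev G P ^ (3 * e)"
      by (simp add: I_def sum_distrib_right flip: sum.cartesian_product)
    finally show False using abc G by simp
  qed
  then show ?thesis by (intro exI[of _ a] exI[of _ b] exI[of _ c]) auto
qed

lemma form_of_single_times:
  fixes p :: "'a::comm_ring_1 poly3"
  assumes "form e n (single k 1 * p)"
  shows "form (tdeg k + e) n p"
  unfolding form_def
proof
  fix l assume "l \<in> keys p"
  then have "k + l \<in> keys (single k 1 * p)" by (simp add: in_keys_iff lookup_single_times)
  then have "tdeg (k + l) + e = n" using assms by (auto simp: form_def simp del: tdeg_simp)
  then show "tdeg l + (tdeg k + e) = n" by (simp add: tdeg_add)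
qed

lemma form_Suc: "form (Suc e) (Suc n) p \<longleftrightarrow> form e n p"
  by (auto simp: form_def)

lemma form_1_eq: "form 1 (Suc n) p \<longleftrightarrow> form 0 n p"
  using form_Suc[of 0 n p] by simp

text \<open>\<open>D\<close> has degree \<open>m - 1\<close>, so the multiples that can be
  subtracted from \<open>A, B, C\<close> are those of \<open>x D\<close>, \<open>y D\<close>,
  \<open>z D\<close>. They are treated one after the other. At a common zero of the final forms all
  of \<open>A, B, C, x D, y D, z D\<close> vanish; then \<open>D\<close> vanishes there too, or all
  three coordinates do.\<close>

lemma general_position:
  fixes A B C D :: "'a::alg_closed_field poly3"
  assumes f: "form 0 m A" "form 0 m B" "form 0 m C" "form 1 m D"
    and zeros: "\<And>P. ev A P = 0 \<Longrightarrow> ev B P = 0 \<Longrightarrow> ev C P = 0 \<Longrightarrow> ev D P = 0 \<Longrightarrow> P = (0, 0, 0)"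
  shows "\<exists>f g h. form 0 1 f \<and> form 0 1 g \<and> form 0 1 h \<and> (\<forall>P. ev (A - f * D) P = 0 \<longrightarrow>
    ev (B - g * D) P = 0 \<longrightarrow> ev (C - h * D) P = 0 \<longrightarrow> P = (0, 0, 0))"
proof -
  define x where "x = (single (1, 0, 0) 1 :: 'a poly3)"
  define y where "y = (single (0, 1, 0) 1 :: 'a poly3)"
  define z where "z = (single (0, 0, 1) 1 :: 'a poly3)"
  have xyz: "form 0 1 x" "form 0 1 y" "form 0 1 z"
    by (simp_all add: x_def y_def z_def form_single)
  have G: "form 0 m (t * D)" if "form 0 1 t" for t
    using form_mult[OF that f(4)] form_1_eq[of m "t * D"] by simp
  have next_form: "form 0 m (E - single 0 c * (t * D))" if "form 0 m E" "form 0 1 t" for E c t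
    using that G by auto
  obtain a1 b1 c1 where 1: "\<And>P. ev (A - single 0 a1 * (x * D)) P = 0 \<Longrightarrow> ev (B - single 0 b1 * (x * D)) P = 0 \<Longrightarrow>
    ev (C - single 0 c1 * (x * D)) P = 0 \<Longrightarrow> ev A P = 0 \<and> ev B P = 0 \<and> ev C P = 0 \<and> ev (x * D) P = 0"
    using generic_differences[OF f(1-3) G[OF xyz(1)]] by blast
  define A1 B1 C1 where "A1 = A - single 0 a1 * (x * D)" and "B1 = B - single 0 b1 * (x * D)"
    and "C1 = C - single 0 c1 * (x * D)"
  have f1: "form 0 m A1" "form 0 m B1" "form 0 m C1"
    unfolding A1_def B1_def C1_def using f xyz by (auto intro: next_form)
  obtain a2 b2 c2 where 2: "\<And>P. ev (A1 - single 0 a2 * (y * D)) P = 0 \<Longrightarrow> ev (B1 - single 0 b2 * (y * D)) P = 0 \<Longrightarrow>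
    ev (C1 - single 0 c2 * (y * D)) P = 0 \<Longrightarrow> ev A1 P = 0 \<and> ev B1 P = 0 \<and> ev C1 P = 0 \<and> ev (y * D) P = 0"
    using generic_differences[OF f1 G[OF xyz(2)]] by blast
  define A2 B2 C2 where "A2 = A1 - single 0 a2 * (y * D)" and "B2 = B1 - single 0 b2 * (y * D)"
    and "C2 = C1 - single 0 c2 * (y * D)"
  have f2: "form 0 m A2" "form 0 m B2" "form 0 m C2"
    unfolding A2_def B2_def C2_def using f1 xyz by (auto intro: next_form)
  obtain a3 b3 c3 where 3: "\<And>P. ev (A2 - single 0 a3 * (z * D)) P = 0 \<Longrightarrow> ev (B2 - single 0 b3 * (z * D)) P = 0 \<Longrightarrow>
    ev (C2 - single 0 c3 * (z * D)) P = 0 \<Longrightarrow> ev A2 P = 0 \<and> ev B2 P = 0 \<and> ev C2 P = 0 \<and> ev (z * D) P = 0"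
    using generic_differences[OF f2 G[OF xyz(3)]] by blast
  define lin where "lin a b c = single 0 a * x + single 0 b * y + single 0 c * z" for a b c
  have lin: "form 0 1 (lin a b c)" for a b c unfolding lin_def using xyz by auto
  have eq: "A - lin a1 a2 a3 * D = A2 - single 0 a3 * (z * D)"
    "B - lin b1 b2 b3 * D = B2 - single 0 b3 * (z * D)"
    "C - lin c1 c2 c3 * D = C2 - single 0 c3 * (z * D)"
    by (simp_all add: A2_def B2_def C2_def A1_def B1_def C1_def lin_def algebra_simps)
  have "P = (0, 0, 0)" if "ev (A - lin a1 a2 a3 * D) P = 0" "ev (B - lin b1 b2 b3 * D) P = 0"
    "ev (C - lin c1 c2 c3 * D) P = 0" for P
  proof -
    have z3: "ev A2 P = 0" "ev B2 P = 0" "ev C2 P = 0" "ev (z * D) P = 0"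
      using 3[of P] that unfolding eq by auto
    have z2: "ev A1 P = 0" "ev B1 P = 0" "ev C1 P = 0" "ev (y * D) P = 0"
      using 2[of P] z3 unfolding A2_def B2_def C2_def by auto
    have z1: "ev A P = 0" "ev B P = 0" "ev C P = 0" "ev (x * D) P = 0"
      using 1[of P] z2 unfolding A1_def B1_def C1_def by auto
    show ?thesis
    proof (cases "ev D P = 0")
      case True
      then show ?thesis using zeros z1 by blast
    next
      case False
      then have "ev x P = 0" "ev y P = 0" "ev z P = 0" using z1(4) z2(4) z3(4) by auto
      then show ?thesis by (cases P) (simp add: x_def y_def z_def mval_def)
    qed
  qed
  then show ?thesis using lin by blast
qed

text \<open>Descent: if \<open>D\<close> times all forms of degree \<open>t + 1\<close> lies in \<open>(A, B, C)\<close> and there are no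
  relations in low degree, then the coefficients for \<open>x w\<close> and \<open>y w\<close> are compatible, hence divisible by
  \<open>x\<close> and \<open>y\<close>, and the same holds in degree \<open>t\<close>.\<close>

lemma eq_0_of_multiples_in_ideal:
  fixes A B C D :: "'a::comm_ring_1 poly3"
  assumes D: "form 1 m D"
    and low: "\<And>p q r. (\<And>k. k \<in> keys p \<union> keys q \<union> keys r \<Longrightarrow> tdeg k < m) \<Longrightarrow>
      A * p + B * q + C * r = 0 \<Longrightarrow> p = 0 \<and> q = 0 \<and> r = 0"
    and span: "\<And>w. form 1 m w \<Longrightarrow>
      \<exists>p q r. form 2 m p \<and> form 2 m q \<and> form 2 m r \<and> D * w = A * p + B * q + C * r"
  shows "D = 0"
proof (cases m)
  case 0
  then show ?thesis using form_less_eq_0[OF D] by simp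
next
  case (Suc n)
  \<comment> \<open>\<open>R t\<close>: in the ideal of \<open>A, B, C\<close> lie all products of
    \<open>D\<close> with forms of degree \<open>t\<close>, with cofactors of degree
    \<open>t - 1\<close>. The hypothesis is \<open>R (m - 1)\<close>, the goal is
    \<open>R 0\<close>.\<close>
  define R where "R t \<longleftrightarrow> (\<forall>w. form 0 t w \<longrightarrow>
    (\<exists>p q r. form 1 t p \<and> form 1 t q \<and> form 1 t r \<and> D * w = A * p + B * q + C * r))" for t
  have shift: "form 1 (Suc n) g \<longleftrightarrow> form 0 n g" "form 2 (Suc n) g \<longleftrightarrow> form 1 n g" for g :: "'a poly3"
    using form_Suc[of 0 n g] form_Suc[of 1 n g] by (simp_all add: numeral_2_eq_2)
  have "R n" unfolding R_def using span unfolding Suc shift by blast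
  have step: "R t" if R: "R (Suc t)" and t: "t < n" for t
    unfolding R_def
  proof (intro allI impI)
    fix w :: "'a poly3" assume w: "form 0 t w"
    define x where "x = (single (1, 0, 0) 1 :: 'a poly3)"
    define y where "y = (single (0, 1, 0) 1 :: 'a poly3)"
    have xy: "form 0 1 x" "form 0 1 y" by (simp_all add: x_def y_def form_single)
    have "form 0 (Suc t) (x * w)" "form 0 (Suc t) (y * w)"
      using form_mult[OF xy(1) w] form_mult[OF xy(2) w] by auto
    then obtain p q r p' q' r' where
      p: "form 1 (Suc t) p" "form 1 (Suc t) q" "form 1 (Suc t) r" "D * (x * w) = A * p + B * q + C * r" and
      p': "form 1 (Suc t) p'" "form 1 (Suc t) q'" "form 1 (Suc t) r'" "D * (y * w) = A * p' + B * q' + C * r'"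
      using R unfolding R_def by metis
    have deg: "tdeg k < m" if "form 1 (Suc t) g" "form 1 (Suc t) g'" "k \<in> keys (y * g - x * g')" for g g' k
    proof -
      have "form 0 (Suc t) (y * g - x * g')"
        using that(1,2) form_mult[OF xy(2), of 0 t g] form_mult[OF xy(1), of 0 t g'] by (auto simp: form_Suc)
      then show ?thesis using that(3) t Suc by (auto simp: form_def)
    qed
    \<comment> \<open>Two expressions of \<open>x y D w\<close> are compared. The resulting relation
      has coefficients of degree \<open>t + 1 < m\<close>, so it is trivial.\<close>
    have "A * (y * p - x * p') + B * (y * q - x * q') + C * (y * r - x * r') =
      y * (D * (x * w)) - x * (D * (y * w))" by (simp only: p(4) p'(4)) (simp add: algebra_simps)
    then have "A * (y * p - x * p') + B * (y * q - x * q') + C * (y * r - x * r') = 0"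
      by (simp add: algebra_simps)
    then have "y * p - x * p' = 0 \<and> y * q - x * q' = 0 \<and> y * r - x * r' = 0"
      using deg p p' by (intro low) blast
    then have eq: "y * p = x * p'" "y * q = x * q'" "y * r = x * r'" by auto
    have cop: "coprime_exponents (0, 1, 0) ((1, 0, 0) :: nat \<times> nat \<times> nat)"
      unfolding coprime_exponents_def
    proof (intro allI impI)
      fix a b :: "nat \<times> nat \<times> nat" assume "(0, 1, 0) + a = (1, 0, 0) + b"
      then have "a = (1, 0, 0) + (fst a - 1, snd a)" by (cases a; cases b) auto
      then show "\<exists>c. a = (1, 0, 0) + c" by blast
    qed
    have div_x: "\<exists>u. g = x * u \<and> form 1 t u" if "y * g = x * g'" "form 1 (Suc t) g" for g g'
    proof -
      from coprime_monomials[OF cop that(1)[unfolded x_def y_def]] obtain u where "g = x * u"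
        unfolding x_def by blast
      moreover have "form 0 t (x * u)" using that(2) calculation by (simp add: form_Suc)
      ultimately show ?thesis
        using form_of_single_times[of 0 t "(1, 0, 0)" u] by (auto simp: x_def)
    qed
    obtain u1 u2 u3 where u: "p = x * u1" "form 1 t u1" "q = x * u2" "form 1 t u2" "r = x * u3" "form 1 t u3"
      using div_x[OF eq(1) p(1)] div_x[OF eq(2) p(2)] div_x[OF eq(3) p(3)] by blast
    have "x * (D * w) = x * (A * u1 + B * u2 + C * u3)" using p(4) by (simp add: u algebra_simps)
    then have "D * w = A * u1 + B * u2 + C * u3" unfolding x_def single_times_left_cancel .
    then show "\<exists>p q r. form 1 t p \<and> form 1 t q \<and> form 1 t r \<and> D * w = A * p + B * q + C * r"
      using u by blast
  qed
  have "R (n - j)" for j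
  proof (induction j)
    case 0
    then show ?case using \<open>R n\<close> by simp
  next
    case (Suc j)
    then show ?case using step[of "n - Suc j"] by (cases "j < n") (auto simp: Suc_diff_Suc)
  qed
  from this[of n] have "R 0" by simp
  moreover have "form 0 0 (1 :: 'a poly3)" by (simp add: form_def zero_prod_def)
  ultimately obtain p q r where pqr: "form 1 0 p" "form 1 0 q" "form 1 0 r"
      "D * 1 = A * p + B * q + C * r"
    unfolding R_def by blast
  \<comment> \<open>In \<open>R 0\<close> the cofactors have degree -1.\<close>
  have "p = 0" "q = 0" "r = 0" by (rule form_less_eq_0[OF pqr(1)] form_less_eq_0[OF pqr(2)] form_less_eq_0[OF pqr(3)]; simp)+
  then show ?thesis using pqr(4) by simp
qed

text \<open>The index \<open>(j, k)\<close> with \<open>j < 3\<close> stands for the monomial of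
  \<open>k\<close> times the \<open>j\<close>-th of three general combinations
  \<open>A', B', C'\<close>. These products are independent because a dependence would be a relation
  with coefficients of degree \<open>m - 2\<close>. If \<open>D\<close> is not 0, the index 3
  contributes one further element \<open>D w\<close> outside their span. All are rewritten in terms
  of the original \<open>A, B, C, D\<close>.\<close>

lemma ex_independent_combinations:
  fixes A B C D :: "'a::alg_closed_field poly3" and m :: nat
  defines "I \<equiv> {..<3} \<times> {k. tdeg k + 2 = m} \<union> (if D = 0 then {} else {(3::nat, (0, 0, 0))})"
  assumes f: "form 0 m A" "form 0 m B" "form 0 m C" "form 1 m D"
    and zeros: "\<And>P. ev A P = 0 \<Longrightarrow> ev B P = 0 \<Longrightarrow> ev C P = 0 \<Longrightarrow> ev D P = 0 \<Longrightarrow> P = (0, 0, 0)"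
  shows "\<exists>p q r s. (\<forall>i\<in>I. form 2 m (p i) \<and> form 2 m (q i) \<and> form 2 m (r i) \<and> form 1 m (s i)) \<and>
    (\<forall>x. (\<Sum>i\<in>I. single 0 (x i) * (A * p i + B * q i + C * r i + D * s i)) = 0 \<longrightarrow> (\<forall>i\<in>I. x i = 0))"
proof -
  obtain a b c where abc: "form 0 1 a" "form 0 1 b" "form 0 1 c" and
    pos: "\<And>P. ev (A - a * D) P = 0 \<Longrightarrow> ev (B - b * D) P = 0 \<Longrightarrow> ev (C - c * D) P = 0 \<Longrightarrow> P = (0, 0, 0)"
    using general_position[OF f zeros] by blast
  define A' B' C' where "A' = A - a * D" and "B' = B - b * D" and "C' = C - c * D"
  have f': "form 0 m A'" "form 0 m B'" "form 0 m C'"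
  proof -
    have "form 0 m (l * D)" if "form 0 1 l" for l
      using form_mult[OF that f(4)] form_1_eq[of m "l * D"] by simp
    then show "form 0 m A'" "form 0 m B'" "form 0 m C'"
      using f abc by (auto simp: A'_def B'_def C'_def)
  qed
  note low = low_degree_relations_trivial[OF f' pos[folded A'_def B'_def C'_def]]
  define K where "K = {k. tdeg k + 2 = m}"
  have finK: "finite K" by (rule finite_subset[OF _ finite_tdeg[of "m - 2"]]) (auto simp: K_def)
  define span where "span w \<longleftrightarrow>
    (\<exists>p q r. form 2 m p \<and> form 2 m q \<and> form 2 m r \<and> D * w = A' * p + B' * q + C' * r)" for w
  have "\<exists>w. form 1 m w \<and> (D \<noteq> 0 \<longrightarrow> \<not> span w)"
  proof (cases "D = 0")
    case True
    then show ?thesis using form_0 by blast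
  next
    case False
    have "\<not> (\<forall>w. form 1 m w \<longrightarrow> span w)"
    proof
      assume "\<forall>w. form 1 m w \<longrightarrow> span w"
      then have "D = 0" unfolding span_def
        by (intro eq_0_of_multiples_in_ideal[OF f(4), of A' B' C']) (use low in blast)+
      then show False using False by simp
    qed
    then show ?thesis by blast
  qed
  then obtain w where w: "form 1 m w" "D \<noteq> 0 \<Longrightarrow> \<not> span w" by blast
  \<comment> \<open>A multiple of \<open>A' = A - a D\<close> has the same multiple as cofactor of
    \<open>A\<close>, and \<open>- a\<close> times it as cofactor of \<open>D\<close>; likewise for
    \<open>B'\<close> and \<open>C'\<close>.\<close>
  define p q r s where "p = (\<lambda>(j::nat, k). if j = 0 then single k 1 else (0 :: 'a poly3))"
    and "q = (\<lambda>(j::nat, k). if j = 1 then single k 1 else (0 :: 'a poly3))"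
    and "r = (\<lambda>(j::nat, k). if j = 2 then single k 1 else (0 :: 'a poly3))"
    and "s = (\<lambda>(j::nat, k). if j = 0 then - (a * single k 1) else if j = 1 then - (b * single k 1)
       else if j = 2 then - (c * single k 1) else w)"
  have forms: "form 2 m (p i) \<and> form 2 m (q i) \<and> form 2 m (r i) \<and> form 1 m (s i)" if "i \<in> I" for i
  proof -
    obtain j k where i: "i = (j, k)" by (cases i)
    have "form 2 m (single k (1::'a)) \<and> form 1 m (l * single k 1)" if "form 0 1 l" "j < 3" for l :: "'a poly3"
    proof -
      have k: "form 2 m (single k (1::'a))" using \<open>i \<in> I\<close> that(2) by (intro form_single) (auto simp: I_def i split: if_splits)
      moreover have "form 1 m (l * single k 1)"
        using form_mult[OF that(1) k] form_Suc[of 1 m "l * single k 1"] by (simp add: numeral_2_eq_2)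
      ultimately show ?thesis by simp
    qed
    then show ?thesis using abc w(1) by (auto simp: i p_def q_def r_def s_def)
  qed
  have "\<forall>i\<in>I. x i = 0"
    if x: "(\<Sum>i\<in>I. single 0 (x i) * (A * p i + B * q i + C * r i + D * s i)) = 0" for x
  proof -
    define \<Phi> where "\<Phi> i = single 0 (x i) * (A * p i + B * q i + C * r i + D * s i)" for i
    define T where "T j = (\<Sum>k\<in>K. single k (x (j, k)))" for j :: nat
    have \<Phi>: "\<Phi> (0, k) = A' * single k (x (0, k))" "\<Phi> (1, k) = B' * single k (x (1, k))"
      "\<Phi> (2, k) = C' * single k (x (2, k))" "\<Phi> (3, k) = D * (single 0 (x (3, k)) * w)" for k
    proof -
      have e: "single k c = single k 1 * single 0 c" for c :: 'a by (simp add: mult_single)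
      show "\<Phi> (0, k) = A' * single k (x (0, k))" "\<Phi> (1, k) = B' * single k (x (1, k))"
        "\<Phi> (2, k) = C' * single k (x (2, k))"
        by (subst e; simp add: \<Phi>_def p_def q_def r_def s_def A'_def B'_def C'_def algebra_simps)+
      show "\<Phi> (3, k) = D * (single 0 (x (3, k)) * w)"
        by (simp add: \<Phi>_def p_def q_def r_def s_def algebra_simps)
    qed
    have three: "{..<3::nat} = {0, 1, 2}" by auto
    have "sum \<Phi> I = sum \<Phi> ({..<3} \<times> K) + (if D = 0 then 0 else \<Phi> (3, (0, 0, 0)))"
      unfolding I_def K_def[symmetric] using finK by (subst sum.union_disjoint) auto
    also have "sum \<Phi> ({..<3} \<times> K) = (\<Sum>j\<in>{0, 1, 2}. \<Sum>k\<in>K. \<Phi> (j, k))"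
      unfolding three by (simp add: sum.cartesian_product del: insert_iff)
    also have "\<dots> = A' * T 0 + B' * T 1 + C' * T 2"
      using \<Phi> by (simp add: T_def sum_distrib_left)
    finally have rel: "A' * T 0 + B' * T 1 + C' * T 2 + (if D = 0 then 0 else \<Phi> (3, (0, 0, 0))) = 0"
      using x by (simp add: \<Phi>_def)
    have fT: "form 2 m (T j)" for j
      unfolding T_def by (intro form_sum form_single) (simp add: K_def)
    have x3: "D = 0 \<or> x (3, (0, 0, 0)) = 0"
    proof (rule ccontr)
      assume "\<not> ?thesis"
      then have nz: "D \<noteq> 0" "x (3, (0, 0, 0)) \<noteq> 0" by auto
      define t where "t = single (0 :: nat \<times> nat \<times> nat) (- inverse (x (3, (0, 0, 0))))"
      have t: "t * single 0 (x (3, (0, 0, 0))) = - 1" using nz by (simp add: t_def mult_single single_uminus)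
      have "D * w = - (t * single 0 (x (3, (0, 0, 0)))) * (D * w)" by (simp add: t)
      also have "\<dots> = t * - (D * (single 0 (x (3, (0, 0, 0))) * w))" by (simp add: algebra_simps)
      also have "- (D * (single 0 (x (3, (0, 0, 0))) * w)) = A' * T 0 + B' * T 1 + C' * T 2"
        using rel nz(1) unfolding \<Phi> by (simp only: if_False flip: eq_neg_iff_add_eq_0)
      finally have "D * w = A' * (t * T 0) + B' * (t * T 1) + C' * (t * T 2)" by (simp add: algebra_simps)
      moreover have "form 2 m (t * T j)" for j unfolding t_def by (intro form_const_times fT)
      ultimately show False using w(2) nz unfolding span_def by blast
    qed
    then have "A' * T 0 + B' * T 1 + C' * T 2 = 0" using rel x3 by (auto simp: \<Phi> split: if_splits)
    moreover have "tdeg k < m" if "k \<in> keys (T 0) \<union> keys (T 1) \<union> keys (T 2)" for k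
    proof -
      from that obtain j where "k \<in> keys (T j)" by blast
      then have "tdeg k + 2 = m" using fT[of j] by (simp add: form_def)
      then show ?thesis by simp
    qed
    ultimately have "T 0 = 0 \<and> T 1 = 0 \<and> T 2 = 0" using low by blast
    moreover have "lookup (T j) k = x (j, k)" if "k \<in> K" for j k
      using that finK by (simp add: T_def lookup_sum_single)
    ultimately have "x (0, k) = 0" "x (1, k) = 0" "x (2, k) = 0" if "k \<in> K" for k
      using that by (metis lookup_zero)+
    then show ?thesis using x3 unfolding I_def K_def[symmetric] three by auto
  qed
  then show ?thesis using forms by blast
qed

section \<open>Decomposition of a form by the parity of the exponents\<close>

lemma inj_double: "inj (\<lambda>k :: nat \<times> nat \<times> nat. k + k + \<tau>)"
  by (auto simp: inj_def)

text \<open>The monomial of \<tau> times \<open>p(X^2, Y^2, Z^2)\<close>.\<close>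

definition double :: "nat \<times> nat \<times> nat \<Rightarrow> 'a::comm_monoid_add poly3 \<Rightarrow> 'a poly3" where
  "double \<tau> p = (\<Sum>k\<in>keys p. single (k + k + \<tau>) (lookup p k))"

lemma double_superset:
  "finite K \<Longrightarrow> keys p \<subseteq> K \<Longrightarrow> double \<tau> p = (\<Sum>k\<in>K. single (k + k + \<tau>) (lookup p k))"
  unfolding double_def by (rule sum.mono_neutral_left) (auto simp: in_keys_iff)

lemma lookup_double: "lookup (double \<tau> p) (k + k + \<tau>) = lookup p k"
proof -
  have eq: "l + l + \<tau> = k + k + \<tau> \<longleftrightarrow> l = k" for l
    using injD[OF inj_double[of \<tau>], of l k] by auto
  show ?thesis
    unfolding double_def by (simp add: lookup_sum lookup_single when_def eq sum.delta in_keys_iff del: add_right_cancel)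
qed

lemma lookup_double_eq_0: "(\<And>l. k \<noteq> l + l + \<tau>) \<Longrightarrow> lookup (double \<tau> p) k = 0"
  unfolding double_def by (force simp: lookup_sum lookup_single when_def intro!: sum.neutral)

lemma double_mult:
  fixes p q :: "'a::comm_semiring_1 poly3"
  shows "double \<tau> p * double \<sigma> q = double (\<tau> + \<sigma>) (p * q)"
proof -
  have add: "double \<tau> (p + q) = double \<tau> p + double \<tau> q" for \<tau> and p q :: "'a poly3"
  proof -
    have "double \<tau> g = (\<Sum>k\<in>keys p \<union> keys q. single (k + k + \<tau>) (lookup g k))"
      if "keys g \<subseteq> keys p \<union> keys q" for g :: "'a poly3"
      by (rule double_superset) (use that in auto)
    from this[of p] this[of q] this[of "p + q"] show ?thesis
      using Poly_Mapping.keys_add[of p q] by (simp add: lookup_add single_add sum.distrib)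
  qed
  have 0: "double \<tau> 0 = (0 :: 'a poly3)" for \<tau> by (simp add: double_def)
  have sum: "double \<tau> (sum f I) = (\<Sum>i\<in>I. double \<tau> (f i))" for \<tau> and f :: "nat \<times> nat \<times> nat \<Rightarrow> 'a poly3" and I
    by (induction I rule: infinite_finite_induct) (auto simp: add 0)
  have single: "double \<tau> (single k c) = single (k + k + \<tau>) c" for \<tau> k and c :: 'a
    by (simp add: double_def)
  have "p * q = (\<Sum>k\<in>keys p. \<Sum>l\<in>keys q. single (k + l) (lookup p k * lookup q l))"
    by (subst (1) poly_mapping_eq_sum_single[of "keys p" p], simp, simp,
        subst (1) poly_mapping_eq_sum_single[of "keys q" q], simp, simp)
      (simp add: sum_product mult_single)
  then have "double (\<tau> + \<sigma>) (p * q) =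
      (\<Sum>k\<in>keys p. \<Sum>l\<in>keys q. single ((k + l) + (k + l) + (\<tau> + \<sigma>)) (lookup p k * lookup q l))"
    by (simp only: sum single)
  also have "\<dots> = double \<tau> p * double \<sigma> q"
    unfolding double_def sum_product mult_single by (simp only: ac_simps)
  finally show ?thesis by simp
qed

text \<open>The parity classes of exponent vectors of odd total degree.\<close>

definition odd_units :: "(nat \<times> nat \<times> nat) set" where
  "odd_units = {(1, 0, 0), (0, 1, 0), (0, 0, 1), (1, 1, 1)}"

lemma sum_odd_units:
  "(\<Sum>\<tau>\<in>odd_units. h \<tau>) = h (1, 0, 0) + h (0, 1, 0) + h (0, 0, 1) + h (1, 1, 1)"
  by (simp add: odd_units_def add.assoc)

text \<open>\<open>F = X A(X\<^sup>2,Y\<^sup>2,Z\<^sup>2) + Y B(X\<^sup>2,Y\<^sup>2,Z\<^sup>2) + Z C(X\<^sup>2,Y\<^sup>2,Z\<^sup>2) + XYZ D(X\<^sup>2,Y\<^sup>2,Z\<^sup>2)\<close>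
  where \<open>A, B, C, D\<close> are the parts of \<open>F\<close>, with coefficients moved to the algebraic closure.\<close>

definition parity_part :: "nat \<times> nat \<times> nat \<Rightarrow> 'k::field poly3 \<Rightarrow> 'k alg_closure poly3" where
  "parity_part \<tau> F = Poly_Mapping.map to_ac (Poly_Mapping.map_key (\<lambda>k. k + k + \<tau>) F)"

lemma lookup_map_to_ac [simp]: "lookup (Poly_Mapping.map to_ac p) k = to_ac (lookup p k)"
  by (simp add: Poly_Mapping.map.rep_eq when_def)

lemma lookup_parity_part [simp]: "lookup (parity_part \<tau> F) k = to_ac (lookup F (k + k + \<tau>))"
  using inj_double[of \<tau>] by (simp add: parity_part_def map_key.rep_eq)

lemma keys_parity_part: "k \<in> keys (parity_part \<tau> F) \<longleftrightarrow> k + k + \<tau> \<in> keys F"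
  by (simp add: in_keys_iff)

lemma form_parity_part:
  assumes "form 0 (2 * m + 1) F"
  shows "form 0 m (parity_part (1, 0, 0) F)" "form 0 m (parity_part (0, 1, 0) F)"
    "form 0 m (parity_part (0, 0, 1) F)" "form 1 m (parity_part (1, 1, 1) F)"
proof -
  have "2 * tdeg k + tdeg \<tau> = 2 * m + 1" if "k \<in> keys (parity_part \<tau> F)" for k \<tau>
    using that assms by (auto simp: keys_parity_part form_def tdeg_add simp del: tdeg_simp)
  from this[of _ "(1, 0, 0)"] this[of _ "(0, 1, 0)"] this[of _ "(0, 0, 1)"] this[of _ "(1, 1, 1)"]
  show "form 0 m (parity_part (1, 0, 0) F)" "form 0 m (parity_part (0, 1, 0) F)"
    "form 0 m (parity_part (0, 0, 1) F)" "form 1 m (parity_part (1, 1, 1) F)"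
    unfolding form_def by (fastforce simp del: split_paired_All)+
qed

lemma odd_decompose:
  assumes "odd (tdeg k)"
  obtains l \<tau> where "\<tau> \<in> odd_units" "k = l + l + \<tau>"
proof -
  obtain a b c where k: "k = (a, b, c)" by (cases k)
  define \<tau> where "\<tau> = (a mod 2, b mod 2, c mod 2)"
  have "\<tau> \<in> odd_units"
    using assms unfolding \<tau>_def odd_units_def k by (auto simp: mod_2_eq_odd)
  moreover have "k = (a div 2, b div 2, c div 2) + (a div 2, b div 2, c div 2) + \<tau>"
    by (simp add: k \<tau>_def) presburger
  ultimately show ?thesis using that by blast
qed

lemma odd_unit_eqD:
  assumes "k + k + \<tau> = l + l + \<sigma>" "\<tau> \<in> odd_units" "\<sigma> \<in> odd_units"
  shows "\<tau> = \<sigma> \<and> k = l"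
proof -
  obtain a b c a' b' c' where k: "k = (a, b, c)" "l = (a', b', c')" by (cases k; cases l)
  have "\<tau> = \<sigma>"
    using assms unfolding odd_units_def k by auto presburger+
  then show ?thesis using assms(1) injD[OF inj_double[of \<tau>], of k l] by simp
qed

text \<open>Each exponent of \<open>F\<close> is uniquely \<open>2 k + \<tau>\<close> with \<tau> in
  \<open>odd_units\<close>. The weight \<open>h\<close> is left arbitrary so that the same splitting
  serves for values, for derivatives and for coefficients.\<close>

lemma sum_over_parity_parts:
  fixes F :: "'k::field poly3"
  assumes "form 0 (2 * m + 1) F"
  shows "(\<Sum>k\<in>keys F. to_ac (lookup F k) * h k) =
    (\<Sum>\<tau>\<in>odd_units. \<Sum>k\<in>keys (parity_part \<tau> F). lookup (parity_part \<tau> F) k * h (k + k + \<tau>))"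
proof -
  have bij: "bij_betw (\<lambda>(\<tau>, k). k + k + \<tau>) (Sigma odd_units (\<lambda>\<tau>. keys (parity_part \<tau> F))) (keys F)"
    unfolding bij_betw_def
  proof
    show "inj_on (\<lambda>(\<tau>, k). k + k + \<tau>) (Sigma odd_units (\<lambda>\<tau>. keys (parity_part \<tau> F)))"
    proof (rule inj_onI)
      fix a b assume ab: "a \<in> Sigma odd_units (\<lambda>\<tau>. keys (parity_part \<tau> F))"
        "b \<in> Sigma odd_units (\<lambda>\<tau>. keys (parity_part \<tau> F))"
        "(case a of (\<tau>, k) \<Rightarrow> k + k + \<tau>) = (case b of (\<tau>, k) \<Rightarrow> k + k + \<tau>)"
      obtain \<tau> k \<sigma> l where "a = (\<tau>, k)" "b = (\<sigma>, l)" by (metis surj_pair)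
      then show "a = b" using ab odd_unit_eqD[of k \<tau> l \<sigma>] by auto
    qed
    show "(\<lambda>(\<tau>, k). k + k + \<tau>) ` Sigma odd_units (\<lambda>\<tau>. keys (parity_part \<tau> F)) = keys F"
    proof (intro equalityI subsetI)
      fix k assume k: "k \<in> keys F"
      then have "odd (tdeg k)" using assms by (auto simp: form_def simp del: tdeg_simp)
      then obtain l \<tau> where "\<tau> \<in> odd_units" "k = l + l + \<tau>" by (rule odd_decompose)
      then show "k \<in> (\<lambda>(\<tau>, k). k + k + \<tau>) ` Sigma odd_units (\<lambda>\<tau>. keys (parity_part \<tau> F))"
        using k by (intro image_eqI[of _ _ "(\<tau>, l)"]) (auto simp: keys_parity_part)
    qed (auto simp: keys_parity_part)
  qed
  have "(\<Sum>k\<in>keys F. to_ac (lookup F k) * h k) =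
      (\<Sum>(\<tau>, k)\<in>Sigma odd_units (\<lambda>\<tau>. keys (parity_part \<tau> F)). to_ac (lookup F (k + k + \<tau>)) * h (k + k + \<tau>))"
    by (subst sum.reindex_bij_betw[OF bij, symmetric]) (simp add: case_prod_unfold)
  then show ?thesis
    by (subst sum.Sigma) (auto simp: odd_units_def)
qed

lemma map_to_ac_eq_doubles:
  fixes F :: "'k::field poly3"
  assumes "form 0 (2 * m + 1) F"
  shows "Poly_Mapping.map to_ac F = (\<Sum>\<tau>\<in>odd_units. double \<tau> (parity_part \<tau> F))"
proof (rule poly_mapping_eqI)
  fix k
  have "to_ac (lookup F k) = (\<Sum>l\<in>keys F. to_ac (lookup F l) * (1 when l = k))"
    by (simp add: when_def in_keys_iff sum.delta if_distrib cong: if_cong)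
  also have "\<dots> = (\<Sum>\<tau>\<in>odd_units. \<Sum>l\<in>keys (parity_part \<tau> F).
      lookup (parity_part \<tau> F) l * (1 when l + l + \<tau> = k))"
    by (rule sum_over_parity_parts[OF assms])
  also have "\<dots> = lookup (\<Sum>\<tau>\<in>odd_units. double \<tau> (parity_part \<tau> F)) k"
    by (simp add: lookup_sum double_def lookup_single when_def if_distrib cong: if_cong)
  finally show "lookup (Poly_Mapping.map to_ac F) k = lookup (\<Sum>\<tau>\<in>odd_units. double \<tau> (parity_part \<tau> F)) k"
    by simp
qed

section \<open>Smoothness and the parity parts\<close>

lemma map_to_ac_sum: "Poly_Mapping.map to_ac (sum f I) = (\<Sum>i\<in>I. Poly_Mapping.map to_ac (f i))"
  by (rule poly_mapping_eqI) (simp add: lookup_sum to_ac_sum)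

lemma map_to_ac_single: "Poly_Mapping.map to_ac (single k c) = single k (to_ac c)"
  by (rule poly_mapping_eqI) (simp add: lookup_single when_def)

lemma eval3_eq_ev: "eval3 F x y z = ev (Poly_Mapping.map to_ac F) (x, y, z)"
proof -
  have "keys (Poly_Mapping.map to_ac F) = keys F" by (auto simp: in_keys_iff)
  then show ?thesis by (simp add: eval3_def ev_def mval_def case_prod_unfold mult.assoc)
qed

lemma eval3_sum_single:
  "eval3 (\<Sum>k\<in>K. single (h k) (c k)) x y z = (\<Sum>k\<in>K. to_ac (c k) * mval (x, y, z) (h k))"
  by (simp add: eval3_eq_ev map_to_ac_sum map_to_ac_single)

lemma mval_double:
  "mval (x, y, z) (k + k + (i, j, l)) = mval (x\<^sup>2, y\<^sup>2, z\<^sup>2) k * (x ^ i * y ^ j * z ^ l)"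
  by (cases k) (simp add: mval_def power_add power2_eq_square power_mult_distrib ac_simps)

context
  fixes F :: "'k::field poly3" and m :: nat
  assumes char2: "CHAR('k) = 2" and form: "form 0 (2 * m + 1) F"
begin

lemma of_nat_double: "of_nat (a + a) = (0 :: 'k alg_closure)"
proof -
  have "of_nat 2 = (0 :: 'k alg_closure)" using of_nat_CHAR[where 'a = "'k alg_closure"] char2 by simp
  then have "of_nat (2 * a) = (0 :: 'k alg_closure)" by (simp only: of_nat_mult mult_zero_left)
  then show ?thesis by (simp only: mult_2)
qed

lemma of_nat_Suc_double: "of_nat (Suc (a + a)) = (1 :: 'k alg_closure)"
  using of_nat_double[of a] by (simp only: of_nat_Suc add_0_right)

lemma eval3_parts:
  "eval3 F x y z = x * ev (parity_part (1, 0, 0) F) (x\<^sup>2, y\<^sup>2, z\<^sup>2) + y * ev (parity_part (0, 1, 0) F) (x\<^sup>2, y\<^sup>2, z\<^sup>2) +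
    z * ev (parity_part (0, 0, 1) F) (x\<^sup>2, y\<^sup>2, z\<^sup>2) + x * y * z * ev (parity_part (1, 1, 1) F) (x\<^sup>2, y\<^sup>2, z\<^sup>2)"
proof -
  have "eval3 F x y z = (\<Sum>k\<in>keys F. to_ac (lookup F k) * mval (x, y, z) k)"
    by (simp add: eval3_def mval_def case_prod_unfold mult.assoc)
  then show ?thesis
    unfolding sum_over_parity_parts[OF form] sum_odd_units mval_double ev_def sum_distrib_left
    by (simp add: mult_ac)
qed

text \<open>In characteristic 2 the derivation kills every function of the squares, so it acts only
  on the monomial factors \<open>X\<close> and \<open>XYZ\<close> in front of the parts. The other
  two partial derivatives are treated in the same way.\<close>

lemma eval3_deriv_X:
  "eval3 (deriv_X F) x y z =
    ev (parity_part (1, 0, 0) F) (x\<^sup>2, y\<^sup>2, z\<^sup>2) + y * z * ev (parity_part (1, 1, 1) F) (x\<^sup>2, y\<^sup>2, z\<^sup>2)"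
proof -
  define h where "h = (\<lambda>(i, j, l). of_nat i * mval (x, y, z) (i - 1, j, l))"
  have "deriv_X F = (\<Sum>k\<in>keys F. single (fst k - 1, snd k) (of_nat (fst k) * lookup F k))"
    by (simp add: deriv_X_def case_prod_unfold)
  then have "eval3 (deriv_X F) x y z = (\<Sum>k\<in>keys F. to_ac (lookup F k) * h k)"
    by (simp add: eval3_sum_single h_def case_prod_unfold ac_simps)
  moreover have "h (k + k + (1, 0, 0)) = mval (x\<^sup>2, y\<^sup>2, z\<^sup>2) k" "h (k + k + (0, 1, 0)) = 0"
    "h (k + k + (0, 0, 1)) = 0" "h (k + k + (1, 1, 1)) = mval (x\<^sup>2, y\<^sup>2, z\<^sup>2) k * (y * z)" for k
    using mval_double[of x y z k 0 0 0] mval_double[of x y z k 0 1 1]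
    by (cases k; simp add: h_def of_nat_double of_nat_Suc_double del: of_nat_add of_nat_Suc)+
  ultimately show ?thesis
    unfolding sum_over_parity_parts[OF form] sum_odd_units ev_def sum_distrib_left
    by (simp add: mult_ac)
qed

lemma eval3_deriv_Y:
  "eval3 (deriv_Y F) x y z =
    ev (parity_part (0, 1, 0) F) (x\<^sup>2, y\<^sup>2, z\<^sup>2) + x * z * ev (parity_part (1, 1, 1) F) (x\<^sup>2, y\<^sup>2, z\<^sup>2)"
proof -
  define h where "h = (\<lambda>(i, j, l). of_nat j * mval (x, y, z) (i, j - 1, l))"
  have "deriv_Y F = (\<Sum>k\<in>keys F. single (fst k, fst (snd k) - 1, snd (snd k)) (of_nat (fst (snd k)) * lookup F k))"
    by (simp add: deriv_Y_def case_prod_unfold)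
  then have "eval3 (deriv_Y F) x y z = (\<Sum>k\<in>keys F. to_ac (lookup F k) * h k)"
    by (simp add: eval3_sum_single h_def case_prod_unfold ac_simps)
  moreover have "h (k + k + (1, 0, 0)) = 0" "h (k + k + (0, 1, 0)) = mval (x\<^sup>2, y\<^sup>2, z\<^sup>2) k"
    "h (k + k + (0, 0, 1)) = 0" "h (k + k + (1, 1, 1)) = mval (x\<^sup>2, y\<^sup>2, z\<^sup>2) k * (x * z)" for k
    using mval_double[of x y z k 0 0 0] mval_double[of x y z k 1 0 1]
    by (cases k; simp add: h_def of_nat_double of_nat_Suc_double del: of_nat_add of_nat_Suc)+
  ultimately show ?thesis
    unfolding sum_over_parity_parts[OF form] sum_odd_units ev_def sum_distrib_left
    by (simp add: mult_ac)
qed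

lemma eval3_deriv_Z:
  "eval3 (deriv_Z F) x y z =
    ev (parity_part (0, 0, 1) F) (x\<^sup>2, y\<^sup>2, z\<^sup>2) + x * y * ev (parity_part (1, 1, 1) F) (x\<^sup>2, y\<^sup>2, z\<^sup>2)"
proof -
  define h where "h = (\<lambda>(i, j, l). of_nat l * mval (x, y, z) (i, j, l - 1))"
  have "deriv_Z F = (\<Sum>k\<in>keys F. single (fst k, fst (snd k), snd (snd k) - 1) (of_nat (snd (snd k)) * lookup F k))"
    by (simp add: deriv_Z_def case_prod_unfold)
  then have "eval3 (deriv_Z F) x y z = (\<Sum>k\<in>keys F. to_ac (lookup F k) * h k)"
    by (simp add: eval3_sum_single h_def case_prod_unfold ac_simps)
  moreover have "h (k + k + (1, 0, 0)) = 0" "h (k + k + (0, 1, 0)) = 0"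
    "h (k + k + (0, 0, 1)) = mval (x\<^sup>2, y\<^sup>2, z\<^sup>2) k" "h (k + k + (1, 1, 1)) = mval (x\<^sup>2, y\<^sup>2, z\<^sup>2) k * (x * y)" for k
    using mval_double[of x y z k 0 0 0] mval_double[of x y z k 1 1 0]
    by (cases k; simp add: h_def of_nat_double of_nat_Suc_double del: of_nat_add of_nat_Suc)+
  ultimately show ?thesis
    unfolding sum_over_parity_parts[OF form] sum_odd_units ev_def sum_distrib_left
    by (simp add: mult_ac)
qed

text \<open>The parts are functions of the squares of the coordinates. The coordinatewise square
  root of a common zero is a point where \<open>F\<close> and its partial derivatives all
  vanish.\<close>

lemma parity_parts_no_common_zero:
  assumes "smooth_plane_curve F"
    and "ev (parity_part (1, 0, 0) F) P = 0" "ev (parity_part (0, 1, 0) F) P = 0"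
    "ev (parity_part (0, 0, 1) F) P = 0" "ev (parity_part (1, 1, 1) F) P = 0"
  shows "P = (0, 0, 0)"
proof -
  obtain a b c where P: "P = (a, b, c)" by (cases P)
  obtain x y z where xyz: "x\<^sup>2 = a" "y\<^sup>2 = b" "z\<^sup>2 = c"
    using nth_root_exists[of 2 a] nth_root_exists[of 2 b] nth_root_exists[of 2 c] by auto
  have "eval3 F x y z = 0" "eval3 (deriv_X F) x y z = 0" "eval3 (deriv_Y F) x y z = 0"
    "eval3 (deriv_Z F) x y z = 0"
    using assms(2-5) by (simp_all add: P xyz eval3_parts eval3_deriv_X eval3_deriv_Y eval3_deriv_Z)
  then have "(x, y, z) = (0, 0, 0)" using assms(1) unfolding smooth_plane_curve_def by blast
  then show ?thesis using xyz by (auto simp: P)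
qed

text \<open>The rows of the matrix \<open>lookup (F * single \<alpha> 1) (\<beta> + \<beta> + (1, 1, 1))\<close> span the multiples of
  \<open>A, B, C, D\<close>: write \<open>u = double (0, 1, 1) p + double (1, 0, 1) q + double (1, 1, 0) r + double 0 s\<close>; the part
  of \<open>F u\<close> of parity \<open>(1, 1, 1)\<close> is \<open>A p + B q + C r + D s\<close>.\<close>

lemma factorization_bound:
  assumes smooth: "smooth_plane_curve F"
    and fac: "\<And>\<alpha> \<beta>. tdeg \<alpha> + 2 = 2 * m \<Longrightarrow> tdeg \<beta> + 2 = 2 * m \<Longrightarrow>
      lookup (F * single \<alpha> 1) (\<beta> + \<beta> + (1, 1, 1)) = (\<Sum>l<\<rho>. c l \<alpha> * w l \<beta>)"
  shows "3 * card {k. tdeg k + 2 = m} + (if \<forall>k. lookup F (k + k + (1, 1, 1)) = 0 then 0 else 1) \<le> \<rho>"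
proof -
  define A B C D where "A = parity_part (1, 0, 0) F" and "B = parity_part (0, 1, 0) F"
    and "C = parity_part (0, 0, 1) F" and "D = parity_part (1, 1, 1) F"
  note ABCD = A_def B_def C_def D_def
  have f: "form 0 m A" "form 0 m B" "form 0 m C" "form 1 m D"
    using form_parity_part[OF form] by (simp_all add: ABCD)
  define K where "K = {k. tdeg k + 2 = m}"
  have finK: "finite K" by (rule finite_subset[OF _ finite_tdeg[of "m - 2"]]) (auto simp: K_def)
  define I where "I = {..<3} \<times> K \<union> (if D = 0 then {} else {(3::nat, (0, 0, 0))})"
  have finI: "finite I" using finK by (simp add: I_def)
  obtain p q r s where pqrs: "\<forall>i\<in>I. form 2 m (p i) \<and> form 2 m (q i) \<and> form 2 m (r i) \<and> form 1 m (s i)"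
    and indep: "\<And>x. (\<Sum>i\<in>I. single 0 (x i) * (A * p i + B * q i + C * r i + D * s i)) = 0 \<Longrightarrow> (\<forall>i\<in>I. x i = 0)"
    using ex_independent_combinations[OF f] parity_parts_no_common_zero[OF smooth]
    unfolding I_def K_def ABCD by blast
  define u where "u i = double (0, 1, 1) (p i) + double (1, 0, 1) (q i) + double (1, 1, 0) (r i) + double (0, 0, 0) (s i)" for i
  define J where "J = {\<alpha>. tdeg \<alpha> + 2 = 2 * m}"
  have finJ: "finite J" by (rule finite_subset[OF _ finite_tdeg[of "2 * m - 2"]]) (auto simp: J_def)
  have double_keys: "\<alpha> \<in> keys (double \<tau> g) \<Longrightarrow> \<exists>k\<in>keys g. \<alpha> = k + k + \<tau>" for \<alpha> \<tau> and g :: "'k alg_closure poly3"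
    unfolding double_def by (drule subsetD[OF keys_sum]) (auto split: if_splits)
  have keys_u: "keys (u i) \<subseteq> J" if "i \<in> I" for i
  proof
    fix \<alpha> assume "\<alpha> \<in> keys (u i)"
    then consider "\<alpha> \<in> keys (double (0, 1, 1) (p i))" | "\<alpha> \<in> keys (double (1, 0, 1) (q i))" |
      "\<alpha> \<in> keys (double (1, 1, 0) (r i))" | "\<alpha> \<in> keys (double (0, 0, 0) (s i))"
      unfolding u_def by (auto dest!: subsetD[OF Poly_Mapping.keys_add])
    then show "\<alpha> \<in> J"
      using pqrs that
      by cases (force dest!: double_keys simp: J_def form_def tdeg_add simp del: add_Pair)+
  qed
  have odd_sum: "Poly_Mapping.map to_ac F = double (1, 0, 0) A + double (0, 1, 0) B + double (0, 0, 1) C + double (1, 1, 1) D"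
    unfolding map_to_ac_eq_doubles[OF form] ABCD sum_odd_units ..
  \<comment> \<open>The unwanted products of parts of \<open>F\<close> and of \<open>u i\<close>
    have a parity vector such as \<open>(1, 0, 0) + (1, 0, 1)\<close> with an even entry, so they do
    not meet the class \<open>(1, 1, 1)\<close>.\<close>
  have parity: "lookup (double (a, b, c') g) (\<beta> + \<beta> + (1, 1, 1)) = 0" if "even a \<or> even b \<or> even c'"
    for a b c' \<beta> and g :: "'k alg_closure poly3"
  proof (rule lookup_double_eq_0)
    fix l :: "nat \<times> nat \<times> nat"
    show "\<beta> + \<beta> + (1, 1, 1) \<noteq> l + l + (a, b, c')"
      using that by (cases \<beta>; cases l) (auto; presburger)
  qed
  have product: "lookup (Poly_Mapping.map to_ac F * u i) (\<beta> + \<beta> + (1, 1, 1)) =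
      lookup (A * p i + B * q i + C * r i + D * s i) \<beta>" for i \<beta>
    unfolding odd_sum u_def
    by (simp add: distrib_left distrib_right double_mult lookup_add parity[unfolded One_nat_def] lookup_double)
  have map_single: "lookup (Poly_Mapping.map to_ac F * single \<alpha> 1) \<gamma> = to_ac (lookup (F * single \<alpha> 1) \<gamma>)" for \<alpha> \<gamma>
  proof (cases "\<exists>l. \<gamma> = \<alpha> + l")
    case True
    then show ?thesis by (auto simp: mult.commute[of _ "single \<alpha> 1"] lookup_single_times)
  next
    case False
    then have "\<gamma> \<notin> keys (single \<alpha> 1 * Poly_Mapping.map to_ac F)" "\<gamma> \<notin> keys (single \<alpha> 1 * F)"
      using keys_single_times[of \<alpha> 1] by blast+
    then show ?thesis by (simp add: in_keys_iff mult.commute[of _ "single \<alpha> 1"])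
  qed
  have row: "lookup (A * p i + B * q i + C * r i + D * s i) \<beta> =
      (\<Sum>\<alpha>\<in>J. lookup (u i) \<alpha> * to_ac (lookup (F * single \<alpha> 1) (\<beta> + \<beta> + (1, 1, 1))))" if "i \<in> I" for i \<beta>
  proof -
    have "Poly_Mapping.map to_ac F * u i =
        (\<Sum>\<alpha>\<in>J. single 0 (lookup (u i) \<alpha>) * (Poly_Mapping.map to_ac F * single \<alpha> 1))"
      by (subst poly_mapping_eq_sum_single[OF finJ keys_u[OF that]])
        (simp add: sum_distrib_left mult_single mult.left_commute[of _ "Poly_Mapping.map to_ac F"])
    then show ?thesis
      unfolding product[symmetric] by (simp add: lookup_sum lookup_const_times map_single)
  qed
  have "card I \<le> \<rho>"
  proof (rule ccontr)
    assume "\<not> ?thesis"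
    then have "card {..<\<rho>} < card I" by simp
    \<comment> \<open>With more than \<rho> elements \<open>u i\<close>, some nontrivial combination
      is orthogonal to all \<rho> vectors \<open>c l\<close>. The factorization then makes the same
      combination of the products vanish, against their independence.\<close>
    from underdetermined_system[OF _ finI this, of "\<lambda>i l. \<Sum>\<alpha>\<in>J. lookup (u i) \<alpha> * to_ac (c l \<alpha>)"]
    obtain x where x: "\<exists>i\<in>I. x i \<noteq> 0"
      "\<And>l. l < \<rho> \<Longrightarrow> (\<Sum>i\<in>I. x i * (\<Sum>\<alpha>\<in>J. lookup (u i) \<alpha> * to_ac (c l \<alpha>))) = 0" by auto
    have "(\<Sum>i\<in>I. single 0 (x i) * (A * p i + B * q i + C * r i + D * s i)) = 0"
    proof (rule poly_mapping_eqI)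
      fix \<beta>
      show "lookup (\<Sum>i\<in>I. single 0 (x i) * (A * p i + B * q i + C * r i + D * s i)) \<beta> = lookup 0 \<beta>"
      proof (cases "\<beta> \<in> J")
        case True
        have "(\<Sum>\<alpha>\<in>J. lookup (u i) \<alpha> * to_ac (lookup (F * single \<alpha> 1) (\<beta> + \<beta> + (1, 1, 1)))) =
            (\<Sum>l<\<rho>. to_ac (w l \<beta>) * (\<Sum>\<alpha>\<in>J. lookup (u i) \<alpha> * to_ac (c l \<alpha>)))" for i
        proof -
          have "(\<Sum>\<alpha>\<in>J. lookup (u i) \<alpha> * to_ac (lookup (F * single \<alpha> 1) (\<beta> + \<beta> + (1, 1, 1)))) =
            (\<Sum>\<alpha>\<in>J. \<Sum>l<\<rho>. to_ac (w l \<beta>) * (lookup (u i) \<alpha> * to_ac (c l \<alpha>)))"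
          proof (rule sum.cong)
            fix \<alpha> assume "\<alpha> \<in> J"
            then have "lookup (F * single \<alpha> 1) (\<beta> + \<beta> + (1, 1, 1)) = (\<Sum>l<\<rho>. c l \<alpha> * w l \<beta>)"
              using True fac[of \<alpha> \<beta>] unfolding J_def by blast
            then show "lookup (u i) \<alpha> * to_ac (lookup (F * single \<alpha> 1) (\<beta> + \<beta> + (1, 1, 1))) =
                (\<Sum>l<\<rho>. to_ac (w l \<beta>) * (lookup (u i) \<alpha> * to_ac (c l \<alpha>)))"
              by (simp only: to_ac_sum to_ac_mult sum_distrib_left mult_ac)
          qed simp
          then show ?thesis by (subst (asm) sum.swap) (simp add: sum_distrib_left)
        qed
        then have "lookup (\<Sum>i\<in>I. single 0 (x i) * (A * p i + B * q i + C * r i + D * s i)) \<beta> =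
            (\<Sum>i\<in>I. \<Sum>l<\<rho>. to_ac (w l \<beta>) * (x i * (\<Sum>\<alpha>\<in>J. lookup (u i) \<alpha> * to_ac (c l \<alpha>))))"
          by (simp only: lookup_sum lookup_const_times)
            (intro sum.cong, simp_all only: row, simp_all add: sum_distrib_left ac_simps)
        also have "\<dots> = (\<Sum>l<\<rho>. to_ac (w l \<beta>) * (\<Sum>i\<in>I. x i * (\<Sum>\<alpha>\<in>J. lookup (u i) \<alpha> * to_ac (c l \<alpha>))))"
          by (subst sum.swap) (simp only: sum_distrib_left)
        also have "\<dots> = 0" using x(2) by simp
        finally show ?thesis by simp
      next
        case False
        \<comment> \<open>All these products are forms of degree \<open>2m - 2\<close>.\<close>
        have "lookup (A * p i + B * q i + C * r i + D * s i) \<beta> = 0" if "i \<in> I" for i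
        proof -
          have "form 2 (m + m) (A * p i)" "form 2 (m + m) (B * q i)" "form 2 (m + m) (C * r i)"
            "form 2 (m + m) (D * s i)"
            using pqrs that form_mult[OF f(1), of 2 m "p i"] form_mult[OF f(2), of 2 m "q i"]
              form_mult[OF f(3), of 2 m "r i"] form_mult[OF f(4), of 1 m "s i"] by (auto simp: numeral_2_eq_2)
          then have "form 2 (m + m) (A * p i + B * q i + C * r i + D * s i)" by (intro form_add)
          then show ?thesis using False by (auto simp: form_def J_def in_keys_iff mult_2)
        qed
        then show ?thesis by (simp add: lookup_sum lookup_const_times)
      qed
    qed
    then show False using indep x(1) by blast
  qed
  moreover have "card I = 3 * card K + (if D = 0 then 0 else 1)"
    unfolding I_def using finK by (auto simp: card_cartesian_product card_Un_disjoint)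
  moreover have "D = 0 \<longleftrightarrow> (\<forall>k. lookup F (k + k + (1, 1, 1)) = 0)"
    unfolding poly_mapping_eq_iff fun_eq_iff by (simp add: D_def)
  ultimately show ?thesis by (simp add: K_def)
qed

end

section \<open>Laurent polynomials\<close>

text \<open>Leading terms multiply: the sum of the two largest exponents arises in only one way, so
  its coefficient does not cancel.\<close>

lemma mult_neq_0_of_ordered_exponents:
  fixes p q :: "'b::cancel_comm_monoid_add \<Rightarrow>\<^sub>0 'a::idom" and lt :: "'b \<Rightarrow> 'b \<Rightarrow> bool"
  assumes irrefl: "\<And>x. \<not> lt x x" and trans: "\<And>x y z. lt x y \<Longrightarrow> lt y z \<Longrightarrow> lt x z"
    and total: "\<And>x y. x \<noteq> y \<Longrightarrow> lt x y \<or> lt y x" and mono: "\<And>x y z. lt x y \<Longrightarrow> lt (x + z) (y + z)"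
    and nz: "p \<noteq> 0" "q \<noteq> 0"
  shows "p * q \<noteq> 0"
proof -
  have ex_max: "S \<noteq> {} \<longrightarrow> (\<exists>m\<in>S. \<forall>x\<in>S. x = m \<or> lt x m)" if "finite S" for S :: "'b set"
    using that
  proof (induction S)
    case (insert a S)
    show ?case
    proof (cases "S = {}")
      case False
      then obtain m where m: "m \<in> S" "\<forall>x\<in>S. x = m \<or> lt x m" using insert by blast
      show ?thesis
      proof (cases "lt m a")
        case True
        have "x = a \<or> lt x a" if "x \<in> insert a S" for x
          using that m(2) True trans[of x m a] by auto
        then show ?thesis by blast
      next
        case False
        then have "a = m \<or> lt a m" using total[of a m] by auto
        then show ?thesis using m by auto
      qed
    qed simp
  qed simp
  have "keys p \<noteq> {}" "keys q \<noteq> {}" using nz by (auto simp: poly_mapping_eq_iff in_keys_iff fun_eq_iff)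
  then obtain k l where k: "k \<in> keys p" "\<forall>x\<in>keys p. x = k \<or> lt x k"
    and l: "l \<in> keys q" "\<forall>x\<in>keys q. x = l \<or> lt x l"
    using ex_max[of "keys p"] ex_max[of "keys q"] by auto
  have unique: "x = k \<and> y = l" if "x \<in> keys p" "y \<in> keys q" "x + y = k + l" for x y
  proof (rule ccontr)
    assume ne: "\<not> ?thesis"
    then have "x \<noteq> k" using that(3) by auto
    then have "lt (x + y) (k + y)" using k that(1) mono by blast
    moreover have "y = l \<or> lt (k + y) (k + l)" using l that(2) mono[of y l k] by (auto simp: add.commute)
    ultimately have "lt (x + y) (k + l)" using trans by blast
    then show False using that(3) irrefl by simp
  qed
  have "p * q = (\<Sum>x\<in>keys p. \<Sum>y\<in>keys q. single (x + y) (lookup p x * lookup q y))"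
    by (subst (1) poly_mapping_eq_sum_single[of "keys p" p], simp, simp,
        subst (1) poly_mapping_eq_sum_single[of "keys q" q], simp, simp)
      (simp add: sum_product mult_single)
  then have "lookup (p * q) (k + l) =
      (\<Sum>x\<in>keys p. \<Sum>y\<in>keys q. if x + y = k + l then lookup p x * lookup q y else 0)"
    by (simp add: lookup_sum lookup_single when_def)
  also have "\<dots> = (\<Sum>x\<in>keys p. \<Sum>y\<in>keys q. if y = l then if x = k then lookup p x * lookup q y else 0 else 0)"
    by (intro sum.cong refl) (use unique in auto)
  also have "\<dots> = lookup p k * lookup q l"
    using k(1) l(1) by (simp add: sum.delta)
  finally have "lookup (p * q) (k + l) \<noteq> 0" using k(1) l(1) by (simp add: in_keys_iff)
  then show ?thesis by auto
qed

text \<open>The order on the exponents is the lexicographic one.\<close>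

lemma laurent_mult_neq_0:
  fixes p q :: "'k::field laurent"
  assumes "p \<noteq> 0" "q \<noteq> 0"
  shows "p * q \<noteq> 0"
  by (rule mult_neq_0_of_ordered_exponents[where lt = "\<lambda>k l. fst k < fst l \<or> fst k = fst l \<and>
      (fst (snd k) < fst (snd l) \<or> fst (snd k) = fst (snd l) \<and> snd (snd k) < snd (snd l))",
      OF _ _ _ _ assms]) (auto simp: prod_eq_iff)

section \<open>Degrees and signs of Laurent exponents\<close>

definition ldeg :: "int \<times> int \<times> int \<Rightarrow> int" where
  "ldeg = (\<lambda>(a, b, c). a + b + c)"

lemma ldeg_simp [simp]: "ldeg (a, b, c) = a + b + c"
  by (simp add: ldeg_def)

lemma ldeg_add: "ldeg (k + l) = ldeg k + ldeg l"
  by (cases k; cases l) simp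

definition negative :: "int \<times> int \<times> int \<Rightarrow> bool" where
  "negative = (\<lambda>(a, b, c). a < 0 \<and> b < 0 \<and> c < 0)"

lemma negative_simp [simp]: "negative (a, b, c) \<longleftrightarrow> a < 0 \<and> b < 0 \<and> c < 0"
  by (simp add: negative_def)

definition emb :: "nat \<times> nat \<times> nat \<Rightarrow> int \<times> int \<times> int" where
  "emb = (\<lambda>(i, j, l). (int i, int j, int l))"

lemma emb_simp [simp]: "emb (i, j, l) = (int i, int j, int l)"
  by (simp add: emb_def)

lemma emb_add: "emb (k + l) = emb k + emb l"
  by (cases k; cases l) simp

lemma emb_eq_iff [simp]: "emb k = emb l \<longleftrightarrow> k = l"
  by (cases k; cases l) simp

lemma to_laurent_eq: "to_laurent F = (\<Sum>k\<in>keys F. single (emb k) (lookup F k))"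
  by (simp add: to_laurent_def emb_def case_prod_unfold)

lemma lookup_to_laurent [simp]: "lookup (to_laurent F) (emb k) = lookup F k"
  by (simp add: to_laurent_eq lookup_sum lookup_single when_def sum.delta in_keys_iff)

lemma keys_to_laurent: "keys (to_laurent F) = emb ` keys F"
proof -
  have range: "k \<in> range emb" if "k \<in> keys (to_laurent F)" for k
  proof -
    have "k \<in> (\<Union>h\<in>keys F. keys (single (emb h) (lookup F h)))"
      using subsetD[OF keys_sum that[unfolded to_laurent_eq]] .
    then obtain h where "k \<in> keys (single (emb h) (lookup F h))" by (rule UN_E)
    then have "k = emb h" by (metis keys_single empty_iff singletonD)
    then show ?thesis by (rule range_eqI)
  qed
  show ?thesis
  proof (intro equalityI subsetI)
    fix k assume k: "k \<in> keys (to_laurent F)"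
    then obtain h where h: "k = emb h" using range by blast
    then have "h \<in> keys F" using k by (simp add: in_keys_iff del: emb_simp)
    then show "k \<in> emb ` keys F" using h by blast
  next
    fix k assume "k \<in> emb ` keys F"
    then obtain h where "k = emb h" "h \<in> keys F" by blast
    then show "k \<in> keys (to_laurent F)" by (simp add: in_keys_iff del: emb_simp)
  qed
qed

lemma lookup_times_single:
  fixes p :: "'b::ab_group_add \<Rightarrow>\<^sub>0 'a::comm_semiring_1"
  shows "lookup (p * single k c) l = lookup p (l - k) * c"
  using lookup_single_times[of k c p "l - k"] by (simp add: mult.commute)

text \<open>A coefficient at a difference of exponents is turned into one of an ordinary polynomial.
  If \<open>l - k\<close> has a negative entry, both sides are 0.\<close>

lemma lookup_to_laurent_shift:
  "lookup (to_laurent F) (emb l - emb k) = lookup (F * single k 1) l"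
proof (cases "\<exists>h. l = k + h")
  case True
  then obtain h where h: "l = k + h" by blast
  then have "emb l - emb k = emb h" by (simp add: emb_add)
  then show ?thesis by (simp add: h mult.commute[of F] lookup_single_times)
next
  case False
  then have "l \<notin> keys (single k 1 * F)" using keys_single_times[of k 1 F] by blast
  moreover have "emb l - emb k \<noteq> emb h" for h
    using False by (metis add.commute diff_eq_eq emb_add emb_eq_iff)
  then have "emb l - emb k \<notin> keys (to_laurent F)" unfolding keys_to_laurent by blast
  ultimately show ?thesis by (simp add: in_keys_iff mult.commute[of F])
qed

section \<open>Squares in characteristic two\<close>

lemma square_sum_char2:
  fixes f :: "'i \<Rightarrow> 'b::comm_ring_1"
  assumes "\<And>x :: 'b. x + x = 0"
  shows "(sum f I)\<^sup>2 = (\<Sum>i\<in>I. (f i)\<^sup>2)"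
proof (induction I rule: infinite_finite_induct)
  case (insert i I)
  have "(f i + sum f I)\<^sup>2 = (f i)\<^sup>2 + (sum f I)\<^sup>2 + (f i * sum f I + f i * sum f I)"
    by (simp add: power2_eq_square algebra_simps)
  then show ?case using insert assms by simp
qed auto

lemma add_self_char2:
  assumes "CHAR('k::field) = 2"
  shows "x + x = (0 :: 'b::cancel_comm_monoid_add \<Rightarrow>\<^sub>0 'k)"
proof (rule poly_mapping_eqI)
  fix k
  have "of_nat 2 = (0::'k)" using of_nat_CHAR[where 'a = 'k] assms by simp
  then have "(2::'k) = 0" by simp
  then have "2 * lookup x k = 0" by simp
  then show "lookup (x + x) k = lookup 0 k" by (simp only: lookup_add lookup_zero mult_2)
qed

lemma square_char2:
  fixes p :: "'b::cancel_comm_monoid_add \<Rightarrow>\<^sub>0 'k::field"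
  assumes "CHAR('k) = 2" "finite K" "keys p \<subseteq> K"
  shows "p\<^sup>2 = (\<Sum>k\<in>K. single (k + k) ((lookup p k)\<^sup>2))"
proof -
  have "(\<Sum>k\<in>K. single k (lookup p k))\<^sup>2 = (\<Sum>k\<in>K. (single k (lookup p k))\<^sup>2)"
    by (rule square_sum_char2[OF add_self_char2[OF assms(1)]])
  then show ?thesis
    unfolding poly_mapping_eq_sum_single[OF assms(2,3), symmetric]
    by (simp add: power2_eq_square mult_single)
qed

section \<open>Cohomology as negative parts\<close>

lemma localized_add: "u \<in> localized I \<Longrightarrow> v \<in> localized I \<Longrightarrow> u + v \<in> localized I"
  unfolding localized_def using Poly_Mapping.keys_add[of u v] by blast

lemma keys_uminus: "keys (- u) = keys (u :: 'b \<Rightarrow>\<^sub>0 'a::ab_group_add)"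
  by (auto simp: in_keys_iff)

lemma localized_uminus: "u \<in> localized I \<Longrightarrow> - u \<in> localized I"
  by (simp add: localized_def keys_uminus)

lemma localized_mult:
  assumes "u \<in> localized I" "v \<in> localized I"
  shows "u * v \<in> localized I"
  unfolding localized_def
proof (rule CollectI, rule ballI)
  fix k assume "k \<in> keys (u * v)"
  then obtain a b where ab: "k = a + b" "a \<in> keys u" "b \<in> keys v" using keys_mult[of u v] by blast
  then show "case k of (a, b, c) \<Rightarrow> (0 \<notin> I \<longrightarrow> 0 \<le> a) \<and> (1 \<notin> I \<longrightarrow> 0 \<le> b) \<and> (2 \<notin> I \<longrightarrow> 0 \<le> c)"
    using assms unfolding localized_def by fastforce
qed

lemma localized_const: "u \<in> localized I \<Longrightarrow> single 0 c * u \<in> localized I"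
  unfolding localized_def using keys_const_times[of c u] by blast

lemma to_laurent_localized: "to_laurent F \<in> localized I"
  by (auto simp: localized_def keys_to_laurent emb_def)

lemma localized_mono: "I \<subseteq> J \<Longrightarrow> localized I \<subseteq> localized J"
  by (auto simp: localized_def)

lemma localized_all: "u \<in> localized {0, 1, 2}"
  by (auto simp: localized_def)

lemma sections_iff: "u \<in> sections I \<longleftrightarrow> u \<in> localized I \<and> (\<forall>k\<in>keys u. ldeg k = 0)"
  by (auto simp: sections_def ldeg_def)

lemma sections_add: "u \<in> sections I \<Longrightarrow> v \<in> sections I \<Longrightarrow> u + v \<in> sections I"
  unfolding sections_iff using Poly_Mapping.keys_add[of u v] localized_add by blast

lemma sections_uminus: "u \<in> sections I \<Longrightarrow> - u \<in> sections I"
  by (simp add: sections_iff keys_uminus localized_uminus)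

lemma sections_diff: "u \<in> sections I \<Longrightarrow> v \<in> sections I \<Longrightarrow> u - v \<in> sections I"
  using sections_add[of u I "- v"] sections_uminus[of v I] by simp

lemma sections_const: "u \<in> sections I \<Longrightarrow> single 0 c * u \<in> sections I"
  unfolding sections_iff using keys_const_times[of c u] localized_const by blast

lemma sections_mult: "u \<in> sections I \<Longrightarrow> v \<in> sections I \<Longrightarrow> u * v \<in> sections I"
  unfolding sections_iff using localized_mult[of u I v] keys_mult[of u v] by (fastforce simp: ldeg_add)

lemma sections_mono: "I \<subseteq> J \<Longrightarrow> u \<in> sections I \<Longrightarrow> u \<in> sections J"
  unfolding sections_iff using localized_mono by blast

lemma sections_0: "0 \<in> sections I"
  by (simp add: sections_iff localized_def)

section \<open>Cech cocycles of the curve and the connecting map\<close>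

definition cech_d :: "'k::field cochain \<Rightarrow> 'k laurent" where
  "cech_d = (\<lambda>(u01, u02, u12). u12 - u02 + u01)"

lemma cech_d_diff: "cech_d (z - w) = cech_d z - cech_d w"
  by (cases z; cases w) (simp add: cech_d_def)

lemma cech_d_0 [simp]: "cech_d 0 = 0"
  by (simp add: cech_d_def zero_prod_def)

lemma cech_d_add: "cech_d (z + w) = cech_d z + cech_d w"
  by (cases z; cases w) (simp add: cech_d_def)

lemma cech_d_scale: "cech_d (scale_cochain r z) = single 0 r * cech_d z"
  by (cases z) (simp add: cech_d_def scale_cochain_def algebra_simps)

locale plane_curve =
  fixes F :: "'k::field poly3" and d :: nat
  assumes form_F: "form 0 d F" and F_neq_0: "F \<noteq> 0"
begin

abbreviation "G \<equiv> to_laurent F"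

lemma G_neq_0: "G \<noteq> 0"
proof
  assume "G = 0"
  then have "lookup F k = 0" for k using lookup_to_laurent[of F k] by simp
  then show False using F_neq_0 by (auto intro: poly_mapping_eqI)
qed

lemma G_cancel: "G * p = G * q \<longleftrightarrow> p = q"
  using laurent_mult_neq_0[OF G_neq_0, of "p - q"] by (auto simp: right_diff_distrib)

lemma ldeg_G: "k \<in> keys G \<Longrightarrow> ldeg k = int d"
  using form_F by (auto simp: keys_to_laurent form_def)

lemma ldeg_keys_G_times: "k \<in> keys (G * q) \<Longrightarrow> \<exists>l\<in>keys q. ldeg k = int d + ldeg l"
  using keys_mult[of G q] ldeg_G by (force simp: ldeg_add)

text \<open>The components of \<open>q\<close> of other degrees would contribute terms of nonzero
  degree to \<open>G * q\<close>, which cannot cancel against the rest. So \<open>G\<close> times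
  their sum is 0, and \<open>G\<close> can be cancelled.\<close>

lemma ldeg_quotient:
  assumes "\<And>k. k \<in> keys (G * q) \<Longrightarrow> ldeg k = 0" "k \<in> keys q"
  shows "ldeg k = - int d"
proof (rule ccontr)
  assume k: "ldeg k \<noteq> - int d"
  define q1 where "q1 = restrict_keys (\<lambda>k. ldeg k = - int d) q"
  define q2 where "q2 = restrict_keys (\<lambda>k. ldeg k \<noteq> - int d) q"
  have q: "q = q1 + q2" unfolding q1_def q2_def by (rule restrict_keys_split)
  have "l \<notin> keys (G * q2)" for l
  proof
    assume l: "l \<in> keys (G * q2)"
    then have l2: "ldeg l \<noteq> 0" using ldeg_keys_G_times[of l q2] by (auto simp: q2_def)
    then have "l \<notin> keys (G * q1)" using ldeg_keys_G_times[of l q1] by (auto simp: q1_def)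
    then have "l \<in> keys (G * q)" using l by (simp add: q distrib_left lookup_add in_keys_iff)
    then show False using assms(1) l2 by blast
  qed
  then have "G * q2 = G * 0" by (intro poly_mapping_eqI) (simp add: in_keys_iff)
  then have "q2 = 0" using G_cancel by blast
  then have "lookup q2 k = 0" by simp
  then show False using k assms(2) by (simp add: q2_def in_keys_iff)
qed

text \<open>On the triple intersection all coordinates are inverted and the degree is automatically
  0, so only divisibility by \<open>G\<close> remains of the ideal condition.\<close>

lemma cocycles_iff: "z \<in> cocycles F \<longleftrightarrow>
    (fst z \<in> sections {0, 1} \<and> fst (snd z) \<in> sections {0, 2} \<and> snd (snd z) \<in> sections {1, 2} \<and>
     (\<exists>q. cech_d z = G * q))"
proof -
  obtain a b c where z: "z = (a, b, c)" by (cases z)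
  have "c - b + a \<in> sections {0, 1, 2}" if "a \<in> sections {0, 1}" "b \<in> sections {0, 2}" "c \<in> sections {1, 2}"
    using that by (intro sections_add sections_diff) (auto elim: sections_mono[rotated])
  then show ?thesis
    using localized_all by (auto simp: z cocycles_def sections_ideal_def cech_d_def)
qed

lemma cocycles_diff: "z \<in> cocycles F \<Longrightarrow> w \<in> cocycles F \<Longrightarrow> z - w \<in> cocycles F"
  unfolding cocycles_iff using sections_diff
  by (auto simp: cech_d_diff right_diff_distrib[symmetric])

lemma cocycles_add: "z \<in> cocycles F \<Longrightarrow> w \<in> cocycles F \<Longrightarrow> z + w \<in> cocycles F"
  unfolding cocycles_iff using sections_add
  by (auto simp: cech_d_add distrib_left[symmetric])

lemma cocycles_scale: "z \<in> cocycles F \<Longrightarrow> scale_cochain r z \<in> cocycles F"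
  unfolding cocycles_iff cech_d_scale
  by (cases z) (auto simp: scale_cochain_def sections_const mult.left_commute[of _ G])

lemma cocycles_0: "0 \<in> cocycles F"
  unfolding cocycles_iff by (auto simp: sections_0 intro: exI[of _ 0])

lemma cocycles_sum: "(\<And>i. i \<in> I \<Longrightarrow> f i \<in> cocycles F) \<Longrightarrow> sum f I \<in> cocycles F"
  by (induction I rule: infinite_finite_induct) (auto simp: cocycles_0 cocycles_add)

text \<open>The connecting map \<open>H\<^sup>1(C, O) \<rightarrow> H\<^sup>2(P\<^sup>2, O(-d))\<close>; the target has the Laurent monomials of
  degree \<open>-d\<close> with negative exponents as a basis.\<close>

definition connecting :: "'k cochain \<Rightarrow> 'k laurent" where
  "connecting z = restrict_keys negative (THE q. cech_d z = G * q)"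

lemma connecting_eq: "cech_d z = G * q \<Longrightarrow> connecting z = restrict_keys negative q"
  unfolding connecting_def by (rule arg_cong[of _ _ "restrict_keys negative"]) (auto simp: G_cancel)

lemma restrict_keys_add: "restrict_keys P (p + q) = restrict_keys P p + restrict_keys P q"
  by (rule poly_mapping_eqI) (simp add: lookup_add)

lemma restrict_keys_diff: "restrict_keys P (p - q) = restrict_keys P p - restrict_keys P q"
  for p q :: "'b \<Rightarrow>\<^sub>0 'a::ab_group_add"
  by (rule poly_mapping_eqI) (simp add: lookup_minus)

lemma restrict_keys_const: "restrict_keys P (single 0 c * p) = single 0 c * restrict_keys P p"
  for p :: "'k laurent"
  by (rule poly_mapping_eqI) (simp add: lookup_const_times)

lemma restrict_keys_sum: "restrict_keys P (sum f I) = (\<Sum>i\<in>I. restrict_keys P (f i))"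
  by (rule poly_mapping_eqI) (simp add: lookup_sum)

lemma connecting_diff:
  assumes "z \<in> cocycles F" "w \<in> cocycles F"
  shows "connecting (z - w) = connecting z - connecting w"
proof -
  obtain p q where *: "cech_d z = G * p" "cech_d w = G * q" using assms unfolding cocycles_iff by blast
  then have "cech_d (z - w) = G * (p - q)" by (simp add: cech_d_diff right_diff_distrib)
  then show ?thesis using * by (simp add: connecting_eq restrict_keys_diff)
qed

lemma connecting_add:
  assumes "z \<in> cocycles F" "w \<in> cocycles F"
  shows "connecting (z + w) = connecting z + connecting w"
proof -
  obtain p q where *: "cech_d z = G * p" "cech_d w = G * q" using assms unfolding cocycles_iff by blast
  then have "cech_d (z + w) = G * (p + q)" by (simp add: cech_d_add distrib_left)
  then show ?thesis using * by (simp add: connecting_eq restrict_keys_add)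
qed

lemma connecting_scale:
  assumes "z \<in> cocycles F"
  shows "connecting (scale_cochain r z) = single 0 r * connecting z"
proof -
  obtain p where *: "cech_d z = G * p" using assms unfolding cocycles_iff by blast
  then have "cech_d (scale_cochain r z) = G * (single 0 r * p)"
    by (simp add: cech_d_scale mult.left_commute)
  then show ?thesis using * by (simp add: connecting_eq restrict_keys_const)
qed

lemma connecting_0: "connecting 0 = 0"
  using connecting_eq[of 0 0] by (auto intro!: poly_mapping_eqI)

lemma connecting_sum:
  "(\<And>i. i \<in> I \<Longrightarrow> f i \<in> cocycles F) \<Longrightarrow> connecting (sum f I) = (\<Sum>i\<in>I. connecting (f i))"
  by (induction I rule: infinite_finite_induct)
    (auto simp: connecting_0 connecting_add cocycles_sum)

lemma keys_connecting:
  assumes "z \<in> cocycles F" "k \<in> keys (connecting z)"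
  shows "negative k \<and> ldeg k = - int d"
proof -
  obtain q where q: "cech_d z = G * q" using assms unfolding cocycles_iff by blast
  obtain a b c where z: "z = (a, b, c)" by (cases z)
  have "c - b + a \<in> sections {0, 1, 2}"
    using assms(1) unfolding cocycles_iff z by (intro sections_add sections_diff) (auto elim: sections_mono[rotated])
  then have "\<And>k. k \<in> keys (G * q) \<Longrightarrow> ldeg k = 0" using q by (simp add: z cech_d_def sections_iff)
  then show ?thesis using assms(2) ldeg_quotient[of q k] by (simp add: connecting_eq[OF q])
qed

lemma localized_G_times: "q \<in> localized I \<Longrightarrow> G * q \<in> localized I"
  by (intro localized_mult to_laurent_localized)

text \<open>The quotient by \<open>G\<close> is a combination of elements each regular in one of the
  coordinates, so it contains no monomial with three negative exponents.\<close>

lemma coboundaries_cocycle: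
  assumes "z \<in> coboundaries F"
  shows "z \<in> cocycles F \<and> connecting z = 0"
proof -
  obtain a b c where z: "z = (a, b, c)" by (cases z)
  obtain v0 v1 v2 q01 q02 q12 where v: "v0 \<in> sections {0}" "v1 \<in> sections {1}" "v2 \<in> sections {2}"
    and s: "a - (v1 - v0) \<in> sections {0, 1}" "b - (v2 - v0) \<in> sections {0, 2}" "c - (v2 - v1) \<in> sections {1, 2}"
    and q: "q01 \<in> localized {0, 1}" "q02 \<in> localized {0, 2}" "q12 \<in> localized {1, 2}"
    and eq: "a - (v1 - v0) = G * q01" "b - (v2 - v0) = G * q02" "c - (v2 - v1) = G * q12"
    using assms unfolding z coboundaries_def sections_ideal_def by auto
  have "v0 \<in> sections {0, 1}" "v1 \<in> sections {0, 1}"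
    using sections_mono[OF _ v(1), of "{0, 1}"] sections_mono[OF _ v(2), of "{0, 1}"] by auto
  then have "a \<in> sections {0, 1}" using sections_add[OF s(1) sections_diff[of v1 "{0, 1}" v0]] by simp
  moreover have "v0 \<in> sections {0, 2}" "v2 \<in> sections {0, 2}"
    using sections_mono[OF _ v(1), of "{0, 2}"] sections_mono[OF _ v(3), of "{0, 2}"] by auto
  then have "b \<in> sections {0, 2}" using sections_add[OF s(2) sections_diff[of v2 "{0, 2}" v0]] by simp
  moreover have "v1 \<in> sections {1, 2}" "v2 \<in> sections {1, 2}"
    using sections_mono[OF _ v(2), of "{1, 2}"] sections_mono[OF _ v(3), of "{1, 2}"] by auto
  then have "c \<in> sections {1, 2}" using sections_add[OF s(3) sections_diff[of v2 "{1, 2}" v1]] by simp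
  moreover have d: "cech_d z = G * (q12 - q02 + q01)"
  proof -
    have "cech_d z = (c - (v2 - v1)) - (b - (v2 - v0)) + (a - (v1 - v0))"
      by (simp add: z cech_d_def)
    then show ?thesis by (simp only: eq) (simp add: algebra_simps)
  qed
  moreover have "restrict_keys negative (q12 - q02 + q01) = 0"
  proof (rule poly_mapping_eqI)
    fix k :: "int \<times> int \<times> int"
    have "k \<notin> keys q01 \<and> k \<notin> keys q02 \<and> k \<notin> keys q12" if "negative k"
      using q that by (cases k) (fastforce simp: localized_def)
    then show "lookup (restrict_keys negative (q12 - q02 + q01)) k = lookup 0 k"
      by (simp add: lookup_add lookup_minus in_keys_iff)
  qed
  ultimately show ?thesis unfolding cocycles_iff using connecting_eq[OF d] by (auto simp: z)
qed

text \<open>\<open>H\<^sup>1(P\<^sup>2, O) = 0\<close>, monomial by monomial.\<close>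

lemma projective_plane_cocycle:
  fixes u01 u02 u12 :: "'k laurent"
  assumes u: "u01 \<in> sections {0, 1}" "u02 \<in> sections {0, 2}" "u12 \<in> sections {1, 2}"
    and cocycle: "u12 - u02 + u01 = 0"
  shows "\<exists>v0\<in>sections {0}. \<exists>v1\<in>sections {1}. \<exists>v2\<in>sections {2}.
    u01 = v1 - v0 \<and> u02 = v2 - v0 \<and> u12 = v2 - v1"
proof -
  \<comment> \<open>A monomial with two negative exponents can occur in only one of the three
    sections, and the cocycle condition excludes it. The rest is distributed by the sign pattern;
    the constant monomial is given to \<open>v1\<close> and \<open>v2\<close>.\<close>
  define v0 where "v0 = restrict_keys (\<lambda>(a, b, c). a < 0 \<and> 0 \<le> b \<and> 0 \<le> c) (- u01)"
  define v1 where "v1 = restrict_keys (\<lambda>(a, b, c). 0 \<le> a \<and> 0 \<le> c) u01"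
  define v2 where "v2 = restrict_keys (\<lambda>(a, b, c). 0 \<le> a \<and> 0 \<le> b) u02"
  have zero: "lookup u01 (a, b, c) = 0" if "a + b + c \<noteq> 0 \<or> c < 0" for a b c
    using u(1) that by (force simp: sections_def localized_def in_keys_iff)
  have zero': "lookup u02 (a, b, c) = 0" if "a + b + c \<noteq> 0 \<or> b < 0" for a b c
    using u(2) that by (force simp: sections_def localized_def in_keys_iff)
  have zero'': "lookup u12 (a, b, c) = 0" if "a + b + c \<noteq> 0 \<or> a < 0" for a b c
    using u(3) that by (force simp: sections_def localized_def in_keys_iff)
  have cocycle': "lookup u02 k = lookup u12 k + lookup u01 k" for k
  proof -
    have "u02 = u12 + u01" using cocycle by (simp add: algebra_simps)
    then show ?thesis by (simp add: lookup_add)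
  qed
  have "v0 \<in> sections {0}" "v1 \<in> sections {1}" "v2 \<in> sections {2}"
    using u by (auto simp: v0_def v1_def v2_def sections_def localized_def keys_uminus)
  moreover have "u01 = v1 - v0"
  proof (rule poly_mapping_eqI)
    fix k :: "int \<times> int \<times> int"
    obtain a b c where k: "k = (a, b, c)" by (cases k)
    show "lookup u01 k = lookup (v1 - v0) k"
      using zero[of a b c] zero'[of a b c] zero''[of a b c] cocycle'[of k]
      by (auto simp: k v0_def v1_def lookup_minus)
  qed
  moreover have "u02 = v2 - v0"
  proof (rule poly_mapping_eqI)
    fix k :: "int \<times> int \<times> int"
    obtain a b c where k: "k = (a, b, c)" by (cases k)
    show "lookup u02 k = lookup (v2 - v0) k"
      using zero[of a b c] zero'[of a b c] zero''[of a b c] cocycle'[of k]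
      by (auto simp: k v0_def v2_def lookup_minus)
  qed
  moreover have "u12 = u02 - u01" using cocycle by (simp add: algebra_simps)
  ultimately show ?thesis
    by (intro bexI[of _ v0] bexI[of _ v1] bexI[of _ v2]) auto
qed

text \<open>A monomial with some nonnegative exponent is regular on a pairwise intersection of the
  cover. It is assigned to the first possible one, and the sign in \<open>q02\<close> matches the
  Cech differential.\<close>

lemma split_nonnegative:
  fixes q :: "'k laurent"
  assumes "\<And>k. k \<in> keys q \<Longrightarrow> \<not> negative k"
  shows "\<exists>q01 q02 q12. q = q12 - q02 + q01 \<and> q01 \<in> localized {0, 1} \<and> q02 \<in> localized {0, 2} \<and>
    q12 \<in> localized {1, 2} \<and> keys q01 \<subseteq> keys q \<and> keys q02 \<subseteq> keys q \<and> keys q12 \<subseteq> keys q"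
proof -
  define q01 where "q01 = restrict_keys (\<lambda>(a, b, c). 0 \<le> c) q"
  define q02 where "q02 = restrict_keys (\<lambda>(a, b, c). c < 0 \<and> 0 \<le> b) (- q)"
  define q12 where "q12 = restrict_keys (\<lambda>(a, b, c). c < 0 \<and> b < 0) q"
  have "q = q12 - q02 + q01"
    by (rule poly_mapping_eqI) (auto simp: q01_def q02_def q12_def lookup_add lookup_minus)
  moreover have "q01 \<in> localized {0, 1}" "q02 \<in> localized {0, 2}"
    by (auto simp: localized_def q01_def q02_def)
  moreover have "q12 \<in> localized {1, 2}"
    using assms by (fastforce simp: localized_def q12_def)
  ultimately show ?thesis
    by (intro exI[of _ q01] exI[of _ q02] exI[of _ q12])
      (auto simp: q01_def q02_def q12_def keys_uminus simp del: lookup_restrict_keys)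
qed

text \<open>Without negative monomials the quotient \<open>q\<close> splits over the pairwise
  intersections. Subtracting \<open>G\<close> times the pieces turns \<open>z\<close> into a genuine
  cocycle of the projective plane, and such a cocycle bounds.\<close>

lemma cocycle_coboundary:
  assumes z: "z \<in> cocycles F" and 0: "connecting z = 0"
  shows "z \<in> coboundaries F"
proof -
  obtain a b c where zabc: "z = (a, b, c)" by (cases z)
  obtain q where q: "cech_d z = G * q" using z unfolding cocycles_iff by blast
  have s: "a \<in> sections {0, 1}" "b \<in> sections {0, 2}" "c \<in> sections {1, 2}"
    using z unfolding cocycles_iff zabc by auto
  have "c - b + a \<in> sections {0, 1, 2}"
    using s by (intro sections_add sections_diff) (auto elim: sections_mono[rotated])
  then have deg: "\<And>k. k \<in> keys (G * q) \<Longrightarrow> ldeg k = 0" using q by (simp add: zabc cech_d_def sections_iff)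
  have "restrict_keys negative q = 0" using 0 connecting_eq[OF q] by simp
  then have "\<not> negative k" if "k \<in> keys q" for k
    using that by (metis lookup_restrict_keys lookup_zero in_keys_iff)
  then obtain q01 q02 q12 where qs: "q = q12 - q02 + q01" "q01 \<in> localized {0, 1}" "q02 \<in> localized {0, 2}"
    "q12 \<in> localized {1, 2}" "keys q01 \<subseteq> keys q" "keys q02 \<subseteq> keys q" "keys q12 \<subseteq> keys q"
    using split_nonnegative[of q] by blast
  have deg': "ldeg k = 0" if "k \<in> keys (G * p)" "keys p \<subseteq> keys q" for k p
    using ldeg_keys_G_times[OF that(1)] ldeg_quotient[OF deg] that(2) by force
  have sG: "G * q01 \<in> sections {0, 1}" "G * q02 \<in> sections {0, 2}" "G * q12 \<in> sections {1, 2}"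
    unfolding sections_iff using qs deg' localized_G_times by auto
  have "(c - G * q12) - (b - G * q02) + (a - G * q01) = 0"
    using q by (simp add: zabc cech_d_def qs(1) algebra_simps)
  from projective_plane_cocycle[OF sections_diff[OF s(1) sG(1)] sections_diff[OF s(2) sG(2)]
      sections_diff[OF s(3) sG(3)] this]
  obtain v0 v1 v2 where v: "v0 \<in> sections {0}" "v1 \<in> sections {1}" "v2 \<in> sections {2}"
    and eq: "a - G * q01 = v1 - v0" "b - G * q02 = v2 - v0" "c - G * q12 = v2 - v1" by blast
  have "a - (v1 - v0) = G * q01" "b - (v2 - v0) = G * q02" "c - (v2 - v1) = G * q12"
    using eq by (simp_all add: algebra_simps flip: eq)
  then have "a - (v1 - v0) \<in> sections_ideal F {0, 1}" "b - (v2 - v0) \<in> sections_ideal F {0, 2}"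
    "c - (v2 - v1) \<in> sections_ideal F {1, 2}"
    unfolding sections_ideal_def using sG qs by auto
  then show ?thesis unfolding coboundaries_def zabc using v by blast
qed

text \<open>\<open>G * v\<close> has degree 0, so none of its monomials has three negative
  exponents, and it is the Cech differential of a cochain.\<close>

lemma connecting_surj:
  assumes "\<And>k. k \<in> keys v \<Longrightarrow> negative k \<and> ldeg k = - int d"
  shows "\<exists>z\<in>cocycles F. connecting z = v"
proof -
  have deg: "ldeg k = 0" if "k \<in> keys (G * v)" for k
    using ldeg_keys_G_times[OF that] assms by force
  then have "\<not> negative k" if "k \<in> keys (G * v)" for k using deg[OF that] by (cases k) auto
  then obtain a b c where abc: "G * v = c - b + a" "a \<in> localized {0, 1}" "b \<in> localized {0, 2}"
    "c \<in> localized {1, 2}" "keys a \<subseteq> keys (G * v)" "keys b \<subseteq> keys (G * v)" "keys c \<subseteq> keys (G * v)"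
    using split_nonnegative[of "G * v"] by blast
  have d: "cech_d (a, b, c) = G * v" by (simp add: cech_d_def abc)
  have "a \<in> sections {0, 1}" "b \<in> sections {0, 2}" "c \<in> sections {1, 2}"
    unfolding sections_iff using abc(2-) deg by blast+
  then have "(a, b, c) \<in> cocycles F" unfolding cocycles_iff using d by (metis fst_conv snd_conv)
  moreover have "connecting (a, b, c) = v"
    unfolding connecting_eq[OF d] by (rule poly_mapping_eqI) (use assms in \<open>auto simp: in_keys_iff\<close>)
  ultimately show ?thesis by blast
qed

text \<open>The kernel of the connecting map consists of the coboundaries, so coordinates in
  cohomology can be read off from Laurent polynomials.\<close>

lemma H1_coords_iff:
  assumes "set bs \<subseteq> cocycles F" "z \<in> cocycles F"
  shows "H1_coords F bs z r \<longleftrightarrow> r \<in> carrier_vec (length bs) \<and>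
    connecting z = (\<Sum>i<length bs. single 0 (r $ i) * connecting (bs ! i))"
proof -
  define s where "s = (\<Sum>i<length bs. scale_cochain (r $ i) (bs ! i))"
  have bs: "bs ! i \<in> cocycles F" if "i < length bs" for i using assms(1) that by auto
  have s: "s \<in> cocycles F" unfolding s_def by (intro cocycles_sum cocycles_scale bs) simp
  have "z - s \<in> coboundaries F \<longleftrightarrow> connecting z = connecting s"
    using cocycle_coboundary[OF cocycles_diff[OF assms(2) s]] coboundaries_cocycle[of "z - s"]
    by (auto simp: connecting_diff assms(2) s)
  also have "connecting s = (\<Sum>i<length bs. single 0 (r $ i) * connecting (bs ! i))"
    unfolding s_def by (subst connecting_sum) (auto intro!: cocycles_scale bs simp: connecting_scale bs)
  finally show ?thesis by (simp add: H1_coords_def s_def)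
qed

text \<open>Squaring commutes with the Cech differential, and \<open>(G q)^2 = G (G q^2)\<close>; so
  the quotient \<open>q\<close> is replaced by \<open>G q^2\<close>. Only the negative part of
  \<open>q\<close> matters, because squares of the remaining monomials and their multiples by
  \<open>G\<close> keep a nonnegative exponent.\<close>

lemma frobenius_cocycle:
  assumes char2: "CHAR('k) = 2" and z: "z \<in> cocycles F"
  shows "frobenius z \<in> cocycles F" "connecting (frobenius z) = restrict_keys negative (G * (connecting z)\<^sup>2)"
proof -
  obtain a b c where zabc: "z = (a, b, c)" by (cases z)
  obtain q where q: "cech_d z = G * q" using z unfolding cocycles_iff by blast
  have s: "a \<in> sections {0, 1}" "b \<in> sections {0, 2}" "c \<in> sections {1, 2}"
    using z unfolding cocycles_iff zabc by auto
  note self = add_self_char2[OF char2]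
  \<comment> \<open>The sign of \<open>b^2\<close> and the mixed terms are collected in a summand of
    the form \<open>t + t\<close>, which is 0.\<close>
  have "(cech_d z)\<^sup>2 = (c\<^sup>2 - b\<^sup>2 + a\<^sup>2) + ((b\<^sup>2 - c * b + c * a - b * a) + (b\<^sup>2 - c * b + c * a - b * a))"
    by (simp add: zabc cech_d_def power2_eq_square algebra_simps)
  then have "cech_d (frobenius z) = (cech_d z)\<^sup>2"
    unfolding self by (simp add: zabc cech_d_def frobenius_def char2)
  then have d: "cech_d (frobenius z) = G * (G * q\<^sup>2)" by (simp add: q power2_eq_square ac_simps)
  then show "frobenius z \<in> cocycles F"
    unfolding cocycles_iff using s by (auto simp: zabc frobenius_def char2 power2_eq_square intro: sections_mult)
  define n where "n = restrict_keys negative q"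
  define r where "r = restrict_keys (\<lambda>k. \<not> negative k) q"
  have "q = n + r" unfolding n_def r_def by (rule restrict_keys_split)
  then have "q\<^sup>2 = n\<^sup>2 + r\<^sup>2 + (n * r + n * r)" by (simp add: power2_eq_square algebra_simps)
  then have "G * q\<^sup>2 = G * n\<^sup>2 + G * r\<^sup>2" unfolding self by (simp add: distrib_left)
  moreover have "restrict_keys negative (G * r\<^sup>2) = 0"
  proof (rule poly_mapping_eqI)
    fix k
    have "\<not> negative k" if k: "k \<in> keys (G * r\<^sup>2)"
    proof -
      obtain x y where xy: "k = x + y" "x \<in> keys G" "y \<in> keys (r\<^sup>2)" using k keys_mult[of G "r\<^sup>2"] by blast
      obtain l where l: "y = l + l" "l \<in> keys r"
        using xy(3) unfolding square_char2[OF char2 finite_keys subset_refl]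
        by (auto dest!: subsetD[OF keys_sum] split: if_splits)
      have "\<not> negative l" using l(2) by (simp add: r_def)
      then show ?thesis using xy(1,2) l(1) by (cases l) (auto simp: keys_to_laurent emb_def)
    qed
    then show "lookup (restrict_keys negative (G * r\<^sup>2)) k = lookup 0 k" by (auto simp: in_keys_iff)
  qed
  ultimately show "connecting (frobenius z) = restrict_keys negative (G * (connecting z)\<^sup>2)"
    unfolding connecting_eq[OF d] connecting_eq[OF q] by (simp add: restrict_keys_add n_def)
qed

end

section \<open>Rank and factorizations\<close>

text \<open>A maximal independent set of columns has \<open>rank A\<close> elements and spans all
  columns; its coordinates give the second factor.\<close>

lemma (in vec_space) rank_factorization:
  assumes A: "A \<in> carrier_mat n nc"
  shows "\<exists>u w. \<forall>i<n. \<forall>j<nc. A $$ (i, j) = (\<Sum>l<rank A. u i l * w l j)"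
proof -
  define P where "P = (\<lambda>T. T \<subseteq> set (cols A) \<and> lin_indpt T)"
  have "P {}" unfolding P_def by (simp add: lin_dep_def)
  then obtain S where S: "finite S" "maximal S P"
    using maximal_exists_superset[of "set (cols A)" P "{}"] unfolding P_def by blast
  have r: "rank A = card S" using rank_card_indpt[OF A] S(2) unfolding P_def by blast
  have cols: "set (cols A) \<subseteq> carrier_vec n" using A cols_dim by blast
  have SS: "S \<subseteq> set (cols A)" "lin_indpt S" using S(2) unfolding maximal_def P_def by auto
  have SC: "S \<subseteq> carrier_vec n" using SS cols by blast
  obtain h where h: "bij_betw h {..<card S} S"
    using ex_bij_betw_nat_finite[OF S(1)] by (auto simp: lessThan_atLeast0)
  have "\<exists>a. lincomb a S = col A j" if "j < nc" for j
  proof -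
    have c: "col A j \<in> set (cols A)" using A that by (simp add: cols_def)
    have "col A j \<in> span S"
    proof (cases "col A j \<in> S")
      case True
      then show ?thesis using span_mem SC by (simp add: span_mem)
    next
      case False
      then have "\<not> P (S \<union> {col A j})" using S(2) unfolding maximal_def by blast
      then have "lin_dep (S \<union> {col A j})" using SS c unfolding P_def by blast
      then show ?thesis using lin_dep_iff_in_span[of S "col A j"] SC SS(2) False c cols by auto
    qed
    then show ?thesis using finite_in_span[OF S(1)] SC by auto
  qed
  then obtain a where a: "\<And>j. j < nc \<Longrightarrow> lincomb (a j) S = col A j" by metis
  have eq: "A $$ (i, j) = (\<Sum>l<rank A. (h l $ i) * a j (h l))" if "i < n" "j < nc" for i j
  proof -
    have "A $$ (i, j) = lincomb (a j) S $ i" using that A by (simp add: a)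
    also have "\<dots> = (\<Sum>x\<in>S. a j x * x $ i)" by (rule lincomb_index[OF that(1) SC])
    also have "\<dots> = (\<Sum>l<card S. a j (h l) * h l $ i)"
      by (rule sum.reindex_bij_betw[OF h, symmetric])
    finally show ?thesis by (simp add: r mult.commute)
  qed
  show ?thesis
    by (intro exI[of _ "\<lambda>i l. h l $ i"] exI[of _ "\<lambda>l j. a j (h l)"] allI impI) (rule eq)
qed

text \<open>If there were more independent columns than summands, some nontrivial combination of
  these columns would be orthogonal to every \<open>w l\<close> and hence vanish.\<close>

lemma (in vec_space) rank_le_factorization:
  assumes A: "A \<in> carrier_mat n nc" and I: "finite I"
    and eq: "\<And>i j. i < n \<Longrightarrow> j < nc \<Longrightarrow> A $$ (i, j) = (\<Sum>l\<in>I. u i l * w l j)"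
  shows "rank A \<le> card I"
proof (rule ccontr)
  assume less: "\<not> ?thesis"
  define P where "P = (\<lambda>T. T \<subseteq> set (cols A) \<and> lin_indpt T)"
  have "P {}" unfolding P_def by (simp add: lin_dep_def)
  then obtain S where S: "finite S" "maximal S P"
    using maximal_exists_superset[of "set (cols A)" P "{}"] unfolding P_def by blast
  have r: "rank A = card S" using rank_card_indpt[OF A] S(2) unfolding P_def by blast
  have cols: "set (cols A) \<subseteq> carrier_vec n" using A cols_dim by blast
  have SS: "S \<subseteq> set (cols A)" "lin_indpt S" using S(2) unfolding maximal_def P_def by auto
  have SC: "S \<subseteq> carrier_vec n" using SS cols by blast
  have "\<forall>s\<in>S. \<exists>j<nc. s = col A j" using SS(1) A by (fastforce simp: cols_def)
  then obtain j where j: "\<And>s. s \<in> S \<Longrightarrow> j s < nc" "\<And>s. s \<in> S \<Longrightarrow> s = col A (j s)" by metis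
  have "card I < card S" using less r by simp
  from underdetermined_system[OF I S(1) this, of "\<lambda>s l. w l (j s)"]
  obtain x where x: "\<exists>s\<in>S. x s \<noteq> 0" "\<And>l. l \<in> I \<Longrightarrow> (\<Sum>s\<in>S. x s * w l (j s)) = 0" by blast
  have "lincomb x S = 0\<^sub>v n"
  proof (rule eq_vecI)
    fix i assume "i < dim_vec (0\<^sub>v n)"
    then have i: "i < n" by simp
    have "lincomb x S $ i = (\<Sum>s\<in>S. x s * s $ i)" by (rule lincomb_index[OF i SC])
    also have "\<dots> = (\<Sum>s\<in>S. \<Sum>l\<in>I. u i l * (x s * w l (j s)))"
    proof (rule sum.cong)
      fix s assume s: "s \<in> S"
      have "s $ i = A $$ (i, j s)" using j[OF s] i A by (metis carrier_matD index_col)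
      then show "x s * s $ i = (\<Sum>l\<in>I. u i l * (x s * w l (j s)))"
        using eq[OF i j(1)[OF s]] by (simp add: sum_distrib_left mult_ac)
    qed simp
    also have "\<dots> = (\<Sum>l\<in>I. u i l * (\<Sum>s\<in>S. x s * w l (j s)))"
      by (subst sum.swap) (simp add: sum_distrib_left)
    also have "\<dots> = 0" using x(2) by simp
    finally show "lincomb x S $ i = 0\<^sub>v n $ i" using i by simp
  qed (use lincomb_dim[OF S(1) SC] in simp)
  then have "x \<in> S \<rightarrow> {0}"
    using not_lindepD[OF SS(2) S(1) subset_refl, of x] by (simp add: class_ring_simps module_vec_simps)
  then show False using x(1) by auto
qed

section \<open>The Hasse--Witt matrix of a plane curve\<close>

lemma card_tdeg: "2 * card {k. tdeg k = n} = (n + 1) * (n + 2)"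
proof -
  have "bij_betw (\<lambda>(i, j). (i, j, n - i - j)) (Sigma {..n} (\<lambda>i. {..n - i})) {k. tdeg k = n}"
    by (rule bij_betwI[of _ _ _ "\<lambda>(i, j, l). (i, j)"]) auto
  then have "card {k. tdeg k = n} = card (Sigma {..n} (\<lambda>i. {..n - i}))"
    by (rule bij_betw_same_card[symmetric])
  also have "\<dots> = (\<Sum>i\<le>n. Suc (n - i))" by simp
  also have "\<dots> = (\<Sum>i\<le>n. Suc i)"
    using sum.atLeastAtMost_rev[of Suc 0 n] by (simp add: atLeast0AtMost)
  also have "2 * \<dots> = (n + 1) * (n + 2)" by (induction n) simp_all
  finally show ?thesis .
qed

lemma card_tdeg_2: "2 * card {k. tdeg k + 2 = n} = n * (n - 1)"
proof -
  consider "n < 2" | m where "n = m + 2" by (metis add.commute less_eqE not_less)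
  then show ?thesis
  proof cases
    case 1
    then have "{k. tdeg k + 2 = n} = {}" by auto
    then show ?thesis using 1 by (cases n) auto
  next
    case (2 m)
    then have "{k. tdeg k + 2 = n} = {k. tdeg k = m}" by auto
    then show ?thesis using card_tdeg[of m] 2 by (simp add: mult.commute)
  qed
qed

text \<open>Serre duality on monomials: the negative exponents of degree \<open>-d\<close>
  correspond to the monomials of degree \<open>d - 3\<close>. The shift by \<open>(1, 1, 1)\<close>
  is the source of the class \<open>(1, 1, 1)\<close> in all coefficient formulas.\<close>

definition neg_exp :: "nat \<times> nat \<times> nat \<Rightarrow> int \<times> int \<times> int" where
  "neg_exp k = - emb k - (1, 1, 1)"

lemma neg_exp_eq_iff [simp]: "neg_exp k = neg_exp l \<longleftrightarrow> k = l"
  by (auto simp: neg_exp_def)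

lemma negative_neg_exp: "negative (neg_exp k)"
  by (cases k) (simp add: neg_exp_def)

lemma ldeg_neg_exp: "ldeg (neg_exp k) = - int (tdeg k + 3)"
  by (cases k) (simp add: neg_exp_def)

lemma negativeE:
  assumes "negative k"
  obtains l where "k = neg_exp l"
proof -
  obtain a b c where k: "k = (a, b, c)" by (cases k)
  have "k = neg_exp (nat (- a - 1), nat (- b - 1), nat (- c - 1))"
    using assms by (simp add: k neg_exp_def)
  then show ?thesis using that by blast
qed

section \<open>Frobenius in the basis of negative monomials\<close>

context plane_curve
begin

definition Idx :: "(nat \<times> nat \<times> nat) set" where
  "Idx = {k. tdeg k + 3 = d}"

lemma finite_Idx: "finite Idx"
  by (rule finite_subset[OF _ finite_tdeg[of "d - 3"]]) (auto simp: Idx_def)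

definition top_part :: "'k laurent \<Rightarrow> bool" where
  "top_part v \<longleftrightarrow> (\<forall>k\<in>keys v. negative k \<and> ldeg k = - int d)"

lemma top_part_keys: "top_part v \<Longrightarrow> keys v \<subseteq> neg_exp ` Idx"
  unfolding top_part_def by (force elim!: negativeE simp: ldeg_neg_exp Idx_def simp del: tdeg_simp)

lemma top_part_eqI:
  assumes "top_part v" "top_part w" "\<And>\<beta>. \<beta> \<in> Idx \<Longrightarrow> lookup v (neg_exp \<beta>) = lookup w (neg_exp \<beta>)"
  shows "v = w"
proof (rule poly_mapping_eqI)
  fix k
  show "lookup v k = lookup w k"
  proof (cases "k \<in> neg_exp ` Idx")
    case True
    then show ?thesis using assms(3) by blast
  next
    case False
    then have "k \<notin> keys v" "k \<notin> keys w"
      using top_part_keys[OF assms(1)] top_part_keys[OF assms(2)] by blast+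
    then show ?thesis by (simp add: in_keys_iff)
  qed
qed

lemma top_part_add: "top_part v \<Longrightarrow> top_part w \<Longrightarrow> top_part (v + w)"
  unfolding top_part_def by (auto dest!: subsetD[OF Poly_Mapping.keys_add])

lemma top_part_0: "top_part 0"
  by (simp add: top_part_def)

lemma top_part_sum: "(\<And>i. i \<in> I \<Longrightarrow> top_part (f i)) \<Longrightarrow> top_part (sum f I)"
  by (induction I rule: infinite_finite_induct) (auto simp: top_part_add top_part_0)

lemma top_part_const: "top_part v \<Longrightarrow> top_part (single 0 c * v)"
  unfolding top_part_def by (auto dest!: subsetD[OF keys_const_times])

lemma top_part_connecting: "z \<in> cocycles F \<Longrightarrow> top_part (connecting z)"
  using keys_connecting unfolding top_part_def by blast

lemma top_part_single: "\<beta> \<in> Idx \<Longrightarrow> top_part (single (neg_exp \<beta>) c)"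
  by (auto simp: top_part_def negative_neg_exp ldeg_neg_exp Idx_def)

lemma ex_cocycle_single:
  assumes "\<beta> \<in> Idx"
  shows "\<exists>z\<in>cocycles F. connecting z = single (neg_exp \<beta>) 1"
  using connecting_surj[of "single (neg_exp \<beta>) 1"] top_part_single[OF assms, of 1]
  unfolding top_part_def by blast

text \<open>For \<open>p = 2\<close> this is the classical rule that the entries are coefficients of
  \<open>F ^ (p - 1)\<close>. They sit at \<open>2 \<beta> + (1, 1, 1) - \<alpha>\<close>;
  multiplying \<open>F\<close> by the monomial of \<alpha> avoids the subtraction.\<close>

lemma lookup_frobenius:
  assumes char2: "CHAR('k) = 2" and v: "top_part v"
  shows "lookup (restrict_keys negative (G * v\<^sup>2)) (neg_exp \<alpha>) =
    (\<Sum>\<beta>\<in>Idx. (lookup v (neg_exp \<beta>))\<^sup>2 * lookup (F * single \<alpha> 1) (\<beta> + \<beta> + (1, 1, 1)))"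
proof -
  have "v\<^sup>2 = (\<Sum>k\<in>neg_exp ` Idx. single (k + k) ((lookup v k)\<^sup>2))"
    by (rule square_char2[OF char2 _ top_part_keys[OF v]]) (simp add: finite_Idx)
  also have "\<dots> = (\<Sum>\<beta>\<in>Idx. single (neg_exp \<beta> + neg_exp \<beta>) ((lookup v (neg_exp \<beta>))\<^sup>2))"
    by (subst sum.reindex) (auto simp: inj_on_def)
  finally have v2: "v\<^sup>2 = (\<Sum>\<beta>\<in>Idx. single (neg_exp \<beta> + neg_exp \<beta>) ((lookup v (neg_exp \<beta>))\<^sup>2))" .
  have exp: "neg_exp \<alpha> - (neg_exp \<beta> + neg_exp \<beta>) = emb (\<beta> + \<beta> + (1, 1, 1)) - emb \<alpha>" for \<beta>
    by (cases \<alpha>; cases \<beta>) (simp add: neg_exp_def)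
  show ?thesis
    unfolding v2 sum_distrib_left
    by (simp only: lookup_restrict_keys negative_neg_exp if_True lookup_sum lookup_times_single exp
        lookup_to_laurent_shift mult.commute)
qed

text \<open>Cocycles with the negative monomials as connecting images form a basis, and coordinates
  are coefficients.\<close>

lemma has_genus_card: "has_genus F (card Idx)"
proof -
  obtain z where z: "\<And>\<beta>. \<beta> \<in> Idx \<Longrightarrow> z \<beta> \<in> cocycles F"
    "\<And>\<beta>. \<beta> \<in> Idx \<Longrightarrow> connecting (z \<beta>) = single (neg_exp \<beta>) 1"
    using ex_cocycle_single by metis
  obtain xs where xs: "set xs = Idx" "distinct xs" using finite_distinct_list[OF finite_Idx] by blast
  define bs where "bs = map z xs"
  have len: "length bs = length xs" by (simp add: bs_def)
  have bs: "set bs \<subseteq> cocycles F" using z(1) xs(1) by (auto simp: bs_def)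
  have lin: "(\<Sum>i<length bs. single 0 (r $ i) * connecting (bs ! i)) =
      (\<Sum>i<length xs. single (neg_exp (xs ! i)) (r $ i))" for r :: "'k vec"
  proof (rule sum.cong)
    fix i assume "i \<in> {..<length xs}"
    then have i: "i < length xs" by simp
    then have "connecting (bs ! i) = single (neg_exp (xs ! i)) 1"
      using z(2)[of "xs ! i"] nth_mem[OF i] by (simp add: xs(1) bs_def)
    then show "single 0 (r $ i) * connecting (bs ! i) = single (neg_exp (xs ! i)) (r $ i)"
      by (simp add: mult_single)
  qed (simp add: len)
  have coeff: "lookup (\<Sum>i<length xs. single (neg_exp (xs ! i)) (r $ i)) (neg_exp (xs ! j)) = r $ j"
    if "j < length xs" for r :: "'k vec" and j
    using that xs(2) by (simp add: lookup_sum lookup_single when_def nth_eq_iff_index_eq sum.delta)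
  have "\<exists>!r. H1_coords F bs w r" if w: "w \<in> cocycles F" for w
  proof (rule ex1I)
    define r where "r = vec (length xs) (\<lambda>i. lookup (connecting w) (neg_exp (xs ! i)))"
    have "connecting w = (\<Sum>i<length xs. single (neg_exp (xs ! i)) (r $ i))"
    proof (rule top_part_eqI[OF top_part_connecting[OF w]])
      show "top_part (\<Sum>i<length xs. single (neg_exp (xs ! i)) (r $ i))"
      proof (rule top_part_sum, rule top_part_single)
        fix i assume "i \<in> {..<length xs}"
        then show "xs ! i \<in> Idx" using nth_mem[of i xs] unfolding xs(1) by simp
      qed
      fix \<beta> assume "\<beta> \<in> Idx"
      then obtain j where j: "j < length xs" "xs ! j = \<beta>"
        unfolding xs(1)[symmetric] in_set_conv_nth by blast
      show "lookup (connecting w) (neg_exp \<beta>) =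
          lookup (\<Sum>i<length xs. single (neg_exp (xs ! i)) (r $ i)) (neg_exp \<beta>)"
        unfolding j(2)[symmetric] coeff[OF j(1)] using j(1) by (simp add: r_def)
    qed
    then show "H1_coords F bs w r" unfolding H1_coords_iff[OF bs w] lin by (simp add: r_def len)
    fix r' assume "H1_coords F bs w r'"
    then have r': "r' \<in> carrier_vec (length xs)"
      "connecting w = (\<Sum>i<length xs. single (neg_exp (xs ! i)) (r' $ i))"
      unfolding H1_coords_iff[OF bs w] lin by (simp_all add: len)
    show "r' = r"
    proof (rule eq_vecI)
      fix j assume "j < dim_vec r"
      then have j: "j < length xs" by (simp add: r_def)
      then have "r $ j = lookup (connecting w) (neg_exp (xs ! j))" by (simp add: r_def)
      also have "\<dots> = r' $ j" unfolding r'(2) by (rule coeff[OF j])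
      finally show "r' $ j = r $ j" ..
    qed (use r'(1) in \<open>simp add: r_def\<close>)
  qed
  then have "H1_basis F bs" unfolding H1_basis_def using bs by blast
  then show ?thesis
    unfolding has_genus_def using xs distinct_card[of xs] len by (intro exI[of _ bs]) auto
qed

section \<open>The Hasse-Witt matrix in an arbitrary basis\<close>

context
  fixes bs assumes char2: "CHAR('k) = 2" and basis: "H1_basis F bs"
begin

abbreviation "N \<equiv> length bs"
abbreviation "M \<equiv> hasse_witt_matrix F bs"
abbreviation "b i \<equiv> connecting (bs ! i)"

lemma bs_cocycles: "set bs \<subseteq> cocycles F" "i < N \<Longrightarrow> bs ! i \<in> cocycles F"
  using basis unfolding H1_basis_def by auto

lemma ex1_coords: "z \<in> cocycles F \<Longrightarrow> \<exists>!r. H1_coords F bs z r"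
  using basis unfolding H1_basis_def by blast

lemma M_carrier: "M \<in> carrier_mat N N"
  unfolding hasse_witt_matrix_def by (metis length_map mat_of_cols_carrier(1))

lemma frobenius_b:
  assumes "j < N"
  shows "restrict_keys negative (G * (b j)\<^sup>2) = (\<Sum>i<N. single 0 (M $$ (i, j)) * b i)"
proof -
  have z: "bs ! j \<in> cocycles F" using bs_cocycles assms by blast
  define r where "r = (THE r. H1_coords F bs (frobenius (bs ! j)) r)"
  have r: "H1_coords F bs (frobenius (bs ! j)) r"
    unfolding r_def by (rule theI'[OF ex1_coords[OF frobenius_cocycle(1)[OF char2 z]]])
  have "M $$ (i, j) = r $ i" if "i < N" for i
    using that assms by (simp add: hasse_witt_matrix_def mat_of_cols_index r_def)
  then show ?thesis
    using r unfolding H1_coords_iff[OF bs_cocycles(1) frobenius_cocycle(1)[OF char2 z]]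
      frobenius_cocycle(2)[OF char2 z] by simp
qed

lemma monomial_coords:
  "\<exists>r. \<forall>\<beta>\<in>Idx. single (neg_exp \<beta>) 1 = (\<Sum>i<N. single 0 (r \<beta> i) * b i)"
proof (rule bchoice, rule ballI)
  fix \<beta> assume \<beta>: "\<beta> \<in> Idx"
  obtain z where z: "z \<in> cocycles F" "connecting z = single (neg_exp \<beta>) 1"
    using ex_cocycle_single[OF \<beta>] by blast
  obtain r where "H1_coords F bs z r" using ex1_coords[OF z(1)] by blast
  then show "\<exists>r. single (neg_exp \<beta>) 1 = (\<Sum>i<N. single 0 (r i) * b i)"
    unfolding H1_coords_iff[OF bs_cocycles(1) z(1)] z(2) by blast
qed

lemma b_independent:
  assumes "(\<Sum>i<N. single 0 (r i) * b i) = (\<Sum>i<N. single 0 (s i) * b i)" "i < N"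
  shows "r i = s i"
proof -
  define z where "z = (\<Sum>i<N. scale_cochain (r i) (bs ! i))"
  have z: "z \<in> cocycles F"
    unfolding z_def by (intro cocycles_sum cocycles_scale bs_cocycles) simp
  have cz: "connecting z = (\<Sum>i<N. single 0 (r i) * b i)"
    unfolding z_def by (subst connecting_sum) (auto intro!: cocycles_scale bs_cocycles simp: connecting_scale bs_cocycles)
  have "H1_coords F bs z (vec N r)" "H1_coords F bs z (vec N s)"
    unfolding H1_coords_iff[OF bs_cocycles(1) z] cz using assms(1) by simp_all
  then have "vec N r = vec N s" using ex1_coords[OF z] by blast
  then show ?thesis using assms(2) by (metis index_vec)
qed

text \<open>The negative monomials are expanded in the given basis with coordinates
  \<open>r\<close>. Since Frobenius squares scalars, the monomial matrix is \<open>M\<close> with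
  the squares of \<open>r\<close> on one side and the coefficients of the \<open>b i\<close> on the
  other. Inserting a rank factorization of \<open>M\<close> keeps the number of summands.\<close>

lemma hasse_witt_factorization:
  "\<exists>c w. \<forall>\<alpha>\<in>Idx. \<forall>\<beta>\<in>Idx. lookup (F * single \<alpha> 1) (\<beta> + \<beta> + (1, 1, 1)) =
    (\<Sum>l<vec_space.rank N M. c l \<alpha> * w l \<beta>)"
proof -
  obtain u y where uy: "\<And>i j. i < N \<Longrightarrow> j < N \<Longrightarrow> M $$ (i, j) = (\<Sum>l<vec_space.rank N M. u i l * y l j)"
    using vec_space.rank_factorization[OF M_carrier] by blast
  obtain r where r: "\<And>\<beta>. \<beta> \<in> Idx \<Longrightarrow> single (neg_exp \<beta>) 1 = (\<Sum>j<N. single 0 (r \<beta> j) * b j)"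
    using monomial_coords by blast
  define \<rho> where "\<rho> = vec_space.rank N M"
  have "lookup (F * single \<alpha> 1) (\<beta> + \<beta> + (1, 1, 1)) =
    (\<Sum>l<\<rho>. (\<Sum>i<N. u i l * lookup (b i) (neg_exp \<alpha>)) * (\<Sum>j<N. y l j * (r \<beta> j)\<^sup>2))"
    if \<beta>: "\<beta> \<in> Idx" for \<alpha> \<beta>
  proof -
    define v where "v = single (neg_exp \<beta>) (1::'k)"
    have sq: "v\<^sup>2 = (\<Sum>j<N. single 0 ((r \<beta> j)\<^sup>2) * (b j)\<^sup>2)"
    proof -
      have "(single 0 a)\<^sup>2 = (single 0 (a\<^sup>2) :: 'k laurent)" for a
        by (simp add: power2_eq_square mult_single)
      then show ?thesis
        unfolding v_def r[OF \<beta>] square_sum_char2[OF add_self_char2[OF char2]]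
        by (simp add: power_mult_distrib)
    qed
    have "lookup (F * single \<alpha> 1) (\<beta> + \<beta> + (1, 1, 1)) =
        (\<Sum>\<beta>'\<in>Idx. (lookup v (neg_exp \<beta>'))\<^sup>2 * lookup (F * single \<alpha> 1) (\<beta>' + \<beta>' + (1, 1, 1)))"
    proof -
      have "(lookup v (neg_exp \<beta>'))\<^sup>2 * lookup (F * single \<alpha> 1) (\<beta>' + \<beta>' + (1, 1, 1)) =
          (if \<beta>' = \<beta> then lookup (F * single \<alpha> 1) (\<beta> + \<beta> + (1, 1, 1)) else 0)" for \<beta>'
        by (simp add: v_def lookup_single when_def)
      then show ?thesis using \<beta> finite_Idx by (simp add: sum.delta)
    qed
    also have "\<dots> = lookup (restrict_keys negative (G * v\<^sup>2)) (neg_exp \<alpha>)"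
      by (rule lookup_frobenius[OF char2, symmetric]) (simp add: v_def top_part_single \<beta>)
    also have "restrict_keys negative (G * v\<^sup>2) = (\<Sum>j<N. single 0 ((r \<beta> j)\<^sup>2) * restrict_keys negative (G * (b j)\<^sup>2))"
      unfolding sq sum_distrib_left restrict_keys_sum mult.left_commute[of G] restrict_keys_const ..
    also have "\<dots> = (\<Sum>j<N. single 0 ((r \<beta> j)\<^sup>2) * (\<Sum>i<N. single 0 (M $$ (i, j)) * b i))"
      by (simp add: frobenius_b)
    also have "lookup \<dots> (neg_exp \<alpha>) =
        (\<Sum>j<N. \<Sum>i<N. (r \<beta> j)\<^sup>2 * ((\<Sum>l<\<rho>. u i l * y l j) * lookup (b i) (neg_exp \<alpha>)))"
      by (simp add: lookup_sum lookup_const_times uy \<rho>_def sum_distrib_left)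
    also have "\<dots> = (\<Sum>j<N. \<Sum>i<N. \<Sum>l<\<rho>. (u i l * lookup (b i) (neg_exp \<alpha>)) * (y l j * (r \<beta> j)\<^sup>2))"
      by (simp add: sum_distrib_left sum_distrib_right mult_ac)
    also have "\<dots> = (\<Sum>j<N. \<Sum>l<\<rho>. \<Sum>i<N. (u i l * lookup (b i) (neg_exp \<alpha>)) * (y l j * (r \<beta> j)\<^sup>2))"
      by (intro sum.cong refl sum.swap)
    also have "\<dots> = (\<Sum>l<\<rho>. \<Sum>j<N. \<Sum>i<N. (u i l * lookup (b i) (neg_exp \<alpha>)) * (y l j * (r \<beta> j)\<^sup>2))"
      by (rule sum.swap)
    also have "\<dots> = (\<Sum>l<\<rho>. (\<Sum>i<N. u i l * lookup (b i) (neg_exp \<alpha>)) * (\<Sum>j<N. y l j * (r \<beta> j)\<^sup>2))"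
      by (subst sum.swap) (simp only: sum_product)
    finally show ?thesis .
  qed
  then show ?thesis
    unfolding \<rho>_def[symmetric]
    by (intro exI[of _ "\<lambda>l \<alpha>. \<Sum>i<N. u i l * lookup (b i) (neg_exp \<alpha>)"] exI[of _ "\<lambda>l \<beta>. \<Sum>j<N. y l j * (r \<beta> j)\<^sup>2"])
      blast
qed

text \<open>If \<open>D = 0\<close>, the image of Frobenius involves no monomial \<open>neg_exp (\<kappa> + \<kappa>)\<close>.\<close>

lemma hasse_witt_rank_le:
  assumes D: "\<And>\<kappa>. lookup F (\<kappa> + \<kappa> + (1, 1, 1)) = 0"
  shows "vec_space.rank N M \<le> card {\<gamma> \<in> Idx. \<forall>\<kappa>. \<gamma> \<noteq> \<kappa> + \<kappa>}"
proof -
  define I where "I = {\<gamma> \<in> Idx. \<forall>\<kappa>. \<gamma> \<noteq> \<kappa> + \<kappa>}"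
  have finI: "finite I" using finite_Idx by (simp add: I_def)
  obtain r where r: "\<And>\<beta>. \<beta> \<in> Idx \<Longrightarrow> single (neg_exp \<beta>) 1 = (\<Sum>j<N. single 0 (r \<beta> j) * b j)"
    using monomial_coords by blast
  define y where "y j \<gamma> = lookup (restrict_keys negative (G * (b j)\<^sup>2)) (neg_exp \<gamma>)" for j \<gamma>
  \<comment> \<open>\<open>M\<close> factors through the monomials indexed by \<open>I\<close>:
    \<open>y j\<close> lists the coefficients of the image of the \<open>j\<close>-th basis vector
    there, and \<open>r\<close> converts them back to the basis.\<close>
  have "M $$ (i, j) = (\<Sum>\<gamma>\<in>I. r \<gamma> i * y j \<gamma>)" if i: "i < N" and j: "j < N" for i j
  proof -
    have tb: "top_part (b j)" using top_part_connecting bs_cocycles(2)[OF j] by blast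
    have "y j (\<kappa> + \<kappa>) = 0" for \<kappa>
    proof -
      have "lookup (F * single (\<kappa> + \<kappa>) 1) (\<beta> + \<beta> + (1, 1, 1)) = 0" for \<beta>
      proof (rule ccontr)
        assume "\<not> ?thesis"
        then have "\<beta> + \<beta> + (1, 1, 1) \<in> keys (single (\<kappa> + \<kappa>) 1 * F)" by (simp add: in_keys_iff mult.commute)
        then obtain l where l: "\<beta> + \<beta> + (1, 1, 1) = \<kappa> + \<kappa> + l" "l \<in> keys F"
          using keys_single_times[of "\<kappa> + \<kappa>" 1 F] by blast
        \<comment> \<open>The truncated differences are exact: an entry of \<beta> smaller than that
          of \<kappa> would make the entry of \<open>l\<close> negative.\<close>
        have "l = (\<beta> - \<kappa>) + (\<beta> - \<kappa>) + (1, 1, 1)"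
          using l(1) by (cases \<beta>; cases \<kappa>; cases l) (auto; presburger)
        then show False using D l(2) by (metis in_keys_iff)
      qed
      then show ?thesis unfolding y_def lookup_frobenius[OF char2 tb] by simp
    qed
    then have y0: "y j \<gamma> = 0" if "\<gamma> \<in> Idx - I" for \<gamma> using that by (auto simp: I_def)
    have "restrict_keys negative (G * (b j)\<^sup>2) = (\<Sum>\<gamma>\<in>I. single (neg_exp \<gamma>) (y j \<gamma>))"
    proof (rule top_part_eqI)
      show "top_part (restrict_keys negative (G * (b j)\<^sup>2))"
        unfolding frobenius_b[OF j]
        by (intro top_part_sum top_part_const top_part_connecting bs_cocycles) simp
      show "top_part (\<Sum>\<gamma>\<in>I. single (neg_exp \<gamma>) (y j \<gamma>))"
        by (intro top_part_sum top_part_single) (simp add: I_def)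
      fix \<beta> assume "\<beta> \<in> Idx"
      then show "lookup (restrict_keys negative (G * (b j)\<^sup>2)) (neg_exp \<beta>) =
          lookup (\<Sum>\<gamma>\<in>I. single (neg_exp \<gamma>) (y j \<gamma>)) (neg_exp \<beta>)"
        using y0[of \<beta>] finI unfolding y_def[symmetric]
        by (auto simp: lookup_sum lookup_single when_def sum.delta)
    qed
    also have "\<dots> = (\<Sum>\<gamma>\<in>I. single 0 (y j \<gamma>) * single (neg_exp \<gamma>) 1)" by (simp add: mult_single)
    also have "\<dots> = (\<Sum>\<gamma>\<in>I. \<Sum>i<N. single 0 (r \<gamma> i * y j \<gamma>) * b i)"
    proof (rule sum.cong)
      fix \<gamma> assume "\<gamma> \<in> I"
      then have "\<gamma> \<in> Idx" by (simp add: I_def)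
      have "single 0 (y j \<gamma>) * (single 0 (r \<gamma> i) * b i) = single 0 (r \<gamma> i * y j \<gamma>) * b i" for i
        by (simp add: mult_single mult.commute[of "y j \<gamma>"] flip: mult.assoc)
      then show "single 0 (y j \<gamma>) * single (neg_exp \<gamma>) 1 = (\<Sum>i<N. single 0 (r \<gamma> i * y j \<gamma>) * b i)"
        unfolding r[OF \<open>\<gamma> \<in> Idx\<close>] by (simp add: sum_distrib_left)
    qed simp
    also have "\<dots> = (\<Sum>i<N. single 0 (\<Sum>\<gamma>\<in>I. r \<gamma> i * y j \<gamma>) * b i)"
    proof -
      have sum_single: "single 0 (\<Sum>\<gamma>\<in>I. f \<gamma>) = (\<Sum>\<gamma>\<in>I. single 0 (f \<gamma>))" for f :: "_ \<Rightarrow> 'k"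
        by (rule poly_mapping_eqI) (auto simp: lookup_sum lookup_single when_def)
      show ?thesis by (subst sum.swap) (simp only: sum_single sum_distrib_right)
    qed
    finally show ?thesis
      unfolding frobenius_b[OF j]
      by (rule b_independent[where r = "\<lambda>i. M $$ (i, j)" and s = "\<lambda>i. \<Sum>\<gamma>\<in>I. r \<gamma> i * y j \<gamma>"]) (rule i)
  qed
  then show ?thesis
    unfolding I_def[symmetric]
    using vec_space.rank_le_factorization[OF M_carrier finI, of "\<lambda>i \<gamma>. r \<gamma> i" "\<lambda>\<gamma> j. y j \<gamma>"] by blast
qed

end

end

lemma lookup_homogenize:
  assumes "keys f \<subseteq> {(i, j). i + j \<le> d}"
  shows "lookup (homogenize d f) (i, j, l) = (if i + j + l = d then lookup f (i, j) else 0)"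
proof -
  have "lookup (homogenize d f) (i, j, l) =
      (\<Sum>k\<in>keys f. if k = (i, j) \<and> i + j + l = d then lookup f (i, j) else 0)"
    unfolding homogenize_def lookup_sum
  proof (rule sum.cong)
    fix k assume "k \<in> keys f"
    then show "lookup (case k of (i, j) \<Rightarrow> single (i, j, d - (i + j)) (lookup f (i, j))) (i, j, l) =
        (if k = (i, j) \<and> i + j + l = d then lookup f (i, j) else 0)"
      using assms by (cases k) (auto simp: lookup_single when_def)
  qed simp
  also have "\<dots> = (if i + j + l = d then lookup f (i, j) else 0)"
    by (cases "i + j + l = d") (auto simp: sum.delta in_keys_iff)
  finally show ?thesis .
qed

theorem theorem16:
  fixes f :: "(nat \<times> nat) \<Rightarrow>\<^sub>0 'k::field" and d g :: nat
  assumes "perfect_field TYPE('k)" and "CHAR('k) = 2"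
    and "3 \<le> d" and "odd d"
    and "Poly_Mapping.keys f \<subseteq> {(i, j). i + j \<le> d}"
    and "smooth_plane_curve (homogenize d f)"
    and "g = (d - 1) * (d - 2) div 2"
  shows "has_genus (homogenize d f) g \<and>
    of_nat g - ((of_nat d)\<^sup>2 - 1) / 8 = (3 / 8 :: rat) * (of_nat d - 1) * (of_nat d - 3) \<and>
    (\<forall>bs. H1_basis (homogenize d f) bs \<longrightarrow>
      (let r = of_nat (vec_space.rank (length bs) (hasse_witt_matrix (homogenize d f) bs)) :: rat
       in r \<ge> of_nat g - ((of_nat d)\<^sup>2 - 1) / 8 \<and>
          (r = of_nat g - ((of_nat d)\<^sup>2 - 1) / 8 \<longleftrightarrow>
             (\<forall>i j. odd i \<and> odd j \<longrightarrow> Poly_Mapping.lookup f (i, j) = 0))))"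
proof -
  define F where "F = homogenize d f"
  obtain m where m: "d = 2 * m + 1" using assms(4) by (elim oddE)
  have m1: "m \<ge> 1" using assms(3) m by simp
  note lookup_F = lookup_homogenize[OF assms(5), folded F_def]
  have form: "form 0 d F"
    unfolding form_def by (auto simp: in_keys_iff lookup_F split: if_splits)
  have "F \<noteq> 0"
  proof
    assume "F = 0"
    then have "eval3 F x y z = 0" "eval3 (deriv_X F) x y z = 0" "eval3 (deriv_Y F) x y z = 0"
      "eval3 (deriv_Z F) x y z = 0" for x y z
      by (simp_all add: eval3_def deriv_X_def deriv_Y_def deriv_Z_def)
    moreover have "((1, 0, 0) :: 'k alg_closure \<times> 'k alg_closure \<times> 'k alg_closure) \<noteq> (0, 0, 0)" by simp
    ultimately show False using assms(6) unfolding F_def[symmetric] smooth_plane_curve_def by blast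
  qed
  then interpret plane_curve F d using form by unfold_locales
  have Idx: "Idx = {k. tdeg k + 2 = 2 * m}" unfolding Idx_def by (auto simp: m)
  define n where "n = card {k. tdeg k + 2 = m}"
  have n: "2 * n = m * (m - 1)" using card_tdeg_2[of m] by (simp add: n_def)
  have cI: "card Idx = g"
    unfolding Idx using card_tdeg_2[of "2 * m"] assms(7) by (simp add: m)
  have real_g: "2 * g = 2 * m * (2 * m - 1)" using card_tdeg_2[of "2 * m"] cI unfolding Idx by simp
  have g_rat: "(of_nat g :: rat) = of_nat m * (2 * of_nat m - 1)"
  proof -
    have "g = m * (2 * m - 1)" using real_g by simp
    then show ?thesis using m1 by (simp add: of_nat_diff)
  qed
  have n_rat: "2 * (of_nat n :: rat) = of_nat m * (of_nat m - 1)"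
  proof -
    have "(of_nat (2 * n) :: rat) = of_nat (m * (m - 1))" using n by simp
    then show ?thesis using m1 by (simp add: of_nat_diff)
  qed
  have d_rat: "(of_nat d :: rat) = 2 * of_nat m + 1" by (simp add: m)
  \<comment> \<open>Both sides equal \<open>3 m (m - 1) / 2\<close>, with
    \<open>m = (d - 1) / 2\<close>.\<close>
  have bound: "(of_nat g :: rat) - ((of_nat d)\<^sup>2 - 1) / 8 = of_nat (3 * n)"
    using n_rat by (simp add: g_rat d_rat power2_eq_square field_simps)
  \<comment> \<open>As \<open>d\<close> is odd, odd exponents of \<open>x\<close> and
    \<open>y\<close> force an odd exponent of the homogenizing variable.\<close>
  have D_iff: "(\<forall>k. lookup F (k + k + (1, 1, 1)) = 0) \<longleftrightarrow> (\<forall>i j. odd i \<and> odd j \<longrightarrow> lookup f (i, j) = 0)"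
  proof
    assume D: "\<forall>k. lookup F (k + k + (1, 1, 1)) = 0"
    show "\<forall>i j. odd i \<and> odd j \<longrightarrow> lookup f (i, j) = 0"
    proof (intro allI impI)
      fix i j :: nat assume ij: "odd i \<and> odd j"
      show "lookup f (i, j) = 0"
      proof (cases "i + j \<le> d")
        case True
        define l where "l = d - (i + j)"
        have "odd l" using ij assms(4) True by (simp add: l_def)
        then have "(i, j, l) = (i div 2, j div 2, l div 2) + (i div 2, j div 2, l div 2) + (1, 1, 1)"
          using ij by (simp, presburger)
        then have "lookup F (i, j, l) = 0" using D by metis
        then show ?thesis using True by (simp add: lookup_F l_def)
      next
        case False
        then show ?thesis using assms(5) by (auto simp: in_keys_iff)
      qed
    qed
  next
    assume o: "\<forall>i j. odd i \<and> odd j \<longrightarrow> lookup f (i, j) = 0"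
    show "\<forall>k. lookup F (k + k + (1, 1, 1)) = 0"
    proof
      fix k :: "nat \<times> nat \<times> nat"
      show "lookup F (k + k + (1, 1, 1)) = 0" using o by (cases k) (simp add: lookup_F)
    qed
  qed
  have rank: "vec_space.rank (length bs) (hasse_witt_matrix F bs) \<ge> 3 * n \<and>
      (vec_space.rank (length bs) (hasse_witt_matrix F bs) = 3 * n \<longleftrightarrow>
        (\<forall>k. lookup F (k + k + (1, 1, 1)) = 0))" if basis: "H1_basis F bs" for bs
  proof -
    define \<rho> where "\<rho> = vec_space.rank (length bs) (hasse_witt_matrix F bs)"
    obtain c w where cw: "\<And>\<alpha> \<beta>. \<alpha> \<in> Idx \<Longrightarrow> \<beta> \<in> Idx \<Longrightarrow>
        lookup (F * single \<alpha> 1) (\<beta> + \<beta> + (1, 1, 1)) = (\<Sum>l<\<rho>. c l \<alpha> * w l \<beta>)"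
      using hasse_witt_factorization[OF assms(2) basis] unfolding \<rho>_def by blast
    have lower: "3 * n + (if \<forall>k. lookup F (k + k + (1, 1, 1)) = 0 then 0 else 1) \<le> \<rho>"
      unfolding n_def
    proof (rule factorization_bound[OF assms(2)])
      show "form 0 (2 * m + 1) F" using form m by simp
      show "smooth_plane_curve F" using assms(6) by (simp add: F_def)
      show "lookup (F * single \<alpha> 1) (\<beta> + \<beta> + (1, 1, 1)) = (\<Sum>l<\<rho>. c l \<alpha> * w l \<beta>)"
        if "tdeg \<alpha> + 2 = 2 * m" "tdeg \<beta> + 2 = 2 * m" for \<alpha> \<beta>
        using cw that unfolding Idx by blast
    qed
    have upper: "\<rho> \<le> 3 * n" if D: "\<forall>k. lookup F (k + k + (1, 1, 1)) = 0"
    proof -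
      \<comment> \<open>The exponents in \<open>Idx\<close> with all entries even are the doubles of
        those of degree \<open>m - 1\<close>. They number
        \<open>m (m + 1) / 2 = (d^2 - 1) / 8\<close>, exactly the gap between the genus and
        \<open>3 n\<close>.\<close>
      define E where "E = (\<lambda>k. k + k) ` {k. tdeg k + 2 = m + 1}"
      have "inj_on (\<lambda>k :: nat \<times> nat \<times> nat. k + k) {k. tdeg k + 2 = m + 1}"
        using inj_double[of 0] by (simp add: inj_on_def)
      then have cE: "card E = card {k. tdeg k + 2 = m + 1}" unfolding E_def by (rule card_image)
      have "finite E"
        unfolding E_def by (intro finite_imageI finite_subset[OF _ finite_tdeg[of "m - 1"]]) auto
      moreover have "\<kappa> + \<kappa> \<in> Idx \<longleftrightarrow> \<kappa> \<in> {k. tdeg k + 2 = m + 1}" for \<kappa>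
        unfolding Idx mem_Collect_eq tdeg_add by arith
      then have E: "E = {\<gamma> \<in> Idx. \<exists>\<kappa>. \<gamma> = \<kappa> + \<kappa>}" unfolding E_def by blast
      then have "{\<gamma> \<in> Idx. \<forall>\<kappa>. \<gamma> \<noteq> \<kappa> + \<kappa>} = Idx - E" by blast
      moreover have "E \<subseteq> Idx" using E by blast
      ultimately have "card {\<gamma> \<in> Idx. \<forall>\<kappa>. \<gamma> \<noteq> \<kappa> + \<kappa>} = g - card E"
        using card_Diff_subset[of E Idx] cI by simp
      moreover have "2 * card E = (m + 1) * m" using card_tdeg_2[of "m + 1"] by (simp add: cE)
      moreover have "2 * g = (m + 1) * m + 2 * (3 * n)"
      proof -
        obtain m' where "m = Suc m'" using m1 by (cases m) auto
        then show ?thesis using real_g n by (simp add: algebra_simps)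
      qed
      moreover have "\<rho> \<le> card {\<gamma> \<in> Idx. \<forall>\<kappa>. \<gamma> \<noteq> \<kappa> + \<kappa>}"
        unfolding \<rho>_def by (rule hasse_witt_rank_le[OF assms(2) basis]) (use D in blast)
      ultimately show ?thesis by linarith
    qed
    show ?thesis
      using lower upper unfolding \<rho>_def[symmetric] by (auto split: if_splits)
  qed
  have "has_genus F g" using has_genus_card cI by simp
  moreover have "(of_nat g :: rat) - ((of_nat d)\<^sup>2 - 1) / 8 = (3 / 8) * (of_nat d - 1) * (of_nat d - 3)"
    by (simp add: g_rat d_rat power2_eq_square field_simps)
  moreover have "(let r = of_nat (vec_space.rank (length bs) (hasse_witt_matrix F bs)) :: rat
       in r \<ge> of_nat g - ((of_nat d)\<^sup>2 - 1) / 8 \<and>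
          (r = of_nat g - ((of_nat d)\<^sup>2 - 1) / 8 \<longleftrightarrow>
             (\<forall>i j. odd i \<and> odd j \<longrightarrow> lookup f (i, j) = 0)))" if "H1_basis F bs" for bs
    using rank[OF that] unfolding Let_def bound D_iff of_nat_le_iff of_nat_eq_iff .
  ultimately show ?thesis unfolding F_def[symmetric] by blast
qed

end
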